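(* (1) Every normal sub-Lorentzian nonspacelike (timelike or isotropic) extremal in $(\mathrm{GL}^+(2,\mathbb{C}),d)$ with origin $e$ is a geodesic. It is either the 1-parameter subgroup $g(t)=2e^{t/2}e_0=e^{t/2}I$, or, up to proportional reparametrization, a curve of the form $g(t)=e^{t/2}\gamma(t)$, $t\in\mathbb{R}$, future directed nonspacelike, where $\gamma(t)$, $t\in\mathbb{R}$, $\gamma(0)=e$, is a geodesic in $(\mathrm{SL}(2,\mathbb{C}),\rho)$ parametrized proportionally to the arclength. (2) In the second case, a segment $g(t)$, $0\le t\le t_0$, of the geodesic is a longest arc in $(\mathrm{GL}^+(2,\mathbb{C}),d)$ if and only if the segment $\gamma(t)$, $0\le t\le t_0$, is a shortest arc in $(\mathrm{SL}(2,\mathbb{C}),\rho)$. (3) Each segment of a normal sub-Lorentzian extremal in $(\mathrm{GL}^+(2,\mathbb{C}),d)$ with origin $e$, which is a longest arc, is one of the following: a segment of $g(t)=2e^{t/2}e_0$; a timelike curve $g(t)=e^{\cosh(c)t/2}\gamma(\sinh(c)t)$, $0\le t\le k$, with $c>0$, $k>0$, where $\gamma(s)$, $0\le s\le k\sinh(c)$, is a shortest arc in $(\mathrm{SL}(2,\mathbb{C}),\rho)$ parametrized by arclength with $\gamma(0)=e$; or an isotropic curve $g(t)=e^{t/2}\gamma(t)$, $0\le t\le\xi$, where $\gamma(t)$, $0\le t\le \xi$, is a shortest arc in $(\mathrm{SL}(2,\mathbb{C}),\rho)$ parametrized by arclength with $\gamma(0)=e$.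
   Context: $\mathrm{GL}^+(2,\mathbb{C})$ is the Lie group of complex $2\times2$ matrices with positive real determinant, with unit $e=I$; its Lie algebra $\mathfrak{g}=\mathfrak{gl}^+(2,\mathbb{C})$ (complex $2\times2$ matrices with real trace) has the real basis $e_0=\frac12 I$, $e_1=\frac12\begin{pmatrix}0&1\\1&0\end{pmatrix}$, $e_2=\frac12\begin{pmatrix}0&\mathbf{i}\\-\mathbf{i}&0\end{pmatrix}$, $e_3=\frac12\begin{pmatrix}1&0\\0&-1\end{pmatrix}$, $e_4=\mathbf{i}e_1$, $e_5=\mathbf{i}e_2$, $e_6=\mathbf{i}e_3$, and the pseudoscalar product with $\langle u,u\rangle=u_0^2-\sum_{k=1}^6u_k^2$ for $u=\sum u_ke_k$. $H=\mathrm{span}_{\mathbb{R}}(e_0,\dots,e_3)$ is the space of Hermitian matrices. $l_g:h\mapsto gh$. A horizontal curve in $\mathrm{GL}^+(2,\mathbb{C})$ is a Lipschitzian curve with $g'(t)=dl_{g(t)}(u(t))$, $u(t)\in H$ for almost all $t$; it is timelike (nonspacelike; isotropic) if for almost all $t$ $\langle u(t),u(t)\rangle>0$ ($\ge0$; $=0$ with $u(t)\ne0$), and future directed if $\langle u(t),e_0\rangle>0$ for almost all $t$. $d(x,y)$ is the supremum of lengths $\int\sqrt{\langle u,u\rangle}\,dt$ of future directed nonspacelike horizontal curves from $x$ to $y$ ($-\infty$ if there are none). A longest arc is a future directed nonspacelike horizontal curve realizing this supremum between its endpoints; a geodesic in $(\mathrm{GL}^+(2,\mathbb{C}),d)$ is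 a Lipschitzian curve which is locally a longest arc. Extremals. Let $U=\{u\in H\mid\langle u,u\rangle\ge1,\langle u,e_0\rangle>0\}$. A normal timelike extremal is a future directed horizontal curve $g(t)$, $t\in\mathbb{R}$, with $\langle u(t),u(t)\rangle=1$ a.e., for which there is an absolutely continuous nowhere vanishing $\psi(t)\in\mathfrak{g}^*$ with, a.e., $\frac{d}{dt}\psi(t)(w)=\psi(t)([u(t),w])$ for all $w\in\mathfrak{g}$ and $\psi(t)(u(t))=\min_{u\in U}\psi(t)(u)=M_0$, $M_0>0$ constant. A normal isotropic extremal is a future directed isotropic horizontal curve $g(t)$, $t\in\mathbb{R}$, with control $u(t)=e_0+w(t)$, $w(t)\in W=\{w\in H\mid\langle w,e_0\rangle=0,\langle w,w\rangle=-1\}$, for which there is an absolutely continuous $\psi(t)\in\mathfrak{g}^*$ with $\psi(t)(e_0)\equiv1$ and, a.e., $\frac{d}{dt}\psi(t)(v)=\psi(t)([u(t),v])$ for all $v\in\mathfrak{g}$, $\psi(t)(w(t))=\min_{w\in W}\psi(t)(w)=-1$. On $\mathrm{SL}(2,\mathbb{C})$: $H_0=\mathrm{span}_{\mathbb{R}}(e_1,e_2,e_3)$ with scalar product $(\cdot,\cdot)$ for which $e_1,e_2,e_3$ are orthonormal; $\rho(x,y)$ is the infimum of lengths $\int_0^a\sqrt{(u,u)}\,dt$ of piecewise continuously differentiable paths from $x$ to $y$ with $\gamma'(t)=dl_{\gamma(t)}(u(t))$, $u(t)\in H_0$. A shortest arc is a horizontal ($u(t)\in H_0$) curve whose length equals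 the distance between its endpoints; a geodesic is a curve that is locally a shortest arc. *)

theory Defs
  imports "HOL-Analysis.Analysis"
begin

type_synonym cmat2 = "complex^2^2"

definition mat2 :: "complex \<Rightarrow> complex \<Rightarrow> complex \<Rightarrow> complex \<Rightarrow> cmat2" where
  "mat2 a b c d = vector [vector [a, b], vector [c, d]]"

definition GL_plus :: "cmat2 set" where
  "GL_plus = {A. det A \<in> \<real> \<and> Re (det A) > 0}"

definition SL :: "cmat2 set" where
  "SL = {A. det A = 1}"

definition gl_plus :: "cmat2 set" where
  "gl_plus = {A. trace A \<in> \<real>}"

definition lie_bracket :: "cmat2 \<Rightarrow> cmat2 \<Rightarrow> cmat2" where
  "lie_bracket u w = u ** w - w ** u"

definition e0 :: cmat2 where "e0 = mat2 (1/2) 0 0 (1/2)"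
definition e1 :: cmat2 where "e1 = mat2 0 (1/2) (1/2) 0"
definition e2 :: cmat2 where "e2 = mat2 0 (\<i>/2) (-\<i>/2) 0"
definition e3 :: cmat2 where "e3 = mat2 (1/2) 0 0 (-1/2)"
definition e4 :: cmat2 where "e4 = mat \<i> ** e1"
definition e5 :: cmat2 where "e5 = mat \<i> ** e2"
definition e6 :: cmat2 where "e6 = mat \<i> ** e3"

definition basis_e :: "nat \<Rightarrow> cmat2" where
  "basis_e k = [e0, e1, e2, e3, e4, e5, e6] ! k"

text \<open>The matrices \<open>basis_e k\<close>, \<open>k \<le> 6\<close>, are pairwise orthogonal of squared norm \<open>1/2\<close> for the
  real inner product of \<open>complex^2^2\<close>, so the following is the \<open>k\<close>-th coordinate in this basis
  (lemma \<open>coord_expansion\<close>).\<close>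

definition coord :: "nat \<Rightarrow> cmat2 \<Rightarrow> real" where
  "coord k u = 2 * (u \<bullet> basis_e k)"

definition pseudo_prod :: "cmat2 \<Rightarrow> cmat2 \<Rightarrow> real" where
  "pseudo_prod u v = coord 0 u * coord 0 v - (\<Sum>k=1..6. coord k u * coord k v)"

definition H :: "cmat2 set" where
  "H = span (basis_e ` {0..3})"

definition H0 :: "cmat2 set" where
  "H0 = span (basis_e ` {1..3})"

definition scalar_prod :: "cmat2 \<Rightarrow> cmat2 \<Rightarrow> real" where
  "scalar_prod u v = (\<Sum>k=1..3. coord k u * coord k v)"

lemmas basis_e_defs = basis_e_def e0_def e1_def e2_def e3_def e4_def e5_def e6_def mat2_def

lemma basis_e_entries:
  "basis_e 0 = mat2 (1/2) 0 0 (1/2)"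
  "basis_e 1 = mat2 0 (1/2) (1/2) 0"
  "basis_e 2 = mat2 0 (\<i>/2) (-\<i>/2) 0"
  "basis_e 3 = mat2 (1/2) 0 0 (-1/2)"
  "basis_e 4 = mat2 0 (\<i>/2) (\<i>/2) 0"
  "basis_e 5 = mat2 0 (-1/2) (1/2) 0"
  "basis_e 6 = mat2 (\<i>/2) 0 0 (-\<i>/2)"
  by (simp_all add: basis_e_defs vec_eq_iff forall_2 matrix_matrix_mult_def mat_def sum_2)

lemma set_upto6: "{0..6::nat} = {0, 1, 2, 3, 4, 5, 6}"
  by auto

lemma coord_expansion:
  assumes "u \<in> gl_plus"
  shows "u = (\<Sum>k=0..6. coord k u *\<^sub>R basis_e k)"
proof -
  have "Im (u$1$1) + Im (u$2$2) = 0"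
    using assms by (simp add: gl_plus_def trace_def sum_2 complex_is_Real_iff)
  then have im: "Im (u$2$2) = - Im (u$1$1)"
    by simp
  show ?thesis
    unfolding set_upto6 coord_def
    by (simp add: basis_e_entries[simplified] mat2_def vec_eq_iff forall_2 complex_eq_iff
        inner_vec_def sum_2 inner_complex_def im field_simps)
qed

lemma gl_plus_eq_span: "gl_plus = span (basis_e ` {0..6})"
proof
  show "gl_plus \<subseteq> span (basis_e ` {0..6})"
  proof
    fix u assume "u \<in> gl_plus"
    then have "u = (\<Sum>k=0..6. coord k u *\<^sub>R basis_e k)"
      by (rule coord_expansion)
    also have "\<dots> \<in> span (basis_e ` {0..6})"
      by (intro span_sum span_scale span_base imageI)
    finally show "u \<in> span (basis_e ` {0..6})" .
  qed
  have sub: "subspace gl_plus"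
    unfolding subspace_def
    by (auto simp: gl_plus_def trace_def sum_2 complex_is_Real_iff simp flip: distrib_left)
  have "basis_e ` {0..6} \<subseteq> gl_plus"
    unfolding set_upto6
    by (simp add: gl_plus_def trace_def sum_2 basis_e_entries[simplified] mat2_def
        complex_is_Real_iff)
  with sub show "span (basis_e ` {0..6}) \<subseteq> gl_plus"
    by (rule span_minimal[rotated])
qed

text \<open>The control \<open>u\<close> in \<open>g' = g u\<close>; meaningful wherever \<open>g\<close> is differentiable.\<close>

definition control :: "(real \<Rightarrow> cmat2) \<Rightarrow> real \<Rightarrow> cmat2" where
  "control g t = matrix_inv (g t) ** vector_derivative g (at t)"

text \<open>The parameter domain \<open>S\<close> is an interval. Conditions ``for almost all \<open>t \<in> S\<close>'' are imposed on
  the interior, so that only the values of \<open>g\<close> on \<open>S\<close> matter. Curves are Lipschitzian on compact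
  subintervals; there the norm distance of matrices and any Riemannian distance on the group are
  equivalent along the curve.\<close>

abbreviation ae_on :: "real set \<Rightarrow> (real \<Rightarrow> bool) \<Rightarrow> bool" where
  "ae_on S P \<equiv> (AE t in lebesgue. t \<in> interior S \<longrightarrow> P t)"

definition lipschitzian_on :: "real set \<Rightarrow> (real \<Rightarrow> cmat2) \<Rightarrow> bool" where
  "lipschitzian_on S g \<longleftrightarrow> (\<forall>a b. {a..b} \<subseteq> S \<longrightarrow> (\<exists>L. L-lipschitz_on {a..b} g))"

definition horizontal_on :: "real set \<Rightarrow> (real \<Rightarrow> cmat2) \<Rightarrow> bool" where
  "horizontal_on S g \<longleftrightarrow> g ` S \<subseteq> GL_plus \<and> lipschitzian_on S g \<and>
     ae_on S (\<lambda>t. g differentiable (at t) \<and> control g t \<in> H)"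

definition timelike_on :: "real set \<Rightarrow> (real \<Rightarrow> cmat2) \<Rightarrow> bool" where
  "timelike_on S g \<longleftrightarrow> horizontal_on S g \<and>
     ae_on S (\<lambda>t. pseudo_prod (control g t) (control g t) > 0)"

definition nonspacelike_on :: "real set \<Rightarrow> (real \<Rightarrow> cmat2) \<Rightarrow> bool" where
  "nonspacelike_on S g \<longleftrightarrow> horizontal_on S g \<and>
     ae_on S (\<lambda>t. pseudo_prod (control g t) (control g t) \<ge> 0)"

definition isotropic_on :: "real set \<Rightarrow> (real \<Rightarrow> cmat2) \<Rightarrow> bool" where
  "isotropic_on S g \<longleftrightarrow> horizontal_on S g \<and>
     ae_on S (\<lambda>t. pseudo_prod (control g t) (control g t) = 0 \<and> control g t \<noteq> 0)"

definition future_directed_on :: "real set \<Rightarrow> (real \<Rightarrow> cmat2) \<Rightarrow> bool" where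
  "future_directed_on S g \<longleftrightarrow> horizontal_on S g \<and>
     ae_on S (\<lambda>t. pseudo_prod (control g t) e0 > 0)"

definition lorentz_length :: "(real \<Rightarrow> cmat2) \<Rightarrow> real \<Rightarrow> real \<Rightarrow> real" where
  "lorentz_length g a b = integral {a..b} (\<lambda>t. sqrt (pseudo_prod (control g t) (control g t)))"

text \<open>In the extended reals, \<open>Sup {} = -\<infinity>\<close>.\<close>

definition lorentz_dist :: "cmat2 \<Rightarrow> cmat2 \<Rightarrow> ereal" where
  "lorentz_dist x y = Sup {ereal (lorentz_length g a b) | g a b.
     a < b \<and> future_directed_on {a..b} g \<and> nonspacelike_on {a..b} g \<and> g a = x \<and> g b = y}"

definition longest_arc :: "(real \<Rightarrow> cmat2) \<Rightarrow> real \<Rightarrow> real \<Rightarrow> bool" where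
  "longest_arc g a b \<longleftrightarrow> a < b \<and> future_directed_on {a..b} g \<and> nonspacelike_on {a..b} g \<and>
     ereal (lorentz_length g a b) = lorentz_dist (g a) (g b)"

text \<open>Geodesics are only needed for curves defined on the whole real line.\<close>

definition GL_geodesic :: "(real \<Rightarrow> cmat2) \<Rightarrow> bool" where
  "GL_geodesic g \<longleftrightarrow> lipschitzian_on UNIV g \<and>
     (\<forall>t. \<exists>\<epsilon>>0. longest_arc g (t - \<epsilon>) (t + \<epsilon>))"

definition riem_length :: "(real \<Rightarrow> cmat2) \<Rightarrow> real \<Rightarrow> real \<Rightarrow> real" where
  "riem_length \<gamma> a b = integral {a..b} (\<lambda>t. sqrt (scalar_prod (control \<gamma> t) (control \<gamma> t)))"

text \<open>The library's \<open>piecewise_C1_differentiable_on\<close> does not bound the derivative near the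
  breakpoints, so it admits curves of infinite length; here each piece is \<open>C\<^sup>1\<close> up to its
  endpoints.\<close>

definition piecewise_C1_on :: "real \<Rightarrow> real \<Rightarrow> (real \<Rightarrow> cmat2) \<Rightarrow> bool" where
  "piecewise_C1_on a b \<gamma> \<longleftrightarrow>
     (\<exists>P. finite P \<and> P \<subseteq> {a..b} \<and> a \<in> P \<and> b \<in> P \<and>
        (\<forall>c\<in>P. \<forall>d\<in>P. c < d \<and> {c<..<d} \<inter> P = {} \<longrightarrow>
           (\<exists>D. continuous_on {c..d} D \<and>
              (\<forall>t\<in>{c..d}. (\<gamma> has_vector_derivative D t) (at t within {c..d})))))"

definition SL_horizontal_on :: "real set \<Rightarrow> (real \<Rightarrow> cmat2) \<Rightarrow> bool" where
  "SL_horizontal_on S \<gamma> \<longleftrightarrow> \<gamma> ` S \<subseteq> SL \<and> lipschitzian_on S \<gamma> \<and>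
     ae_on S (\<lambda>t. \<gamma> differentiable (at t) \<and> control \<gamma> t \<in> H0)"

definition riem_dist :: "cmat2 \<Rightarrow> cmat2 \<Rightarrow> ereal" where
  "riem_dist x y = Inf {ereal (riem_length \<gamma> 0 a) | \<gamma> a.
     a > 0 \<and> piecewise_C1_on 0 a \<gamma> \<and> SL_horizontal_on {0..a} \<gamma> \<and> \<gamma> 0 = x \<and> \<gamma> a = y}"

definition shortest_arc :: "(real \<Rightarrow> cmat2) \<Rightarrow> real \<Rightarrow> real \<Rightarrow> bool" where
  "shortest_arc \<gamma> a b \<longleftrightarrow> a < b \<and> SL_horizontal_on {a..b} \<gamma> \<and>
     ereal (riem_length \<gamma> a b) = riem_dist (\<gamma> a) (\<gamma> b)"

definition SL_geodesic :: "(real \<Rightarrow> cmat2) \<Rightarrow> bool" where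
  "SL_geodesic \<gamma> \<longleftrightarrow> (\<forall>t. \<exists>\<epsilon>>0. shortest_arc \<gamma> (t - \<epsilon>) (t + \<epsilon>))"

text \<open>Parametrization proportional to the arclength with factor (speed) \<open>\<sigma>\<close>;
  \<open>\<sigma> = 1\<close> is parametrization by arclength.\<close>

definition arclength_param_on :: "real set \<Rightarrow> real \<Rightarrow> (real \<Rightarrow> cmat2) \<Rightarrow> bool" where
  "arclength_param_on S \<sigma> \<gamma> \<longleftrightarrow> (\<forall>a\<in>S. \<forall>b\<in>S. a \<le> b \<longrightarrow> riem_length \<gamma> a b = \<sigma> * (b - a))"

text \<open>Elements of the dual of \<open>gl_plus\<close> are functions on matrices of which only the restriction
  to \<open>gl_plus\<close> matters.\<close>

definition gl_dual :: "(cmat2 \<Rightarrow> real) \<Rightarrow> bool" where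
  "gl_dual \<phi> \<longleftrightarrow> (\<forall>v\<in>gl_plus. \<forall>w\<in>gl_plus. \<phi> (v + w) = \<phi> v + \<phi> w) \<and>
     (\<forall>r. \<forall>v\<in>gl_plus. \<phi> (r *\<^sub>R v) = r * \<phi> v)"

text \<open>\<open>\<D>\<close> below is a finite family of nonoverlapping nonempty compact intervals.\<close>

definition abs_continuous_on_interval :: "real \<Rightarrow> real \<Rightarrow> (real \<Rightarrow> real) \<Rightarrow> bool" where
  "abs_continuous_on_interval a b f \<longleftrightarrow>
     (\<forall>\<epsilon>>0. \<exists>\<delta>>0. \<forall>\<D>. \<D> division_of \<Union>\<D> \<and> \<Union>\<D> \<subseteq> {a..b} \<and> (\<Sum>K\<in>\<D>. Sup K - Inf K) < \<delta> \<longrightarrow>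
        (\<Sum>K\<in>\<D>. \<bar>f (Sup K) - f (Inf K)\<bar>) < \<epsilon>)"

text \<open>Absolute continuity of a curve in the finite-dimensional dual space, tested on vectors.\<close>

definition abs_continuous_covector :: "(real \<Rightarrow> cmat2 \<Rightarrow> real) \<Rightarrow> bool" where
  "abs_continuous_covector \<psi> \<longleftrightarrow>
     (\<forall>w\<in>gl_plus. \<forall>a b. abs_continuous_on_interval a b (\<lambda>t. \<psi> t w))"

definition adjoint_equation :: "(real \<Rightarrow> cmat2) \<Rightarrow> (real \<Rightarrow> cmat2 \<Rightarrow> real) \<Rightarrow> bool" where
  "adjoint_equation g \<psi> \<longleftrightarrow>
     ae_on UNIV (\<lambda>t. \<forall>w\<in>gl_plus.
       ((\<lambda>s. \<psi> s w) has_real_derivative \<psi> t (lie_bracket (control g t) w)) (at t))"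

definition U :: "cmat2 set" where
  "U = {u \<in> H. pseudo_prod u u \<ge> 1 \<and> pseudo_prod u e0 > 0}"

definition W :: "cmat2 set" where
  "W = {w \<in> H. pseudo_prod w e0 = 0 \<and> pseudo_prod w w = -1}"

definition normal_timelike_extremal :: "(real \<Rightarrow> cmat2) \<Rightarrow> bool" where
  "normal_timelike_extremal g \<longleftrightarrow> future_directed_on UNIV g \<and>
     ae_on UNIV (\<lambda>t. pseudo_prod (control g t) (control g t) = 1) \<and>
     (\<exists>\<psi> M0. M0 > 0 \<and> (\<forall>t. gl_dual (\<psi> t)) \<and> (\<forall>t. \<exists>w\<in>gl_plus. \<psi> t w \<noteq> 0) \<and>
        abs_continuous_covector \<psi> \<and> adjoint_equation g \<psi> \<and>
        ae_on UNIV (\<lambda>t. is_arg_min (\<psi> t) (\<lambda>v. v \<in> U) (control g t) \<and> \<psi> t (control g t) = M0))"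

definition normal_isotropic_extremal :: "(real \<Rightarrow> cmat2) \<Rightarrow> bool" where
  "normal_isotropic_extremal g \<longleftrightarrow> future_directed_on UNIV g \<and> isotropic_on UNIV g \<and>
     ae_on UNIV (\<lambda>t. control g t - e0 \<in> W) \<and>
     (\<exists>\<psi>. (\<forall>t. gl_dual (\<psi> t)) \<and> (\<forall>t. \<psi> t e0 = 1) \<and>
        abs_continuous_covector \<psi> \<and> adjoint_equation g \<psi> \<and>
        ae_on UNIV (\<lambda>t. is_arg_min (\<psi> t) (\<lambda>v. v \<in> W) (control g t - e0) \<and>
          \<psi> t (control g t - e0) = -1))"

definition normal_extremal :: "(real \<Rightarrow> cmat2) \<Rightarrow> bool" where
  "normal_extremal g \<longleftrightarrow> normal_timelike_extremal g \<or> normal_isotropic_extremal g"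

text \<open>\<open>\<sigma> > 0\<close> excludes constant \<open>\<gamma>\<close>, for which the curve is the one-parameter subgroup \<open>e\<^bsup>t/2\<^esup> I\<close>.\<close>

definition lifts_SL_geodesic :: "(real \<Rightarrow> cmat2) \<Rightarrow> real \<Rightarrow> (real \<Rightarrow> cmat2) \<Rightarrow> bool" where
  "lifts_SL_geodesic g \<kappa> \<gamma> \<longleftrightarrow> \<kappa> > 0 \<and> (\<forall>t. g (\<kappa> * t) = exp (t / 2) *\<^sub>R \<gamma> t) \<and>
     future_directed_on UNIV (\<lambda>t. exp (t / 2) *\<^sub>R \<gamma> t) \<and>
     nonspacelike_on UNIV (\<lambda>t. exp (t / 2) *\<^sub>R \<gamma> t) \<and>
     SL_geodesic \<gamma> \<and> \<gamma> 0 = mat 1 \<and> (\<exists>\<sigma>>0. arclength_param_on UNIV \<sigma> \<gamma>)"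

end

theory Submission
  imports Defs
begin

text \<open>
  A matrix with positive determinant is uniquely \<open>g = e\<^bsup>s/2\<^esup> \<gamma>\<close> with \<open>\<gamma> \<in> SL(2)\<close>. As \<open>e0\<close> is central, the control of
  \<open>g\<close> is \<open>s' e0 + v\<close> with \<open>v \<in> H0\<close> the control of \<open>\<gamma>\<close>, and its pseudoscalar square is \<open>s'\<^sup>2 - \<bar>v\<bar>\<^sup>2\<close>. So the
  space is a Lorentzian product of a line of heights \<open>s\<close> with the sub-Riemannian space SL(2), and the
  reverse Cauchy-Schwarz inequality shows that a curve of constant speed over SL(2), lifted with constant slope, is
  longest exactly if its projection is shortest (\<open>longest_arc_lift\<close>, \<open>shortest_arc_of_longest_lift\<close>).

  It remains to see that normal extremals are such lifts and that their projections are locally shortest.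
  By the adjoint equation the covector is constant in the right trivialization (\<open>adjoint_transport\<close>), and the minimum
  condition says that, translated back, its traceless Hermitian part is a multiple of the control (\<open>timelike_minimum\<close>,
  \<open>isotropic_minimum\<close>). Hence there are constants \<open>C\<close> and \<open>\<sigma>\<close>, with \<open>C\<^sup>2 - \<sigma>\<^sup>2 = 1\<close> in the timelike
  and \<open>C = \<sigma> = 1\<close> in the isotropic case, and a constant matrix \<open>X\<close> such that \<open>g = e\<^bsup>Ct/2\<^esup> \<gamma>\<close>, where the control
  of \<open>\<gamma>\<close> is the traceless Hermitian part of \<open>\<gamma>\<^sup>-\<^sup>1 X \<gamma>\<close> and has length \<open>\<sigma>\<close> (\<open>extremal_structure\<close>). The function
  \<open>2 Re tr(X x \<gamma>(t)\<^sup>-\<^sup>1)\<close> is an approximate calibration of \<open>\<gamma>\<close>, good enough to show that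
  short pieces of \<open>\<gamma>\<close> are shortest (\<open>local_lower_bound\<close>). If \<open>\<sigma> = 0\<close>, the extremal is the one-parameter
  subgroup of \<open>e0\<close>.

  The distance of SL(2) is defined by piecewise \<open>C\<^sup>1\<close> curves, whereas arcs in GL+(2) and their projections are
  only Lipschitzian. The two are reconciled by broken paths, products of exponentials of traceless Hermitian matrices:
  every Lipschitzian horizontal curve can be replaced by a broken path that has the same endpoints and is longer
  by at most \<open>\<epsilon>\<close> (\<open>polygon_approximation\<close>), because points near the unit are reached by short broken
  paths (\<open>reach_small\<close>). Derivatives that exist only almost everywhere are integrated by the fundamental theorem
  of calculus for absolutely continuous functions (\<open>AC_FTC\<close>).
\<close>

section \<open>Complex 2x2 matrices\<close>

lemma mat2_nth [simp]:
  "mat2 a b c d $ 1 $ 1 = a" "mat2 a b c d $ 1 $ 2 = b"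
  "mat2 a b c d $ 2 $ 1 = c" "mat2 a b c d $ 2 $ 2 = d"
  by (simp_all add: mat2_def)

lemma cmat2_eq_iff:
  "(A::cmat2) = B \<longleftrightarrow> A$1$1 = B$1$1 \<and> A$1$2 = B$1$2 \<and> A$2$1 = B$2$1 \<and> A$2$2 = B$2$2"
  by (auto simp: vec_eq_iff forall_2)

lemma cmat2_mult_nth:
  "((A::cmat2) ** (B::cmat2)) $ i $ j = A$i$1 * B$1$j + A$i$2 * B$2$j"
  by (simp add: matrix_matrix_mult_def sum_2)

lemma mat_nth_2 [simp]:
  "(mat c :: cmat2)$1$1 = c" "(mat c :: cmat2)$1$2 = 0"
  "(mat c :: cmat2)$2$1 = 0" "(mat c :: cmat2)$2$2 = c"
  by (simp_all add: mat_def)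

lemma inner_cmat2:
  "(A::cmat2) \<bullet> B = Re (A$1$1) * Re (B$1$1) + Im (A$1$1) * Im (B$1$1)
     + Re (A$1$2) * Re (B$1$2) + Im (A$1$2) * Im (B$1$2)
     + Re (A$2$1) * Re (B$2$1) + Im (A$2$1) * Im (B$2$1)
     + Re (A$2$2) * Re (B$2$2) + Im (A$2$2) * Im (B$2$2)"
  by (simp add: inner_vec_def sum_2 inner_complex_def)

lemma norm_cmat2_power2:
  "(norm (A::cmat2))\<^sup>2 = (cmod (A$1$1))\<^sup>2 + (cmod (A$1$2))\<^sup>2 + (cmod (A$2$1))\<^sup>2 + (cmod (A$2$2))\<^sup>2"
  unfolding power2_norm_eq_inner inner_cmat2 inner_complex_def by simp

lemma cmod_dot_le:
  "(cmod (a * c + b * d))\<^sup>2 \<le> ((cmod a)\<^sup>2 + (cmod b)\<^sup>2) * ((cmod c)\<^sup>2 + (cmod d)\<^sup>2)"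
proof -
  have "cmod (a * c + b * d) \<le> cmod a * cmod c + cmod b * cmod d"
    using norm_triangle_ineq[of "a * c" "b * d"] by (simp add: norm_mult)
  then have "(cmod (a * c + b * d))\<^sup>2 \<le> (cmod a * cmod c + cmod b * cmod d)\<^sup>2"
    by (intro power_mono) auto
  also have "\<dots> \<le> ((cmod a)\<^sup>2 + (cmod b)\<^sup>2) * ((cmod c)\<^sup>2 + (cmod d)\<^sup>2)"
    using zero_le_power2[of "cmod a * cmod d - cmod b * cmod c"]
    by (simp add: power2_eq_square algebra_simps)
  finally show ?thesis .
qed

lemma norm_cmat2_mult_le: "norm ((A::cmat2) ** (B::cmat2)) \<le> norm A * norm B"
proof -
  have "(norm (A ** B))\<^sup>2 \<le>
      ((cmod (A$1$1))\<^sup>2 + (cmod (A$1$2))\<^sup>2) * ((cmod (B$1$1))\<^sup>2 + (cmod (B$2$1))\<^sup>2)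
      + ((cmod (A$1$1))\<^sup>2 + (cmod (A$1$2))\<^sup>2) * ((cmod (B$1$2))\<^sup>2 + (cmod (B$2$2))\<^sup>2)
      + ((cmod (A$2$1))\<^sup>2 + (cmod (A$2$2))\<^sup>2) * ((cmod (B$1$1))\<^sup>2 + (cmod (B$2$1))\<^sup>2)
      + ((cmod (A$2$1))\<^sup>2 + (cmod (A$2$2))\<^sup>2) * ((cmod (B$1$2))\<^sup>2 + (cmod (B$2$2))\<^sup>2)"
    unfolding norm_cmat2_power2 cmat2_mult_nth by (intro add_mono cmod_dot_le)
  also have "\<dots> = (norm A * norm B)\<^sup>2"
    unfolding power_mult_distrib norm_cmat2_power2 by (simp add: ring_distribs)
  finally show ?thesis
    by (rule power2_le_imp_le) simp
qed

lemma bounded_bilinear_cmat2_mult: "bounded_bilinear ((**) :: cmat2 \<Rightarrow> cmat2 \<Rightarrow> cmat2)"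
proof
  show "\<exists>K. \<forall>A B. norm ((A::cmat2) ** (B::cmat2)) \<le> norm A * norm B * K"
    using norm_cmat2_mult_le by (intro exI[of _ 1]) auto
  fix A A' B B' :: cmat2 and r :: real
  show "(A + A') ** B = A ** B + A' ** B"
    by (simp add: cmat2_eq_iff cmat2_mult_nth ring_distribs)
  show "A ** (B + B') = A ** B + A ** B'"
    by (simp add: cmat2_eq_iff cmat2_mult_nth ring_distribs)
  show "(r *\<^sub>R A) ** B = r *\<^sub>R (A ** B)" "A ** (r *\<^sub>R B) = r *\<^sub>R (A ** B)"
    by (simp_all add: cmat2_eq_iff cmat2_mult_nth scaleR_right_distrib)
qed

interpretation cmult: bounded_bilinear "(**) :: cmat2 \<Rightarrow> cmat2 \<Rightarrow> cmat2"
  by (rule bounded_bilinear_cmat2_mult)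

text \<open>The adjugate. On SL(2) it is the inverse, and unlike inversion it is linear in the entries, so
  the inverse of a curve in SL(2) is differentiated without further ado.\<close>

definition adj :: "cmat2 \<Rightarrow> cmat2" where
  "adj A = mat2 (A$2$2) (- (A$1$2)) (- (A$2$1)) (A$1$1)"

lemma norm_adj [simp]: "norm (adj A) = norm A"
proof -
  have "(norm (adj A))\<^sup>2 = (norm A)\<^sup>2"
    by (simp add: norm_cmat2_power2 adj_def)
  then show ?thesis by simp
qed

lemma bounded_linear_adj: "bounded_linear adj"
proof
  show "\<exists>K. \<forall>A. norm (adj A) \<le> norm A * K"
    by (intro exI[of _ 1]) auto
qed (simp_all add: cmat2_eq_iff adj_def)

lemma det_cmat2: "det (A::cmat2) = A$1$1 * A$2$2 - A$1$2 * A$2$1"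
  by (simp add: det_2)

lemma adj_mult: "adj ((A::cmat2) ** (B::cmat2)) = adj B ** adj A"
  by (simp add: cmat2_eq_iff cmat2_mult_nth adj_def algebra_simps)

lemma mult_adj: "det A = 1 \<Longrightarrow> A ** adj A = mat 1"
  and adj_mult_self: "det A = 1 \<Longrightarrow> adj A ** A = mat 1"
  by (simp_all add: cmat2_eq_iff cmat2_mult_nth adj_def det_cmat2 algebra_simps)

lemma adj_cancel [simp]:
  assumes "det (A::cmat2) = 1"
  shows "adj A ** (A ** B) = (B::cmat2)" "A ** (adj A ** B) = B"
    "(C::cmat2) ** A ** adj A = C" "C ** adj A ** A = C"
proof -
  show "adj A ** (A ** B) = B" "A ** (adj A ** B) = B"
    using assms by (simp_all only: matrix_mul_assoc adj_mult_self mult_adj matrix_mul_lid)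
  show "C ** A ** adj A = C" "C ** adj A ** A = C"
    using assms by (simp_all only: matrix_mul_assoc[symmetric] adj_mult_self mult_adj matrix_mul_rid)
qed

lemma det_adj [simp]: "det (adj A) = det A"
  by (simp add: det_cmat2 adj_def algebra_simps)

lemma det_scaleR_cmat2: "det (r *\<^sub>R (A::cmat2)) = of_real (r\<^sup>2) * det A"
  by (simp add: det_cmat2 complex_eq_iff algebra_simps power2_eq_square)

lemma det_mult_cmat2: "det ((A::cmat2) ** (B::cmat2)) = det A * det B"
  by (rule det_mul)

lemma matrix_inv_cmat2:
  assumes "(A::cmat2) ** (B::cmat2) = mat 1"
  shows "matrix_inv A = B"
proof -
  have "B ** A = mat 1"
    using assms by (simp add: matrix_left_right_inverse)
  then have "\<exists>C. A ** C = mat 1 \<and> C ** A = mat 1"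
    using assms by auto
  then have "matrix_inv A ** A = mat 1"
    unfolding matrix_inv_def by (rule someI2_ex) auto
  then have "matrix_inv A ** A ** B = B"
    by simp
  then show ?thesis
    using assms by (simp flip: matrix_mul_assoc)
qed

lemma matrix_inv_scaleR_SL:
  assumes "det A = 1" "r \<noteq> 0"
  shows "matrix_inv (r *\<^sub>R A) = (1/r) *\<^sub>R adj A"
  using assms by (intro matrix_inv_cmat2) (simp add: cmult.scaleR_left cmult.scaleR_right mult_adj)

lemma matrix_inv_SL: "det A = 1 \<Longrightarrow> matrix_inv A = adj A"
  by (intro matrix_inv_cmat2) (simp add: mult_adj)

lemma trace_cmat2: "trace (A::cmat2) = A$1$1 + A$2$2"
  by (simp add: trace_def sum_2)

lemma trace_cycle: "trace ((A::cmat2) ** (B::cmat2)) = trace (B ** A)"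
  by (simp add: trace_cmat2 cmat2_mult_nth algebra_simps)

lemma adj_trace0: "trace A = 0 \<Longrightarrow> adj A = - A"
  by (auto simp: cmat2_eq_iff adj_def trace_cmat2 add_eq_0_iff)

section \<open>Hermitian matrices and the two scalar products\<close>

lemma H0_iff: "u \<in> H0 \<longleftrightarrow> Im (u$1$1) = 0 \<and> u$2$2 = - (u$1$1) \<and> u$2$1 = cnj (u$1$2)"
proof
  have sub: "subspace {u::cmat2. Im (u$1$1) = 0 \<and> u$2$2 = - (u$1$1) \<and> u$2$1 = cnj (u$1$2)}"
    by (auto simp: subspace_def)
  have "{1..3::nat} = {1, 2, 3}" by auto
  then have "basis_e ` {1..3} \<subseteq> {u::cmat2. Im (u$1$1) = 0 \<and> u$2$2 = - (u$1$1) \<and> u$2$1 = cnj (u$1$2)}"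
    by (simp add: basis_e_entries[simplified])
  from span_minimal[OF this sub]
  show "u \<in> H0 \<Longrightarrow> Im (u$1$1) = 0 \<and> u$2$2 = - (u$1$1) \<and> u$2$1 = cnj (u$1$2)"
    by (auto simp: H0_def)
next
  assume *: "Im (u$1$1) = 0 \<and> u$2$2 = - (u$1$1) \<and> u$2$1 = cnj (u$1$2)"
  have "u = (2 * Re (u$1$2)) *\<^sub>R basis_e 1 + (2 * Im (u$1$2)) *\<^sub>R basis_e 2 + (2 * Re (u$1$1)) *\<^sub>R basis_e 3"
    using * by (simp add: cmat2_eq_iff basis_e_entries[simplified] complex_eq_iff)
  also have "\<dots> \<in> H0"
    unfolding H0_def by (intro span_add span_scale span_base imageI) auto
  finally show "u \<in> H0" .
qed

lemma H_iff: "u \<in> H \<longleftrightarrow> Im (u$1$1) = 0 \<and> Im (u$2$2) = 0 \<and> u$2$1 = cnj (u$1$2)"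
proof
  have sub: "subspace {u::cmat2. Im (u$1$1) = 0 \<and> Im (u$2$2) = 0 \<and> u$2$1 = cnj (u$1$2)}"
    by (auto simp: subspace_def)
  have "{0..3::nat} = {0, 1, 2, 3}" by auto
  then have "basis_e ` {0..3} \<subseteq> {u::cmat2. Im (u$1$1) = 0 \<and> Im (u$2$2) = 0 \<and> u$2$1 = cnj (u$1$2)}"
    by (simp add: basis_e_entries[simplified])
  from span_minimal[OF this sub]
  show "u \<in> H \<Longrightarrow> Im (u$1$1) = 0 \<and> Im (u$2$2) = 0 \<and> u$2$1 = cnj (u$1$2)"
    by (auto simp: H_def)
next
  assume *: "Im (u$1$1) = 0 \<and> Im (u$2$2) = 0 \<and> u$2$1 = cnj (u$1$2)"
  have "u = (Re (u$1$1) + Re (u$2$2)) *\<^sub>R basis_e 0 + (2 * Re (u$1$2)) *\<^sub>R basis_e 1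
     + (2 * Im (u$1$2)) *\<^sub>R basis_e 2 + (Re (u$1$1) - Re (u$2$2)) *\<^sub>R basis_e 3"
    using * by (simp add: cmat2_eq_iff basis_e_entries[simplified] complex_eq_iff field_simps)
  also have "\<dots> \<in> H"
    unfolding H_def by (intro span_add span_scale span_base imageI) auto
  finally show "u \<in> H" .
qed

lemma subspace_H0: "subspace H0"
  by (simp add: H0_def)

lemma H0_trace: "u \<in> H0 \<Longrightarrow> trace u = 0"
  by (simp add: H0_iff trace_cmat2)

text \<open>Cayley-Hamilton: a traceless matrix squares to a scalar. This is why exponentials of elements of
  \<open>H0\<close> have a closed form.\<close>

lemma H0_square:
  assumes "u \<in> H0"
  shows "u ** u = ((norm u)\<^sup>2 / 2) *\<^sub>R mat 1"
  using assms unfolding H0_iff norm_cmat2_power2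
  by (simp add: cmat2_eq_iff cmat2_mult_nth complex_eq_iff cmod_power2)
    (simp add: power2_eq_square)

lemma e0_half: "e0 = (1/2) *\<^sub>R mat 1"
  by (simp add: cmat2_eq_iff e0_def complex_eq_iff)

lemma coord_0: "coord 0 u = Re (u$1$1) + Re (u$2$2)"
  by (simp add: coord_def inner_cmat2 basis_e_entries[simplified])

lemma pseudo_prod_e0: "pseudo_prod u e0 = Re (trace u)"
proof -
  have [simp]: "coord k e0 = (if k = 0 then 1 else 0)" if "k \<in> {0..6}" for k
    using that unfolding set_upto6 coord_def
    by (auto simp: inner_cmat2 e0_def basis_e_entries[simplified])
  have "(\<Sum>k=1..6. coord k u * coord k e0) = 0"
    by (intro sum.neutral) auto
  then show ?thesis
    by (simp add: pseudo_prod_def coord_0 trace_cmat2 e0_def)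
qed

lemma H_decomp:
  assumes "u \<in> H"
  shows "u - Re (trace u) *\<^sub>R e0 \<in> H0"
  using assms by (simp add: H_iff H0_iff trace_cmat2 e0_def complex_eq_iff field_simps)

text \<open>On \<open>H0\<close> the scalar product for which \<open>e1\<close>, \<open>e2\<close>, \<open>e3\<close> are orthonormal is twice the
  Euclidean one. All later estimates therefore use the Euclidean norm, and sub-Riemannian lengths
  appear as \<open>sqrt 2 * norm\<close>.\<close>

lemma pseudo_prod_H:
  assumes "u \<in> H0" "w \<in> H0"
  shows "pseudo_prod (c *\<^sub>R e0 + u) (d *\<^sub>R e0 + w) = c * d - 2 * (u \<bullet> w)"
proof -
  have "{1..6::nat} = {1,2,3,4,5,6}" by auto
  then show ?thesis
    using assms unfolding H0_iff pseudo_prod_def coord_def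
    by (simp add: inner_cmat2 basis_e_entries[simplified] e0_def) (simp add: algebra_simps)
qed

lemma pseudo_prod_H0: "u \<in> H0 \<Longrightarrow> pseudo_prod (c *\<^sub>R e0 + u) (c *\<^sub>R e0 + u) = c\<^sup>2 - 2 * (norm u)\<^sup>2"
  by (simp add: pseudo_prod_H power2_norm_eq_inner) (simp add: power2_eq_square)

lemma scalar_prod_H0:
  assumes "u \<in> H0"
  shows "scalar_prod u u = 2 * (norm u)\<^sup>2"
proof -
  have "{1..3::nat} = {1,2,3}" by auto
  then show ?thesis
    using assms unfolding H0_iff scalar_prod_def coord_def power2_norm_eq_inner
    by (simp add: inner_cmat2 basis_e_entries[simplified])
qed

lemma sqrt_scalar_prod_H0: "u \<in> H0 \<Longrightarrow> sqrt (scalar_prod u u) = sqrt 2 * norm u"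
  by (simp add: scalar_prod_H0 real_sqrt_mult)

text \<open>The invariant form \<open>2 Re tr(A B)\<close> of the Lie algebra restricts to the scalar product of \<open>H0\<close>, and
  \<open>H0\<close> is orthogonal to the antihermitian matrices. The projection below is orthogonal for both.\<close>

lemma Re_trace_H0: "w \<in> H0 \<Longrightarrow> Re (trace (A ** w)) = A \<bullet> w"
  by (simp add: H0_iff trace_cmat2 inner_cmat2 cmat2_mult_nth)

definition prH0 :: "cmat2 \<Rightarrow> cmat2" where
  "prH0 A = coord 1 A *\<^sub>R basis_e 1 + coord 2 A *\<^sub>R basis_e 2 + coord 3 A *\<^sub>R basis_e 3"

lemma prH0_in: "prH0 A \<in> H0"
  unfolding H0_def prH0_def by (intro span_add span_scale span_base imageI) auto

lemma inner_prH0: "w \<in> H0 \<Longrightarrow> prH0 A \<bullet> w = A \<bullet> w"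
  by (auto simp: H0_iff prH0_def inner_cmat2 coord_def basis_e_entries[simplified] algebra_simps)

lemma prH0_unique:
  assumes "u \<in> H0" "\<And>w. w \<in> H0 \<Longrightarrow> u \<bullet> w = A \<bullet> w"
  shows "u = prH0 A"
proof -
  have d: "u - prH0 A \<in> H0"
    using assms(1) prH0_in subspace_H0 by (simp add: subspace_diff)
  have "(u - prH0 A) \<bullet> (u - prH0 A) = 0"
    using assms(2)[OF d] inner_prH0[OF d] by (simp add: inner_diff_left)
  then show ?thesis by simp
qed

lemma bounded_linear_prH0: "bounded_linear prH0"
  unfolding prH0_def coord_def
  by (intro bounded_linear_add bounded_linear_scaleR_left[THEN bounded_linear_compose]
      bounded_linear_const_mult bounded_linear_inner_left)

section \<open>Absolutely continuous functions\<close>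

text \<open>Vector valued, so that curves of matrices and the coordinates of covectors are treated alike.\<close>

definition AC_on :: "real \<Rightarrow> real \<Rightarrow> (real \<Rightarrow> 'a::real_normed_vector) \<Rightarrow> bool" where
  "AC_on a b f \<longleftrightarrow>
     (\<forall>\<epsilon>>0. \<exists>\<delta>>0. \<forall>\<D>. \<D> division_of \<Union>\<D> \<and> \<Union>\<D> \<subseteq> {a..b} \<and> (\<Sum>K\<in>\<D>. Sup K - Inf K) < \<delta> \<longrightarrow>
        (\<Sum>K\<in>\<D>. norm (f (Sup K) - f (Inf K))) < \<epsilon>)"

lemma AC_on_real: "AC_on a b f \<longleftrightarrow> abs_continuous_on_interval a b f"
  by (simp add: AC_on_def abs_continuous_on_interval_def)

lemma AC_onE:
  assumes "AC_on a b f" "\<epsilon> > 0"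
  obtains \<delta> where "\<delta> > 0" "\<And>\<D>. \<D> division_of \<Union>\<D> \<Longrightarrow> \<Union>\<D> \<subseteq> {a..b} \<Longrightarrow>
    (\<Sum>K\<in>\<D>. Sup K - Inf K) < \<delta> \<Longrightarrow> (\<Sum>K\<in>\<D>. norm (f (Sup K) - f (Inf K))) < \<epsilon>"
  using assms(1)[unfolded AC_on_def, rule_format, OF assms(2)] 
  by (elim exE conjE) (rule that, auto)

lemma division_real_interval:
  assumes "\<D> division_of \<Union>\<D>" "K \<in> \<D>"
  obtains u v :: real where "K = {u..v}" "u \<le> v" "Sup K = v" "Inf K = u"
proof -
  obtain u v where "K = cbox u v" "K \<noteq> {}"
    using division_ofD(3,4)[OF assms] by blast
  then show thesis
    using that[of u v] by auto
qed

lemma division_sum_content: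
  fixes \<D> :: "real set set"
  assumes "\<D> division_of \<Union>\<D>"
  shows "(\<Sum>K\<in>\<D>. Sup K - Inf K) = measure lebesgue (\<Union>\<D>)"
proof -
  have "(\<Sum>K\<in>\<D>. Sup K - Inf K) = (\<Sum>K\<in>\<D>. measure lebesgue K)"
  proof (rule sum.cong)
    fix K assume "K \<in> \<D>"
    then obtain u v where "K = {u..v}" "u \<le> v"
      using division_real_interval[OF assms] by metis
    then show "Sup K - Inf K = measure lebesgue K"
      by simp
  qed simp
  with content_division[OF assms] show ?thesis by simp
qed

text \<open>Closure properties of absolute continuity all come from a bound of the increments of \<open>f\<close> by those
  of two absolutely continuous functions.\<close>

lemma AC_on_bound:
  fixes f :: "real \<Rightarrow> 'a::real_normed_vector"
  assumes "AC_on a b g" "AC_on a b h" "A \<ge> 0" "B \<ge> 0"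
    and "\<And>u v. a \<le> u \<Longrightarrow> u \<le> v \<Longrightarrow> v \<le> b \<Longrightarrow>
          norm (f v - f u) \<le> A * norm (g v - g u) + B * norm (h v - h u)"
  shows "AC_on a b f"
  unfolding AC_on_def
proof (intro allI impI)
  fix \<epsilon> :: real assume "\<epsilon> > 0"
  define e where "e = \<epsilon> / (2 * (A + B + 1))"
  have "e > 0"
    using \<open>\<epsilon> > 0\<close> assms(3,4) by (simp add: e_def)
  obtain \<delta>1 where \<delta>1: "\<delta>1 > 0" "\<And>\<D>. \<D> division_of \<Union>\<D> \<Longrightarrow> \<Union>\<D> \<subseteq> {a..b} \<Longrightarrow> (\<Sum>K\<in>\<D>. Sup K - Inf K) < \<delta>1 \<Longrightarrow>
        (\<Sum>K\<in>\<D>. norm (g (Sup K) - g (Inf K))) < e"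
    by (rule AC_onE[OF assms(1) \<open>e > 0\<close>]) (rule that)
  obtain \<delta>2 where \<delta>2: "\<delta>2 > 0" "\<And>\<D>. \<D> division_of \<Union>\<D> \<Longrightarrow> \<Union>\<D> \<subseteq> {a..b} \<Longrightarrow> (\<Sum>K\<in>\<D>. Sup K - Inf K) < \<delta>2 \<Longrightarrow>
        (\<Sum>K\<in>\<D>. norm (h (Sup K) - h (Inf K))) < e"
    by (rule AC_onE[OF assms(2) \<open>e > 0\<close>]) (rule that)
  have "(\<Sum>K\<in>\<D>. norm (f (Sup K) - f (Inf K))) < \<epsilon>"
    if D: "\<D> division_of \<Union>\<D>" "\<Union>\<D> \<subseteq> {a..b}" "(\<Sum>K\<in>\<D>. Sup K - Inf K) < min \<delta>1 \<delta>2" for \<D>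
  proof -
    have "(\<Sum>K\<in>\<D>. norm (f (Sup K) - f (Inf K)))
        \<le> (\<Sum>K\<in>\<D>. A * norm (g (Sup K) - g (Inf K)) + B * norm (h (Sup K) - h (Inf K)))"
    proof (rule sum_mono)
      fix K assume K: "K \<in> \<D>"
      then obtain u v where uv: "K = {u..v}" "u \<le> v" "Sup K = v" "Inf K = u"
        using division_real_interval[OF D(1)] by metis
      have "{u..v} \<subseteq> {a..b}"
        using D(2) K uv(1) by blast
      then have "a \<le> u" "v \<le> b"
        using uv(2) by auto
      then show "norm (f (Sup K) - f (Inf K))
          \<le> A * norm (g (Sup K) - g (Inf K)) + B * norm (h (Sup K) - h (Inf K))"
        using assms(5)[of u v] uv by simp
    qed
    also have "\<dots> = A * (\<Sum>K\<in>\<D>. norm (g (Sup K) - g (Inf K))) + B * (\<Sum>K\<in>\<D>. norm (h (Sup K) - h (Inf K)))"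
      by (simp add: sum.distrib sum_distrib_left)
    also have "\<dots> \<le> A * e + B * e"
      using \<delta>1(2)[OF D(1,2)] \<delta>2(2)[OF D(1,2)] D(3) assms(3,4)
      by (intro add_mono mult_left_mono) auto
    also have "\<dots> < \<epsilon>"
    proof -
      have "A + B + 1 > 0"
        using assms(3,4) by simp
      then have "(A + B + 1) * e = \<epsilon> / 2"
        unfolding e_def by (metis divide_divide_eq_left less_irrefl mult.commute nonzero_mult_div_cancel_left times_divide_eq_right)
      then show ?thesis
        using \<open>e > 0\<close> \<open>\<epsilon> > 0\<close> by (simp add: algebra_simps)
    qed
    finally show ?thesis .
  qed
  then show "\<exists>\<delta>>0. \<forall>\<D>. \<D> division_of \<Union>\<D> \<and> \<Union>\<D> \<subseteq> {a..b} \<and> (\<Sum>K\<in>\<D>. Sup K - Inf K) < \<delta> \<longrightarrow>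
        (\<Sum>K\<in>\<D>. norm (f (Sup K) - f (Inf K))) < \<epsilon>"
    using \<delta>1(1) \<delta>2(1) by (intro exI[of _ "min \<delta>1 \<delta>2"]) auto
qed

lemma AC_on_ident: "AC_on a b (\<lambda>t::real. t)"
  unfolding AC_on_def
proof (intro allI impI)
  fix \<epsilon> :: real assume "\<epsilon> > 0"
  have "(\<Sum>K\<in>\<D>. norm (Sup K - Inf K)) < \<epsilon>"
    if D: "\<D> division_of \<Union>\<D>" "(\<Sum>K\<in>\<D>. Sup K - Inf K) < \<epsilon>" for \<D> :: "real set set"
  proof -
    have "(\<Sum>K\<in>\<D>. norm (Sup K - Inf K)) = (\<Sum>K\<in>\<D>. Sup K - Inf K)"
    proof (rule sum.cong)
      fix K assume "K \<in> \<D>"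
      then obtain u v where "Sup K = v" "Inf K = u" "u \<le> v"
        using division_real_interval[OF D(1)] by metis
      then show "norm (Sup K - Inf K) = Sup K - Inf K" by simp
    qed simp
    with D(2) show ?thesis by simp
  qed
  with \<open>\<epsilon> > 0\<close> show "\<exists>\<delta>>0. \<forall>\<D>. \<D> division_of \<Union>\<D> \<and> \<Union>\<D> \<subseteq> {a..b} \<and> (\<Sum>K\<in>\<D>. Sup K - Inf K) < \<delta> \<longrightarrow>
        (\<Sum>K\<in>\<D>. norm (Sup K - Inf K)) < \<epsilon>"
    by (intro exI[of _ \<epsilon>]) auto
qed

lemma lipschitz_imp_AC:
  assumes "L-lipschitz_on {a..b} f"
  shows "AC_on a b f"
proof (rule AC_on_bound[OF AC_on_ident AC_on_ident lipschitz_on_nonneg[OF assms] order_refl])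
  fix u v assume "a \<le> u" "u \<le> v" "v \<le> b"
  then show "norm (f v - f u) \<le> L * norm (v - u) + 0 * norm (v - u)"
    using lipschitz_on_normD[OF assms, of v u] by simp
qed

lemma AC_on_subset:
  assumes "AC_on a b f" "a \<le> c" "d \<le> b"
  shows "AC_on c d f"
proof -
  have "{c..d} \<subseteq> {a..b}"
    using assms(2,3) by auto
  show ?thesis
    unfolding AC_on_def
  proof (intro allI impI)
    fix \<epsilon> :: real assume "\<epsilon> > 0"
    obtain \<delta> where "\<delta> > 0" "\<And>\<D>. \<D> division_of \<Union>\<D> \<Longrightarrow> \<Union>\<D> \<subseteq> {a..b} \<Longrightarrow> (\<Sum>K\<in>\<D>. Sup K - Inf K) < \<delta> \<Longrightarrow>
        (\<Sum>K\<in>\<D>. norm (f (Sup K) - f (Inf K))) < \<epsilon>"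
      by (rule AC_onE[OF assms(1) \<open>\<epsilon> > 0\<close>]) (rule that)
    then show "\<exists>\<delta>>0. \<forall>\<D>. \<D> division_of \<Union>\<D> \<and> \<Union>\<D> \<subseteq> {c..d} \<and> (\<Sum>K\<in>\<D>. Sup K - Inf K) < \<delta> \<longrightarrow>
        (\<Sum>K\<in>\<D>. norm (f (Sup K) - f (Inf K))) < \<epsilon>"
      using order_trans[OF _ \<open>{c..d} \<subseteq> {a..b}\<close>] by (intro exI[of _ \<delta>]) simp
  qed
qed

lemma AC_on_continuous:
  assumes "AC_on a b f"
  shows "continuous_on {a..b} f"
  unfolding continuous_on_iff
proof (intro ballI allI impI)
  fix x \<epsilon> :: real assume x: "x \<in> {a..b}" and "\<epsilon> > 0"
  obtain \<delta> where \<delta>: "\<delta> > 0" "\<And>\<D>. \<D> division_of \<Union>\<D> \<Longrightarrow> \<Union>\<D> \<subseteq> {a..b} \<Longrightarrow> (\<Sum>K\<in>\<D>. Sup K - Inf K) < \<delta> \<Longrightarrow>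
        (\<Sum>K\<in>\<D>. norm (f (Sup K) - f (Inf K))) < \<epsilon>"
    by (rule AC_onE[OF assms \<open>\<epsilon> > 0\<close>]) (rule that)
  have *: "norm (f v - f u) < \<epsilon>" if "a \<le> u" "u \<le> v" "v \<le> b" "v - u < \<delta>" for u v
    using \<delta>(2)[of "{{u..v}}"] that division_of_self[of u v] by simp
  have "dist (f y) (f x) < \<epsilon>" if "y \<in> {a..b}" "dist y x < \<delta>" for y
    using *[of x y] *[of y x] x that by (cases "x \<le> y") (auto simp: dist_norm norm_minus_commute)
  with \<delta>(1) show "\<exists>d>0. \<forall>x'\<in>{a..b}. dist x' x < d \<longrightarrow> dist (f x') (f x) < \<epsilon>"
    by blast
qed

lemma AC_on_bounded:
  assumes "AC_on a b f"
  obtains B where "B \<ge> 0" "\<And>t. t \<in> {a..b} \<Longrightarrow> norm (f t) \<le> B"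
proof -
  have "bounded (f ` {a..b})"
    using AC_on_continuous[OF assms] by (simp add: compact_continuous_image compact_imp_bounded)
  then show thesis
    using that by (metis bounded_pos imageI less_imp_le)
qed

lemma AC_on_const: "AC_on a b (\<lambda>t. c)"
  by (rule AC_on_bound[OF AC_on_ident AC_on_ident order_refl order_refl]) simp

lemma AC_on_add:
  assumes "AC_on a b f" "AC_on a b g"
  shows "AC_on a b (\<lambda>t. f t + g t)"
  by (rule AC_on_bound[OF assms zero_le_one zero_le_one])
    (metis add_diff_add mult_1 norm_triangle_ineq)

lemma AC_on_bilinear:
  assumes "bounded_bilinear pr" "AC_on a b f" "AC_on a b g"
  shows "AC_on a b (\<lambda>t. pr (f t) (g t))"
proof -
  interpret bounded_bilinear pr by fact
  obtain M where M: "M \<ge> 0" "\<And>x y. norm (pr x y) \<le> norm x * norm y * M"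
    using nonneg_bounded by blast
  obtain A where A: "A \<ge> 0" "\<And>t. t \<in> {a..b} \<Longrightarrow> norm (f t) \<le> A"
    using AC_on_bounded[OF assms(2)] by metis
  obtain B where B: "B \<ge> 0" "\<And>t. t \<in> {a..b} \<Longrightarrow> norm (g t) \<le> B"
    using AC_on_bounded[OF assms(3)] by metis
  show ?thesis
  proof (rule AC_on_bound[OF assms(2,3)])
    show "B * M \<ge> 0" "A * M \<ge> 0"
      using A B M by auto
    fix u v assume uv: "a \<le> u" "u \<le> v" "v \<le> b"
    have "pr (f v) (g v) - pr (f u) (g u) = pr (f v - f u) (g v) + pr (f u) (g v - g u)"
      by (simp add: diff_left diff_right)
    then have "norm (pr (f v) (g v) - pr (f u) (g u))
        \<le> norm (f v - f u) * norm (g v) * M + norm (f u) * norm (g v - g u) * M"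
      using norm_triangle_ineq[of "pr (f v - f u) (g v)" "pr (f u) (g v - g u)"]
        M(2)[of "f v - f u" "g v"] M(2)[of "f u" "g v - g u"] by simp
    also have "\<dots> \<le> norm (f v - f u) * B * M + A * norm (g v - g u) * M"
      using A(2)[of u] B(2)[of v] uv M(1)
      by (intro add_mono mult_right_mono mult_left_mono) auto
    finally show "norm (pr (f v) (g v) - pr (f u) (g u))
        \<le> B * M * norm (f v - f u) + A * M * norm (g v - g u)"
      by (simp add: mult_ac)
  qed
qed

lemma AC_on_linear:
  assumes "bounded_linear h" "AC_on a b f"
  shows "AC_on a b (\<lambda>t. h (f t))"
proof -
  interpret bounded_linear h by fact
  obtain M where M: "M \<ge> 0" "\<And>x. norm (h x) \<le> norm x * M"
    using nonneg_bounded by blast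
  show ?thesis
    by (rule AC_on_bound[OF assms(2,2) M(1) order_refl])
      (use M(2) in \<open>simp add: mult.commute flip: diff\<close>)
qed

lemma null_outer_open:
  fixes N :: "'a::euclidean_space set"
  assumes "negligible N" "\<delta> > 0"
  obtains T where "open T" "N \<subseteq> T" "T \<in> lmeasurable" "measure lebesgue T < \<delta>"
proof -
  have N: "N \<in> null_sets lebesgue"
    using assms(1) by (simp add: negligible_iff_null_sets)
  then have "N \<in> sets lebesgue" by auto
  then obtain T where T: "open T" "N \<subseteq> T" "T - N \<in> lmeasurable" "emeasure lebesgue (T - N) < ennreal \<delta>"
    using sets_lebesgue_outer_open[OF _ assms(2)] by metis
  have "T = (T - N) \<union> N" using T(2) by blast
  moreover have "emeasure lebesgue ((T - N) \<union> N) = emeasure lebesgue (T - N)"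
    using N T(3) by (intro emeasure_Un_null_set) auto
  ultimately have em: "emeasure lebesgue T < ennreal \<delta>"
    using T(4) by simp
  have "T \<in> lmeasurable"
    using T(1) less_trans[OF em ennreal_less_top] by (intro fmeasurableI) auto
  moreover have "measure lebesgue T < \<delta>"
    using em assms(2) \<open>T \<in> lmeasurable\<close> by (simp add: emeasure_eq_measure2 ennreal_less_iff)
  ultimately show thesis
    using T that by blast
qed

text \<open>The fundamental theorem of calculus, by gauges. At points of differentiability the usual gauge makes
  the Riemann sums close. At points of the exceptional set \<open>N\<close> the gauge keeps the intervals inside an open set of
  measure less than \<open>\<delta>\<close>, so the increments of \<open>f\<close> over these intervals are jointly small by absolute
  continuity.\<close>

lemma AC_FTC:
  fixes f :: "real \<Rightarrow> 'a::banach"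
  assumes "a \<le> b" and ac: "AC_on a b f" and N: "negligible N"
    and deriv: "\<And>x. x \<in> {a..b} - N \<Longrightarrow> (f has_vector_derivative f' x) (at x within {a..b})"
  shows "(f' has_integral (f b - f a)) {a..b}"
proof (rule has_integral_spike[OF N])
  show "\<And>x. x \<in> {a..b} - N \<Longrightarrow> f' x = (if x \<in> N then 0 else f' x)"
    by simp
  show "((\<lambda>x. if x \<in> N then 0 else f' x) has_integral (f b - f a)) {a..b}"
    unfolding has_integral_real
  proof (intro allI impI)
    fix \<epsilon> :: real assume "\<epsilon> > 0"
    define h where "h = (\<lambda>x. if x \<in> N then 0 else f' x)"
    define e where "e = \<epsilon> / (2 * (b - a + 1))"
    have "e > 0"
      using \<open>\<epsilon> > 0\<close> \<open>a \<le> b\<close> by (simp add: e_def)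
    then have "\<forall>x. \<exists>d>0. x \<in> {a..b} - N \<longrightarrow>
         (\<forall>y\<in>{a..b}. norm (y-x) < d \<longrightarrow> norm (f y - f x - (y-x) *\<^sub>R f' x) \<le> e * norm (y-x))"
      using deriv[unfolded has_vector_derivative_def has_derivative_within_alt] by blast
    then obtain d where d: "\<And>x. 0 < d x"
      "\<And>x y. \<lbrakk>x \<in> {a..b}; x \<notin> N; y \<in> {a..b}; norm (y-x) < d x\<rbrakk>
          \<Longrightarrow> norm (f y - f x - (y-x) *\<^sub>R f' x) \<le> e * norm (y-x)"
      by (metis DiffI)
    obtain \<delta> where \<delta>: "\<delta> > 0" "\<And>\<D>. \<D> division_of \<Union>\<D> \<Longrightarrow> \<Union>\<D> \<subseteq> {a..b} \<Longrightarrow> (\<Sum>K\<in>\<D>. Sup K - Inf K) < \<delta> \<Longrightarrow>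
        (\<Sum>K\<in>\<D>. norm (f (Sup K) - f (Inf K))) < \<epsilon> / 2"
      by (rule AC_onE[OF ac half_gt_zero[OF \<open>\<epsilon> > 0\<close>]]) (rule that)
    obtain T where T: "open T" "N \<subseteq> T" "T \<in> lmeasurable" "measure lebesgue T < \<delta>"
      by (rule null_outer_open[OF N \<delta>(1)]) (rule that)
    define \<gamma> where "\<gamma> x = (if x \<in> N then T else ball x (d x))" for x
    have gauge: "gauge \<gamma>"
      using T d(1) by (auto simp: gauge_def \<gamma>_def)
    have close: "norm ((\<Sum>(x,K)\<in>p. measure lborel K *\<^sub>R h x) - (f b - f a)) < \<epsilon>"
      if ptag: "p tagged_division_of {a..b}" and fine: "\<gamma> fine p" for p
    proof -
      have finp: "finite p"
        using ptag by blast
      have ba: "b - a = (\<Sum>(x,K)\<in>p. Sup K - Inf K)" "f b - f a = (\<Sum>(x,K)\<in>p. f(Sup K) - f(Inf K))"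
        using additive_tagged_division_1[where f= "\<lambda>x. x"] additive_tagged_division_1[where f= f]
            \<open>a \<le> b\<close> ptag by auto
      define p' where "p' = {xK \<in> p. fst xK \<in> N}"
      have p'p: "p' \<subseteq> p" by (auto simp: p'_def)
      have K: "\<exists>u v. K = {u..v} \<and> u \<le> v \<and> x \<in> K \<and> a \<le> u \<and> v \<le> b \<and> K \<subseteq> \<gamma> x" if xK: "(x, K) \<in> p" for x K
      proof -
        obtain u v where "K = cbox u v" "x \<in> K" "K \<subseteq> {a..b}"
          using tagged_division_ofD(2-4)[OF ptag xK] by blast
        moreover have "K \<subseteq> \<gamma> x"
          using fine xK by (auto simp: fine_def)
        ultimately show ?thesis
          by (intro exI[of _ u] exI[of _ v]) auto
      qed
      have good: "norm (measure lborel K *\<^sub>R h x - (f (Sup K) - f (Inf K))) \<le> e * (Sup K - Inf K)"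
        if xK: "(x, K) \<in> p" and xN: "x \<notin> N" for x K
      proof -
        obtain u v where k: "K = {u..v}" "u \<le> v" "x \<in> K" "a \<le> u" "v \<le> b" "K \<subseteq> ball x (d x)"
          using K[OF xK] xN unfolding \<gamma>_def by auto
        have x: "x \<in> {a..b}" "u \<in> {a..b}" "v \<in> {a..b}"
          using k by auto
        have "u \<in> ball x (d x)" "v \<in> ball x (d x)"
          using k by (auto simp: subset_iff)
        then have uv: "norm (u - x) < d x" "norm (v - x) < d x"
          by (auto simp: dist_real_def)
        have "norm ((v - u) *\<^sub>R f' x - (f v - f u))
            = norm (f u - f x - (u - x) *\<^sub>R f' x - (f v - f x - (v - x) *\<^sub>R f' x))"
          by (auto simp: algebra_simps)
        also have "\<dots> \<le> norm (f u - f x - (u - x) *\<^sub>R f' x) + norm (f v - f x - (v - x) *\<^sub>R f' x)"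
          by (rule norm_triangle_ineq4)
        also have "\<dots> \<le> e * norm (u - x) + e * norm (v - x)"
          using d(2)[OF x(1) xN x(2) uv(1)] d(2)[OF x(1) xN x(3) uv(2)] by simp
        also have "\<dots> = e * (v - u)"
          using k(1,3) by (simp add: algebra_simps)
        finally show ?thesis
          using k(1,2) xN by (simp add: h_def)
      qed
      have p'tag: "p' tagged_division_of \<Union>(snd ` p')"
        using ptag p'p
        by (meson tagged_division_of_def tagged_partial_division_of_Union_self tagged_partial_division_subset)
      have p'div: "snd ` p' division_of \<Union>(snd ` p')"
        by (rule division_of_tagged_division[OF p'tag])
      have p'sub: "\<Union>(snd ` p') \<subseteq> {a..b}" "\<Union>(snd ` p') \<subseteq> T"
        using K p'p unfolding p'_def \<gamma>_def by fastforce+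
      have small: "(\<Sum>K\<in>snd ` p'. Sup K - Inf K) < \<delta>"
      proof -
        have "(\<Sum>K\<in>snd ` p'. Sup K - Inf K) = measure lebesgue (\<Union>(snd ` p'))"
          by (rule division_sum_content[OF p'div])
        also have "\<dots> \<le> measure lebesgue T"
          using p'sub(2) T(3) lmeasurable_division[OF p'div]
          by (intro measure_mono_fmeasurable) auto
        finally show ?thesis using T(4) by simp
      qed
      have bad: "(\<Sum>(x,K)\<in>p'. norm (f (Sup K) - f (Inf K))) < \<epsilon> / 2"
      proof -
        \<comment> \<open>The value at the empty set is fixed, since \<open>Sup {}\<close> and \<open>Inf {}\<close> may differ.\<close>
        define q where "q K = (if K = {} then 0 else norm (f (Sup K) - f (Inf K)))" for K
        have ne: "K \<noteq> {}" if "(x, K) \<in> p'" for x K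
          using K[of x K] that p'p by auto
        have "(\<Sum>(x,K)\<in>p'. norm (f (Sup K) - f (Inf K))) = (\<Sum>(x,K)\<in>p'. q K)"
          by (rule sum.cong) (auto simp: q_def dest: ne)
        also have "\<dots> = (\<Sum>K\<in>snd ` p'. q K)"
        proof (rule sum.over_tagged_division_lemma[OF p'tag])
          fix u v :: real assume "box u v = {}"
          then show "q (cbox u v) = 0"
            by (cases "u = v") (auto simp: q_def)
        qed
        also have "\<dots> = (\<Sum>K\<in>snd ` p'. norm (f (Sup K) - f (Inf K)))"
          by (rule sum.cong) (auto simp: q_def dest: ne)
        also have "\<dots> < \<epsilon> / 2"
          by (rule \<delta>(2)[OF p'div p'sub(1) small])
        finally show ?thesis .
      qed
      have "norm ((\<Sum>(x,K)\<in>p. measure lborel K *\<^sub>R h x) - (f b - f a))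
          = norm (\<Sum>(x,K)\<in>p. measure lborel K *\<^sub>R h x - (f (Sup K) - f (Inf K)))"
        unfolding ba(2) sum_subtractf[symmetric] by (simp add: split_def)
      also have "\<dots> \<le> (\<Sum>(x,K)\<in>p. norm (measure lborel K *\<^sub>R h x - (f (Sup K) - f (Inf K))))"
        using norm_sum[of "\<lambda>(x,K). measure lborel K *\<^sub>R h x - (f (Sup K) - f (Inf K))" p]
        by (simp add: split_def)
      also have "\<dots> = (\<Sum>(x,K)\<in>p - p'. norm (measure lborel K *\<^sub>R h x - (f (Sup K) - f (Inf K))))
          + (\<Sum>(x,K)\<in>p'. norm (measure lborel K *\<^sub>R h x - (f (Sup K) - f (Inf K))))"
        by (rule sum.subset_diff[OF p'p finp])
      also have "(\<Sum>(x,K)\<in>p'. norm (measure lborel K *\<^sub>R h x - (f (Sup K) - f (Inf K))))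
          = (\<Sum>(x,K)\<in>p'. norm (f (Sup K) - f (Inf K)))"
        by (rule sum.cong) (auto simp: p'_def h_def norm_minus_commute)
      also have "(\<Sum>(x,K)\<in>p - p'. norm (measure lborel K *\<^sub>R h x - (f (Sup K) - f (Inf K))))
          \<le> (\<Sum>(x,K)\<in>p - p'. e * (Sup K - Inf K))"
        using good by (intro sum_mono) (auto simp: p'_def)
      also have "\<dots> \<le> (\<Sum>(x,K)\<in>p. e * (Sup K - Inf K))"
      proof (rule sum_mono2[OF finp])
        fix xK assume "xK \<in> p - (p - p')"
        then obtain x K where "xK = (x, K)" "(x, K) \<in> p"
          by (cases xK) auto
        moreover from this(2) obtain u v where "K = {u..v}" "u \<le> v"
          using K by blast
        ultimately show "0 \<le> (case xK of (x, K) \<Rightarrow> e * (Sup K - Inf K))"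
          using \<open>e > 0\<close> by simp
      qed auto
      also have "\<dots> = e * (b - a)"
        unfolding ba(1) by (simp add: sum_distrib_left split_def)
      also have "\<dots> \<le> \<epsilon> / 2"
        using \<open>\<epsilon> > 0\<close> \<open>a \<le> b\<close> by (simp add: e_def field_simps)
      finally show ?thesis
        using bad by simp
    qed
    show "\<exists>\<gamma>. gauge \<gamma> \<and> (\<forall>\<D>. \<D> tagged_division_of {a..b} \<and> \<gamma> fine \<D> \<longrightarrow>
      norm ((\<Sum>(x, k)\<in>\<D>. measure lborel k *\<^sub>R (if x \<in> N then 0 else f' x)) - (f b - f a)) < \<epsilon>)"
      using gauge close[unfolded h_def] by (intro exI[of _ \<gamma>] conjI allI impI) (simp_all only:)
  qed
qed

section \<open>Products of exponentials of Hermitian matrices\<close>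

text \<open>\<open>hexp V t\<close> is the matrix exponential of \<open>t V\<close> for \<open>V \<in> H0\<close>, whose square is the scalar
  \<open>(norm V)\<^sup>2 / 2\<close>. For \<open>V = 0\<close> the quotient has the value \<open>0\<close>, which is harmless.\<close>

definition hexp :: "cmat2 \<Rightarrow> real \<Rightarrow> cmat2" where
  "hexp V t = cosh (norm V / sqrt 2 * t) *\<^sub>R mat 1
     + (sinh (norm V / sqrt 2 * t) / (norm V / sqrt 2)) *\<^sub>R V"

lemma hexp_0 [simp]: "hexp V 0 = mat 1"
  by (simp add: hexp_def)

lemma hexp_zero [simp]: "hexp 0 t = mat 1"
  by (simp add: hexp_def)

lemma det_H0: "V \<in> H0 \<Longrightarrow> det V = - of_real ((norm V)\<^sup>2 / 2)"
  unfolding H0_iff det_cmat2 norm_cmat2_power2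
  by (simp add: complex_eq_iff cmod_power2) (simp add: power2_eq_square field_simps)

lemma det_hexp:
  assumes "V \<in> H0"
  shows "det (hexp V t) = 1"
proof (cases "V = 0")
  case False
  define r where "r = norm V / sqrt 2"
  have r: "r > 0" "r\<^sup>2 = (norm V)\<^sup>2 / 2"
    using False by (simp_all add: r_def power_divide)
  have "det (c *\<^sub>R mat 1 + s *\<^sub>R V) = of_real (c\<^sup>2) + of_real (s\<^sup>2) * det V" for c s
    using assms unfolding H0_iff det_cmat2
    by (simp add: complex_eq_iff) (simp add: power2_eq_square algebra_simps)
  then have "det (hexp V t) = of_real ((cosh (r * t))\<^sup>2 - (sinh (r * t) / r)\<^sup>2 * r\<^sup>2)"
    unfolding hexp_def r_def[symmetric] by (simp add: det_H0[OF assms] r(2))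
  also have "(cosh (r * t))\<^sup>2 - (sinh (r * t) / r)\<^sup>2 * r\<^sup>2 = 1"
    using r(1) by (simp add: power_divide cosh_square_eq)
  finally show ?thesis by simp
qed simp

lemma hexp_has_vector_derivative:
  assumes "V \<in> H0"
  shows "(hexp V has_vector_derivative hexp V t ** V) (at t within S)"
proof -
  define r where "r = norm V / sqrt 2"
  have r: "V = 0 \<or> r > 0" "r\<^sup>2 = (norm V)\<^sup>2 / 2"
    by (auto simp: r_def power_divide zero_less_divide_iff)
  have "((\<lambda>t. cosh (r * t) *\<^sub>R mat 1 + (sinh (r * t) / r) *\<^sub>R V) has_vector_derivative
      (r * sinh (r * t)) *\<^sub>R mat 1 + (r * cosh (r * t) / r) *\<^sub>R V) (at t within S)"
  proof -
    have "((\<lambda>t. cosh (r * t)) has_real_derivative r * sinh (r * t)) (at t within S)"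
      by (auto intro!: derivative_eq_intros)
    moreover have "((\<lambda>t. sinh (r * t) / r) has_real_derivative r * cosh (r * t) / r) (at t within S)"
      by (rule DERIV_cdivide) (auto intro!: derivative_eq_intros)
    ultimately show ?thesis
      using has_vector_derivative_add[OF has_vector_derivative_scaleR[OF _ has_vector_derivative_const]
          has_vector_derivative_scaleR[OF _ has_vector_derivative_const]]
      by fastforce
  qed
  also have "(r * sinh (r * t)) *\<^sub>R mat 1 + (r * cosh (r * t) / r) *\<^sub>R V = hexp V t ** V"
  proof (cases "V = 0")
    case False
    have "hexp V t ** V = cosh (r * t) *\<^sub>R V + (sinh (r * t) / r * r\<^sup>2) *\<^sub>R mat 1"
      unfolding hexp_def r_def[symmetric] r(2)
      by (simp add: cmult.add_left cmult.scaleR_left H0_square[OF assms])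
    then show ?thesis
      using r(1) False by (simp add: power2_eq_square)
  qed (simp add: r_def)
  finally show ?thesis
    unfolding hexp_def[abs_def] r_def .
qed

lemma hexp_close:
  assumes "norm V \<le> 1"
  shows "norm (hexp V 1 - mat 1 - V) \<le> 2 * (norm V)\<^sup>2"
proof -
  define r where "r = norm V / sqrt 2"
  have r: "r \<ge> 0" "r \<le> 1" "r\<^sup>2 = (norm V)\<^sup>2 / 2" "V = 0 \<or> r > 0"
    using assms by (auto simp: r_def power_divide zero_less_divide_iff divide_le_eq order_trans[OF _ real_sqrt_ge_one])
  have e1: "exp r \<le> 1 + r + r\<^sup>2"
    using exp_bound[of r] r by simp
  have e2: "exp (-r) \<ge> 1 - r"
    using exp_ge_add_one_self[of "-r"] by simp
  have e3: "exp (-r) \<le> 1 - r + r\<^sup>2"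
  proof -
    have "exp r * (1 - r + r\<^sup>2) \<ge> (1 + r) * (1 - r + r\<^sup>2)"
      using exp_ge_add_one_self[of r] r by (intro mult_right_mono) auto
    moreover have "(1 + r) * (1 - r + r\<^sup>2) = 1 + r ^ 3"
      by (simp add: algebra_simps power2_eq_square power3_eq_cube)
    ultimately have "exp r * (1 - r + r\<^sup>2) \<ge> 1"
      using r(1) by (smt (verit) zero_le_power)
    then show ?thesis
      by (simp add: exp_minus field_simps)
  qed
  have c: "0 \<le> cosh r - 1" "cosh r - 1 \<le> r\<^sup>2"
  proof -
    have "cosh r = (exp r + exp (-r)) / 2" by (simp add: cosh_def)
    moreover have "(x + y) / 2 - 1 \<le> z" if "x \<le> 1 + r + z" "y \<le> 1 - r + z" for x y z :: real
    proof -
      have "x + y \<le> 2 + 2 * z" using that by linarith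
      then show ?thesis by (simp add: field_simps)
    qed
    ultimately show "cosh r - 1 \<le> r\<^sup>2"
      using e1 e3 by simp
    show "0 \<le> cosh r - 1"
      using cosh_real_ge_1[of r] by simp
  qed
  have s: "sinh r - r \<le> r\<^sup>2" "sinh r - r \<ge> - r\<^sup>2"
  proof -
    have "sinh r = exp r / 2 - exp (-r) / 2" by (simp add: sinh_def diff_divide_distrib)
    then show "sinh r - r \<le> r\<^sup>2" "sinh r - r \<ge> - r\<^sup>2"
      using e1 e2 e3 exp_ge_add_one_self[of r] zero_le_power2[of r] by linarith+
  qed
  have "hexp V 1 - mat 1 - V = (cosh r - 1) *\<^sub>R mat 1 + (sinh r / r - 1) *\<^sub>R V"
    unfolding hexp_def r_def[symmetric] by (simp add: algebra_simps)
  also have "norm \<dots> \<le> (cosh r - 1) * sqrt 2 + \<bar>sinh r / r - 1\<bar> * norm V"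
  proof -
    have "(norm (mat 1 :: cmat2))\<^sup>2 = 2"
      by (simp add: norm_cmat2_power2)
    then have "norm (mat 1 :: cmat2) = sqrt 2"
      by (metis norm_ge_zero real_sqrt_unique)
    with c(1) show ?thesis
      using norm_triangle_ineq[of "(cosh r - 1) *\<^sub>R (mat 1 :: cmat2)" "(sinh r / r - 1) *\<^sub>R V"] by simp
  qed
  also have "\<bar>sinh r / r - 1\<bar> * norm V \<le> r * norm V"
  proof (cases "V = 0")
    case False
    then have "r > 0" using r(4) by simp
    then have "\<bar>sinh r / r - 1\<bar> \<le> r"
      using s by (simp add: abs_le_iff field_simps power2_eq_square)
    then show ?thesis
      by (intro mult_right_mono) auto
  qed simp
  also have "r * norm V = sqrt 2 * r\<^sup>2"
    by (simp add: r_def power2_eq_square field_simps)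
  also have "(cosh r - 1) * sqrt 2 + sqrt 2 * r\<^sup>2 \<le> 2 * sqrt 2 * r\<^sup>2"
    using c(2) by (simp add: mult.commute)
  also have "\<dots> \<le> 2 * (norm V)\<^sup>2"
  proof -
    have "sqrt 2 \<le> 2" using real_sqrt_le_iff[of 2 4] by simp
    then have "sqrt 2 * (norm V)\<^sup>2 \<le> 2 * (norm V)\<^sup>2"
      by (rule mult_right_mono) simp
    then show ?thesis by (simp add: r(3))
  qed
  finally show ?thesis by simp
qed

text \<open>The endpoints of broken horizontal paths from the unit that consist of finitely many
  one-parameter pieces, with their length. By left invariance one matrix describes such paths between any two
  points. The distance \<open>\<rho>\<close> will turn out to be the infimum over these paths, so that every comparison of
  lengths reduces to them.\<close>

inductive reach :: "cmat2 \<Rightarrow> real \<Rightarrow> bool" where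
  reach_unit: "reach (mat 1) 0"
| reach_step: "reach h l \<Longrightarrow> V \<in> H0 \<Longrightarrow> reach (h ** hexp V 1) (l + sqrt 2 * norm V)"

lemma reach_det: "reach h l \<Longrightarrow> det h = 1"
  by (induction rule: reach.induct) (auto simp: det_mult_cmat2 det_hexp)

lemma reach_hexp: "V \<in> H0 \<Longrightarrow> reach (hexp V 1) (sqrt 2 * norm V)"
  using reach_step[OF reach_unit] by simp

lemma reach_mult:
  assumes "reach h l" "reach k m"
  shows "reach (h ** k) (l + m)"
  using assms(2)
proof induction
  case reach_unit
  then show ?case using assms(1) by simp
next
  case (reach_step k m V)
  from reach.reach_step[OF reach_step.IH reach_step.hyps(2)] show ?case
    by (simp add: matrix_mul_assoc add.assoc)
qed

lemma cmat2_transpose_nth [simp]: "transpose (A::cmat2) $ i $ j = A $ j $ i"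
  by (simp add: transpose_def)

lemma hexp_transpose: "transpose (hexp V t) = hexp (transpose V) t"
proof -
  have "(norm (transpose V))\<^sup>2 = (norm V)\<^sup>2"
    unfolding norm_cmat2_power2 by simp
  then have "norm (transpose V) = norm V" by simp
  then show ?thesis
    by (simp add: hexp_def cmat2_eq_iff)
qed

lemma reach_transpose: "reach h l \<Longrightarrow> reach (transpose h) l"
proof (induction rule: reach.induct)
  case reach_unit
  then show ?case using reach.reach_unit by (simp add: transpose_mat)
next
  case (reach_step h l V)
  have "transpose V \<in> H0"
    using reach_step.hyps(2) by (simp add: H0_iff)
  moreover have "norm (transpose V) = norm V"
  proof -
    have "(norm (transpose V))\<^sup>2 = (norm V)\<^sup>2"
      unfolding norm_cmat2_power2 by simp
    then show ?thesis by simp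
  qed
  ultimately have "reach (transpose (hexp V 1)) (sqrt 2 * norm V)"
    using reach_hexp[of "transpose V"] by (simp add: hexp_transpose)
  from reach_mult[OF this reach_step.IH] show ?case
    by (simp add: matrix_transpose_mul add.commute)
qed

text \<open>A positive definite Hermitian matrix of determinant 1 is a single exponential, of length twice the
  inverse hyperbolic cosine of half its trace. The stated bound is the part of this that matters near the unit.\<close>

lemma reach_posdef:
  assumes h: "Im (P$1$1) = 0" "Im (P$2$2) = 0" "P$2$1 = cnj (P$1$2)" and "det P = 1" and pos: "Re (P$1$1) > 0"
  obtains l where "reach P l" "l \<le> 4 * sqrt (Re (trace P) - 2)"
proof -
  define a b z where "a = Re (P$1$1)" and "b = Re (P$2$2)" and "z = P$1$2"
  define t where "t = (a + b) / 2"
  have P: "P$1$1 = of_real a" "P$2$2 = of_real b" "P$1$2 = z" "P$2$1 = cnj z"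
    using h by (simp_all add: a_def b_def z_def complex_eq_iff)
  have ab: "a * b = 1 + (cmod z)\<^sup>2"
    using \<open>det P = 1\<close> unfolding cmod_power2
    by (simp add: det_cmat2 P complex_eq_iff) (simp add: power2_eq_square)
  have "a > 0" using pos by (simp add: a_def)
  have "a * b > 0" using ab by (simp add: add_pos_nonneg)
  with \<open>a > 0\<close> have "b > 0" by (simp add: zero_less_mult_iff)
  have t2: "t\<^sup>2 = ((a - b) / 2)\<^sup>2 + 1 + (cmod z)\<^sup>2"
    using ab unfolding t_def by (simp add: power2_eq_square field_simps)
  then have "t\<^sup>2 \<ge> 1\<^sup>2" by simp
  moreover have "t > 0" using \<open>a > 0\<close> \<open>b > 0\<close> by (simp add: t_def)
  ultimately have "t \<ge> 1"
    by (metis abs_le_square_iff abs_of_pos zero_less_one)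
  define r where "r = arcosh t"
  have r: "r \<ge> 0" "cosh r = t"
    using \<open>t \<ge> 1\<close> by (simp_all add: r_def)
  have tr: "Re (trace P) - 2 = 2 * (t - 1)"
    by (simp add: trace_cmat2 P t_def)
  define V where "V = (r / sinh r) *\<^sub>R (P - t *\<^sub>R mat 1)"
  have V: "V \<in> H0"
    by (simp add: H0_iff V_def P t_def complex_eq_iff field_simps flip: add_divide_distrib)
  have sh: "(sinh r)\<^sup>2 = t\<^sup>2 - 1"
    using r(2) by (simp add: sinh_square_eq)
  have "(norm (P - t *\<^sub>R mat 1))\<^sup>2 = 2 * (sinh r)\<^sup>2"
  proof -
    have "(norm (P - t *\<^sub>R mat 1))\<^sup>2 = (a - t)\<^sup>2 + (b - t)\<^sup>2 + 2 * (cmod z)\<^sup>2"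
      unfolding norm_cmat2_power2 by (simp add: P cmod_power2)
    also have "\<dots> = 2 * (sinh r)\<^sup>2"
      unfolding sh t2 by (simp add: t_def power2_eq_square field_simps)
    finally show ?thesis .
  qed
  then have nP: "norm (P - t *\<^sub>R mat 1) = sqrt 2 * sinh r"
    using r(1) by (metis norm_ge_zero real_sqrt_abs real_sqrt_mult real_sqrt_unique abs_of_nonneg sinh_real_nonneg_iff)
  have nV: "norm V = sqrt 2 * r"
    using r(1) nP by (cases "r = 0") (auto simp: V_def)
  have "hexp V 1 = P"
  proof (cases "r = 0")
    case True
    then have "P = t *\<^sub>R mat 1" "t = 1"
      using nP r(2) by auto
    then show ?thesis using True by (simp add: V_def)
  next
    case False
    then have "hexp V 1 = cosh r *\<^sub>R mat 1 + (sinh r / r) *\<^sub>R V"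
      by (simp add: hexp_def nV)
    also have "\<dots> = P"
      using False r by (simp add: V_def)
    finally show ?thesis .
  qed
  moreover have "sqrt 2 * norm V \<le> 4 * sqrt (Re (trace P) - 2)"
  proof -
    have "exp r \<ge> 1 + r + r\<^sup>2 / 2" "exp (- r) \<ge> 1 - r"
      using exp_lower_Taylor_quadratic[OF r(1)] exp_ge_add_one_self[of "- r"] by simp_all
    then have "r\<^sup>2 \<le> 4 * (t - 1)"
      unfolding r(2)[symmetric] cosh_def by (simp add: field_simps)
    also have "\<dots> \<le> 4 * (Re (trace P) - 2)"
      using \<open>t \<ge> 1\<close> by (simp add: tr)
    finally have "r \<le> sqrt (4 * (Re (trace P) - 2))"
      by (rule real_le_rsqrt)
    also have "\<dots> = 2 * sqrt (Re (trace P) - 2)"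
      by (simp only: real_sqrt_mult) simp
    finally show ?thesis by (simp add: nV flip: mult.assoc)
  qed
  ultimately show thesis
    using that[of "sqrt 2 * norm V"] reach_hexp[OF V] by simp
qed


text \<open>A unipotent matrix is a commutator \<open>T \<Delta> T\<^sup>-\<^sup>1 \<Delta>\<^sup>-\<^sup>1\<close> of a unipotent \<open>T\<close> with entry \<open>c\<close> and
  a diagonal \<open>\<Delta>\<close> with entries \<open>\<mu>\<close>, \<open>1 / \<mu>\<close>, provided that \<open>c (1 - \<mu>\<^sup>2) = z\<close>. Grouped as
  \<open>(T \<Delta> T\<^sup>*) (T T\<^sup>*)\<^sup>-\<^sup>1 \<Delta>\<^sup>-\<^sup>1\<close> it is a product of three positive definite matrices. The choice
  \<open>1 - \<mu>\<^sup>2 = \<bar>c\<bar> = \<surd>\<bar>z\<bar>\<close> makes all three close to the unit; the square root is the expected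
  price of a direction transversal to \<open>H0\<close>.\<close>

lemma reach_upper:
  assumes "cmod z \<le> 1/4"
  obtains l where "reach (mat2 1 z 0 1) l" "l \<le> 24 * sqrt (cmod z)"
proof -
  \<comment> \<open>\<open>P = T \<Delta> T\<^sup>*\<close> and \<open>Q = (T T\<^sup>*)\<^sup>-\<^sup>1\<close> for \<open>T = mat2 1 c 0 1\<close> and \<open>\<Delta> = mat2 \<mu> 0 0 (1 / \<mu>)\<close>, and \<open>D = \<Delta>\<^sup>-\<^sup>1\<close>.\<close>
  define s where "s = sqrt (cmod z)"
  have s: "0 \<le> s" "s \<le> 1/2" "s\<^sup>2 = cmod z"
    using assms real_sqrt_le_mono[OF assms] by (simp_all add: s_def real_sqrt_divide)
  define \<mu> where "\<mu> = sqrt (1 - s)"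
  have \<mu>: "\<mu>\<^sup>2 = 1 - s" "\<mu> \<le> 1" "\<mu> \<ge> 1/2"
  proof -
    show "\<mu>\<^sup>2 = 1 - s" "\<mu> \<le> 1"
      using s by (simp_all add: \<mu>_def)
    have "sqrt ((1/2)\<^sup>2) \<le> sqrt (1 - s)"
      using s by (intro real_sqrt_le_mono) (simp add: power2_eq_square)
    then show "\<mu> \<ge> 1/2" by (simp add: \<mu>_def)
  qed
  have \<mu>s: "1 - \<mu> \<le> s"
  proof -
    have "(1 - \<mu>) * (1 + \<mu>) = s" using \<mu>(1) by (simp add: algebra_simps power2_eq_square)
    moreover have "(1 - \<mu>) * 1 \<le> (1 - \<mu>) * (1 + \<mu>)"
      using \<mu> by (intro mult_left_mono) auto
    ultimately show ?thesis by simp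
  qed
  define c where "c = z / of_real s"
  have cs: "c * of_real s = z"
    using s(3) by (cases "s = 0") (auto simp: c_def)
  have c2: "c * cnj c = of_real (s\<^sup>2)"
  proof (cases "s = 0")
    case False
    then have "cmod c = s"
      using s by (simp add: c_def norm_divide) (metis power2_eq_square nonzero_mult_div_cancel_right)
    then show ?thesis by (simp add: complex_norm_square[symmetric])
  qed (simp add: c_def)
  let ?m = "of_real \<mu> :: complex"
  have m0: "?m \<noteq> 0" using \<mu>(3) by auto
  define P where "P = mat2 (?m + c * cnj c / ?m) (c / ?m) (cnj c / ?m) (1 / ?m)"
  define Q where "Q = mat2 1 (- c) (- cnj c) (1 + c * cnj c)"
  define D where "D = mat2 (1 / ?m) 0 0 ?m"
  have prod: "P ** Q ** D = mat2 1 z 0 1"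
  proof -
    have PQ: "P ** Q = mat2 ?m (c / ?m - c * ?m) 0 (1 / ?m)"
      using m0 by (simp add: cmat2_eq_iff cmat2_mult_nth P_def Q_def field_simps)
    have "(c / ?m - c * ?m) * ?m = c * (1 - ?m\<^sup>2)"
      using m0 by (simp add: field_simps power2_eq_square)
    also have "?m\<^sup>2 = 1 - of_real s"
      using \<mu>(1) by (metis of_real_1 of_real_diff of_real_power)
    finally show ?thesis
      using m0 by (simp add: PQ cmat2_eq_iff cmat2_mult_nth D_def cs)
  qed
  have P: "det P = 1" "det Q = 1" "det D = 1"
    using m0 by (simp_all add: det_cmat2 P_def Q_def D_def field_simps)
  have \<mu>2: "\<mu> + 1 / \<mu> - 2 \<le> 2 * s\<^sup>2"
  proof -
    have "\<mu> + 1 / \<mu> - 2 = (1 - \<mu>)\<^sup>2 / \<mu>"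
      using \<mu>(3) by (simp add: field_simps power2_eq_square)
    also have "\<dots> \<le> s\<^sup>2 / (1/2)"
      using \<mu> \<mu>s s by (intro frac_le power_mono) auto
    finally show ?thesis by simp
  qed
  have bound: "4 * sqrt x \<le> 8 * s" if "x \<le> 4 * s\<^sup>2" for x
  proof -
    have "sqrt x \<le> sqrt ((2 * s)\<^sup>2)"
      using that by (intro real_sqrt_le_mono) (simp add: power_mult_distrib)
    also have "\<dots> = 2 * s" using s(1) by (intro real_sqrt_unique) auto
    finally show ?thesis by simp
  qed
  have tP: "Re (trace P) - 2 \<le> 4 * s\<^sup>2"
  proof -
    have "Re (trace P) - 2 = \<mu> + 1 / \<mu> - 2 + s\<^sup>2 / \<mu>"
      by (simp add: trace_cmat2 P_def c2 Re_divide_of_real)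
    moreover have "s\<^sup>2 / \<mu> \<le> s\<^sup>2 / (1/2)"
      using \<mu>(3) by (intro divide_left_mono) auto
    ultimately show ?thesis using \<mu>2 by simp
  qed
  have tQ: "Re (trace Q) - 2 \<le> 4 * s\<^sup>2"
    by (simp add: trace_cmat2 Q_def c2)
  have tD: "Re (trace D) - 2 \<le> 4 * s\<^sup>2"
  proof -
    have "Re (trace D) - 2 = \<mu> + 1 / \<mu> - 2"
      by (simp add: trace_cmat2 D_def Re_divide_of_real)
    then show ?thesis using \<mu>2 zero_le_power2[of s] by linarith
  qed
  obtain l1 where l1: "reach P l1" "l1 \<le> 4 * sqrt (Re (trace P) - 2)"
  proof (rule reach_posdef[of P])
    show "Im (P $ 1 $ 1) = 0" "Im (P $ 2 $ 2) = 0" "P $ 2 $ 1 = cnj (P $ 1 $ 2)"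
      by (simp_all add: P_def c2 Im_divide_of_real)
    show "0 < Re (P $ 1 $ 1)"
      using \<mu>(3) by (simp add: P_def c2 Re_divide_of_real add_pos_nonneg)
  qed (use P in auto)
  obtain l2 where l2: "reach Q l2" "l2 \<le> 4 * sqrt (Re (trace Q) - 2)"
  proof (rule reach_posdef[of Q])
    show "Im (Q $ 1 $ 1) = 0" "Im (Q $ 2 $ 2) = 0" "Q $ 2 $ 1 = cnj (Q $ 1 $ 2)" "0 < Re (Q $ 1 $ 1)"
      by (simp_all add: Q_def c2)
  qed (use P in auto)
  obtain l3 where l3: "reach D l3" "l3 \<le> 4 * sqrt (Re (trace D) - 2)"
  proof (rule reach_posdef[of D])
    show "Im (D $ 1 $ 1) = 0" "Im (D $ 2 $ 2) = 0" "D $ 2 $ 1 = cnj (D $ 1 $ 2)" "0 < Re (D $ 1 $ 1)"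
      using \<mu>(3) by (simp_all add: D_def Re_divide_of_real Im_divide_of_real)
  qed (use P in auto)
  have "reach (mat2 1 z 0 1) (l1 + l2 + l3)"
    using reach_mult[OF reach_mult[OF l1(1) l2(1)] l3(1)] prod by simp
  moreover have "l1 + l2 + l3 \<le> 24 * s"
    using l1(2) l2(2) l3(2) bound[OF tP] bound[OF tQ] bound[OF tD] by linarith
  ultimately show thesis
    using that by (simp add: s_def)
qed

lemma reach_lower:
  assumes "cmod z \<le> 1/4"
  obtains l where "reach (mat2 1 0 z 1) l" "l \<le> 24 * sqrt (cmod z)"
proof -
  obtain l where l: "reach (mat2 1 z 0 1) l" "l \<le> 24 * sqrt (cmod z)"
    by (rule reach_upper[OF assms]) (rule that)
  have "transpose (mat2 1 z 0 1) = mat2 1 0 z 1"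
    by (simp add: cmat2_eq_iff)
  with reach_transpose[OF l(1)] l(2) show thesis
    using that by simp
qed

text \<open>The quantitative form of bracket generation that is needed: points near the unit are reached by
  short broken paths. Elimination writes a matrix near the unit as lower, upper, lower, upper unipotent
  with small entries.\<close>

lemma reach_small:
  assumes "\<epsilon> > 0"
  obtains \<delta> where "\<delta> > 0" "\<And>h. det h = 1 \<Longrightarrow> norm (h - mat 1) < \<delta> \<Longrightarrow> \<exists>l < \<epsilon>. reach h l"
proof -
  define \<eta> where "\<eta> = min (1/2) (\<epsilon> / 200)"
  define \<delta> where "\<delta> = (\<eta>\<^sup>2 / 4)\<^sup>2"
  have \<eta>: "\<eta> > 0" "\<eta> \<le> 1/2" "\<eta> \<le> \<epsilon> / 200"
    using assms by (auto simp: \<eta>_def)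
  have "\<eta>\<^sup>2 \<le> 1/4"
    using power_mono[OF \<eta>(2), of 2] \<eta>(1) by (simp add: power2_eq_square)
  define t where "t = \<eta>\<^sup>2 / 4"
  have t: "t > 0" "t \<le> 1/16" "\<delta> = t\<^sup>2"
    using \<eta>(1) \<open>\<eta>\<^sup>2 \<le> 1/4\<close> by (simp_all add: t_def \<delta>_def)
  have \<delta>: "\<delta> > 0" "\<delta> \<le> t" "\<delta> \<le> 1/2"
  proof -
    show "\<delta> > 0" using t by simp
    have "t * t \<le> t * 1" using t by (intro mult_left_mono) auto
    then show "\<delta> \<le> t" by (simp add: t power2_eq_square)
    with t show "\<delta> \<le> 1/2" by simp
  qed
  have "\<exists>l < \<epsilon>. reach h l" if h: "det h = 1" "norm (h - mat 1) < \<delta>" for h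
  proof -
    define p q r s where "p = h$1$1" and "q = h$1$2" and "r = h$2$1" and "s = h$2$2"
    have "cmod (p - 1) \<le> norm (h - mat 1)" "cmod q \<le> norm (h - mat 1)" "cmod r \<le> norm (h - mat 1)"
      using Finite_Cartesian_Product.norm_nth_le[of "(h - mat 1)$1" 1]
        Finite_Cartesian_Product.norm_nth_le[of "(h - mat 1)$1" 2]
        Finite_Cartesian_Product.norm_nth_le[of "(h - mat 1)$2" 1]
        Finite_Cartesian_Product.norm_nth_le[of "h - mat 1" 1]
        Finite_Cartesian_Product.norm_nth_le[of "h - mat 1" 2]
      by (auto simp: p_def q_def r_def)
    with h(2) have small: "cmod (p - 1) < \<delta>" "cmod q < \<delta>" "cmod r < \<delta>"
      by auto
    have p: "cmod p \<ge> 1/2"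
      using norm_triangle_ineq2[of 1 "1 - p"] small(1) \<delta>(3) by (simp add: norm_minus_commute)
    then have "p \<noteq> 0" by auto
    define x where "x = csqrt (p - 1)"
    have x: "x * x = p - 1" "cmod x < t"
    proof -
      show "x * x = p - 1"
        by (simp add: x_def flip: power2_eq_square)
      then have "(cmod x)\<^sup>2 = cmod (p - 1)"
        by (metis norm_mult power2_eq_square)
      then have "(cmod x)\<^sup>2 < t\<^sup>2" using small(1) t(3) by simp
      then show "cmod x < t"
        using t(1) by (simp add: power2_less_imp_less)
    qed
    have quot: "cmod ((y - x) / p) \<le> \<eta>\<^sup>2" if "cmod y < \<delta>" for y
    proof -
      have "cmod (y - x) \<le> 2 * t"
        using norm_triangle_ineq4[of y x] that x(2) \<delta>(2) by simp
      then have "cmod (y - x) / cmod p \<le> (2 * t) / (1/2)"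
        using p t(1) by (intro frac_le) auto
      then show ?thesis by (simp add: norm_divide t_def)
    qed
    have step: "24 * sqrt (cmod y) \<le> 24 * \<eta>" "cmod y \<le> 1/4" if "cmod y \<le> \<eta>\<^sup>2" for y
      using real_sqrt_le_mono[OF that] \<eta>(1) \<open>\<eta>\<^sup>2 \<le> 1/4\<close> that by auto
    have yx: "cmod x \<le> \<eta>\<^sup>2"
      using x(2) t(1) unfolding t_def by linarith
    have ps: "p * s - q * r = 1"
      using h(1) by (simp add: det_cmat2 p_def q_def r_def s_def)
    obtain l1 where l1: "reach (mat2 1 0 ((r - x) / p) 1) l1" "l1 \<le> 24 * sqrt (cmod ((r - x) / p))"
      by (rule reach_lower[OF step(2)[OF quot[OF small(3)]]]) (rule that)
    obtain l2 where l2: "reach (mat2 1 x 0 1) l2" "l2 \<le> 24 * sqrt (cmod x)"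
      by (rule reach_upper[OF step(2)[OF yx]]) (rule that)
    obtain l3 where l3: "reach (mat2 1 0 x 1) l3" "l3 \<le> 24 * sqrt (cmod x)"
      by (rule reach_lower[OF step(2)[OF yx]]) (rule that)
    obtain l4 where l4: "reach (mat2 1 ((q - x) / p) 0 1) l4" "l4 \<le> 24 * sqrt (cmod ((q - x) / p))"
      by (rule reach_upper[OF step(2)[OF quot[OF small(2)]]]) (rule that)
    \<comment> \<open>Clearing the first row and column of \<open>h\<close>: the corner \<open>p\<close> is \<open>1 + x\<^sup>2\<close>.\<close>
    have M: "mat2 1 x 0 1 ** mat2 1 0 x 1 = mat2 p x x 1"
      using x(1) by (simp add: cmat2_eq_iff cmat2_mult_nth)
    have "mat2 1 0 ((r - x) / p) 1 ** mat2 p x x 1 ** mat2 1 ((q - x) / p) 0 1 = h"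
    proof -
      have "mat2 1 0 ((r - x) / p) 1 ** mat2 p x x 1 = mat2 p x r ((r - x) * x / p + 1)"
        using \<open>p \<noteq> 0\<close> by (simp add: cmat2_eq_iff cmat2_mult_nth)
      moreover have "r * ((q - x) / p) + ((r - x) * x / p + 1) = s"
      proof -
        have "p * (r * ((q - x) / p) + ((r - x) * x / p + 1)) = r * q - x * x + p"
          using \<open>p \<noteq> 0\<close> by (simp add: distrib_left) (simp add: algebra_simps)
        also have "\<dots> = p * s" using x(1) ps by (simp add: algebra_simps)
        finally show ?thesis using \<open>p \<noteq> 0\<close> by simp
      qed
      ultimately show ?thesis
        using \<open>p \<noteq> 0\<close> by (simp add: cmat2_eq_iff cmat2_mult_nth p_def q_def r_def s_def)
    qed
    then have "reach h (l1 + (l2 + l3) + l4)"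
      using reach_mult[OF reach_mult[OF l1(1) reach_mult[OF l2(1) l3(1)]] l4(1)] M by simp
    moreover have "l1 + (l2 + l3) + l4 \<le> 96 * \<eta>"
      using l1(2) l2(2) l3(2) l4(2) step(1)[OF yx] step(1)[OF quot[OF small(2)]] step(1)[OF quot[OF small(3)]]
      by linarith
    moreover have "96 * \<eta> < \<epsilon>"
      using \<eta> assms by linarith
    ultimately show ?thesis by (intro exI[of _ "l1 + (l2 + l3) + l4"]) auto
  qed
  with \<delta>(1) show thesis using that by blast
qed

section \<open>Polygonal approximation of horizontal curves\<close>

lemma ae_onI:
  assumes "negligible N" "\<And>t. t \<in> interior S - N \<Longrightarrow> P t"
  shows "ae_on S P"
proof (rule AE_I')
  show "N \<in> null_sets lebesgue"
    using assms(1) by (simp add: negligible_iff_null_sets)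
  show "{t \<in> space lebesgue. \<not> (t \<in> interior S \<longrightarrow> P t)} \<subseteq> N"
    using assms(2) by auto
qed

lemma ae_onE:
  assumes "ae_on S P"
  obtains N where "negligible N" "\<And>t. t \<in> interior S \<Longrightarrow> t \<notin> N \<Longrightarrow> P t"
proof -
  obtain N where N: "{t \<in> space lebesgue. \<not> (t \<in> interior S \<longrightarrow> P t)} \<subseteq> N" "N \<in> null_sets lebesgue"
    using assms by (auto elim!: AE_E simp: null_sets_def)
  show thesis
    by (rule that[of N]) (use N in \<open>auto simp: negligible_iff_null_sets\<close>)
qed

lemma ae_on_IccE:
  fixes a b :: real
  assumes "ae_on {a..b} P"
  obtains N where "negligible N" "\<And>t. t \<in> {a..b} - N \<Longrightarrow> a < t \<and> t < b \<and> P t"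
proof -
  obtain N where N: "negligible N" "\<And>t. t \<in> interior {a..b} \<Longrightarrow> t \<notin> N \<Longrightarrow> P t"
    by (rule ae_onE[OF assms]) (rule that)
  show thesis
  proof (rule that[of "N \<union> {a, b}"])
    show "negligible (N \<union> {a, b})"
      using N(1) by (simp add: negligible_Un)
  qed (use N(2) in auto)
qed

lemma lipschitz_deriv_bound:
  fixes f :: "real \<Rightarrow> 'a::real_normed_vector"
  assumes lip: "L-lipschitz_on {a..b} f" and t: "a < t" "t < b" and D: "(f has_vector_derivative D) (at t)"
  shows "norm D \<le> L"
proof (rule field_le_epsilon)
  fix e :: real assume "e > 0"
  then obtain d where d: "d > 0" "\<And>y. norm (y - t) < d \<Longrightarrow> norm (f y - f t - (y - t) *\<^sub>R D) \<le> e * norm (y - t)"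
    using D unfolding has_vector_derivative_def has_derivative_at_alt by blast
  define s where "s = min (d / 2) (b - t)"
  have s: "s > 0" "s < d" "t + s \<le> b"
    using d(1) t by (auto simp: s_def)
  have "norm (s *\<^sub>R D) \<le> norm (f (t + s) - f t) + norm (f (t + s) - f t - s *\<^sub>R D)"
    using norm_triangle_ineq4[of "f (t + s) - f t" "f (t + s) - f t - s *\<^sub>R D"] by simp
  also have "\<dots> \<le> L * s + e * s"
    using d(2)[of "t + s"] lipschitz_on_normD[OF lip, of "t + s" t] s t by simp
  finally have "s * norm D \<le> s * (L + e)"
    using s(1) by (simp add: algebra_simps)
  then show "norm D \<le> L + e"
    using s(1) by simp
qed

lemma prH0_ident: "u \<in> H0 \<Longrightarrow> prH0 u = u"
  using prH0_unique[of u u] by simp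

text \<open>A Lipschitzian horizontal curve is cut into \<open>n\<close> equal pieces, each replaced by the exponential of the
  integral of the control. This does not increase the length, and the endpoint is missed by \<open>O(1 / n)\<close> only: a single
  piece errs by \<open>O(1 / n\<^sup>2)\<close>. The gap is closed by \<open>reach_small\<close>. Hence Lipschitzian curves are
  not shorter than broken ones, although \<open>\<rho>\<close> is defined by piecewise \<open>C\<^sup>1\<close> curves alone.\<close>

lemma polygon_approximation:
  fixes \<eta> v :: "real \<Rightarrow> cmat2"
  assumes "a < b" and lip: "L-lipschitz_on {a..b} \<eta>" and det: "\<And>t. t \<in> {a..b} \<Longrightarrow> det (\<eta> t) = 1"
    and N: "negligible N"
    and deriv: "\<And>t. t \<in> {a..b} - N \<Longrightarrow> a < t \<and> t < b \<and> (\<eta> has_vector_derivative \<eta> t ** v t) (at t) \<and> v t \<in> H0"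
  shows "(\<lambda>t. sqrt 2 * norm (v t)) integrable_on {a..b}"
    and "\<epsilon> > 0 \<Longrightarrow> \<exists>l. reach (adj (\<eta> a) ** \<eta> b) l \<and> l \<le> integral {a..b} (\<lambda>t. sqrt 2 * norm (v t)) + \<epsilon>"
proof -
  have L: "L \<ge> 0" by (rule lipschitz_on_nonneg[OF lip])
  have ac: "AC_on a b \<eta>" by (rule lipschitz_imp_AC[OF lip])
  have cont: "continuous_on {a..b} \<eta>" by (rule AC_on_continuous[OF ac])
  obtain M0 where M0: "M0 \<ge> 0" "\<And>t. t \<in> {a..b} \<Longrightarrow> norm (\<eta> t) \<le> M0"
    by (rule AC_on_bounded[OF ac]) (rule that)
  define M where "M = M0 + 1"
  have M: "M \<ge> 1" "\<And>t. t \<in> {a..b} \<Longrightarrow> norm (\<eta> t) \<le> M"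
  proof -
    show "M \<ge> 1" using M0(1) by (simp add: M_def)
    show "norm (\<eta> t) \<le> M" if "t \<in> {a..b}" for t
      using M0(2)[OF that] by (simp add: M_def)
  qed
  define K where "K = M * L + 1"
  have K: "K > 0" using M L by (simp add: K_def add_nonneg_pos)
  \<comment> \<open>Set to zero on the exceptional set, the control satisfies its bounds at every point.\<close>
  define w where "w t = (if t \<in> {a..b} - N then v t else 0)" for t
  have wH: "w t \<in> H0" for t
    using deriv subspace_0[OF subspace_H0] by (auto simp: w_def)
  have wd: "norm (\<eta> t ** w t) \<le> L" for t
    using lipschitz_deriv_bound[OF lip] deriv L by (auto simp: w_def cmult.zero_right)
  have wK: "norm (w t) \<le> K" for t
  proof (cases "t \<in> {a..b} - N")
    case True
    then have "w t = adj (\<eta> t) ** (\<eta> t ** w t)"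
      using det by simp
    then have "norm (w t) \<le> norm (\<eta> t) * norm (\<eta> t ** w t)"
      by (metis norm_cmat2_mult_le norm_adj)
    also have "\<dots> \<le> M * L"
      using M True wd[of t] by (intro mult_mono) auto
    finally show ?thesis by (simp add: K_def)
  qed (use K in \<open>auto simp: w_def\<close>)
  have ftc: "((\<lambda>t. \<eta> t ** w t) has_integral (\<eta> d - \<eta> c)) {c..d}" if "a \<le> c" "c \<le> d" "d \<le> b" for c d
  proof (rule AC_FTC[OF that(2) _ N])
    show "AC_on c d \<eta>"
      by (rule AC_on_subset[OF ac that(1,3)])
    fix x assume "x \<in> {c..d} - N"
    then have "x \<in> {a..b} - N" using that by auto
    with deriv[OF this] show "(\<eta> has_vector_derivative \<eta> x ** w x) (at x within {c..d})"
      by (auto simp: w_def intro: has_vector_derivative_at_within)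
  qed
  have abs: "w absolutely_integrable_on {a..b}"
  proof -
    have "(\<lambda>t. \<eta> t ** w t) absolutely_integrable_on {a..b}"
      using ftc[of a b] \<open>a < b\<close> wd
      by (intro absolutely_integrable_integrable_bound[where g = "\<lambda>_. L"]) (auto simp: integrable_on_def)
    note ai = this
    have ca: "continuous_on {a..b} (\<lambda>t. adj (\<eta> t))"
      by (rule bounded_linear.continuous_on[OF bounded_linear_adj cont])
    have "bilinear ((**) :: cmat2 \<Rightarrow> cmat2 \<Rightarrow> cmat2)"
      using bounded_bilinear_cmat2_mult by (simp add: bilinear_conv_bounded_bilinear)
    moreover have "(\<lambda>t. adj (\<eta> t)) \<in> borel_measurable (lebesgue_on {a..b})"
      by (rule continuous_imp_measurable_on_sets_lebesgue[OF ca]) simp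
    moreover have "{a..b} \<in> sets lebesgue" by simp
    moreover have "bounded ((\<lambda>t. adj (\<eta> t)) ` {a..b})"
      by (rule compact_imp_bounded[OF compact_continuous_image[OF ca]]) simp
    ultimately have "(\<lambda>t. adj (\<eta> t) ** (\<eta> t ** w t)) absolutely_integrable_on {a..b}"
      by (rule absolutely_integrable_bounded_measurable_product[OF _ _ _ _ ai])
    then show ?thesis
      by (rule set_integrable_cong[THEN iffD1, rotated -1]) (use det in auto)
  qed
  define F where "F = (\<lambda>t. sqrt 2 * norm (w t))"
  have wint: "w integrable_on {c..d}" if "a \<le> c" "d \<le> b" for c d
    using integrable_subinterval_real[of w a b c d] abs that
    by (auto simp: absolutely_integrable_on_def)
  have Fint: "F integrable_on {c..d}" if "a \<le> c" "d \<le> b" for c d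
    using integrable_subinterval_real[of "\<lambda>t. norm (w t)" a b c d] abs that
    unfolding F_def by (auto simp: absolutely_integrable_on_def intro!: integrable_on_cmult_left)
  have vF: "(\<lambda>t. sqrt 2 * norm (v t)) integrable_on {a..b}"
    "integral {a..b} (\<lambda>t. sqrt 2 * norm (v t)) = integral {a..b} F"
  proof -
    show "(\<lambda>t. sqrt 2 * norm (v t)) integrable_on {a..b}"
      by (rule integrable_spike[OF Fint[OF order_refl order_refl] N]) (auto simp: F_def w_def)
    show "integral {a..b} (\<lambda>t. sqrt 2 * norm (v t)) = integral {a..b} F"
      by (rule integral_spike[OF N]) (auto simp: F_def w_def)
  qed
  show "(\<lambda>t. sqrt 2 * norm (v t)) integrable_on {a..b}" by (fact vF(1))

  define V where "V c d = integral {c..d} w" for c d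
  have VH: "V c d \<in> H0" if "a \<le> c" "d \<le> b" for c d
  proof -
    have "prH0 (V c d) = integral {c..d} (\<lambda>t. prH0 (w t))"
      using integral_linear[OF wint[OF that] bounded_linear_prH0] by (simp add: V_def o_def)
    also have "\<dots> = V c d" by (simp add: V_def prH0_ident[OF wH])
    finally show ?thesis using prH0_in[of "V c d"] by simp
  qed
  have VF: "sqrt 2 * norm (V c d) \<le> integral {c..d} F" if "a \<le> c" "d \<le> b" for c d
  proof -
    have "(\<lambda>t. norm (w t)) integrable_on {c..d}"
      using Fint[OF that] unfolding F_def by simp
    then have "norm (V c d) \<le> integral {c..d} (\<lambda>t. norm (w t))"
      unfolding V_def by (intro integral_norm_bound_integral wint that) auto
    then show ?thesis by (simp add: F_def)
  qed
  have VK: "norm (V c d) \<le> K * (d - c)" if "a \<le> c" "c \<le> d" "d \<le> b" for c d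
  proof -
    have "norm (V c d) \<le> integral {c..d} (\<lambda>t. K)"
      unfolding V_def using wK that by (intro integral_norm_bound_integral wint) auto
    then show ?thesis using that by (simp add: mult.commute)
  qed
  define C where "C = L * K + 2 * M * K\<^sup>2"
  have C: "C \<ge> 0" using L K M by (simp add: C_def)
  have piece: "norm (\<eta> d - \<eta> c ** hexp (V c d) 1) \<le> C * (d - c)\<^sup>2"
    "norm (hexp (V c d) 1 - mat 1) \<le> 3 * K * (d - c)"
    if cd: "a \<le> c" "c \<le> d" "d \<le> b" and small: "K * (d - c) \<le> 1" for c d
  proof -
    have V1: "norm (V c d) \<le> 1" "norm (V c d) \<le> K * (d - c)"
      using VK[OF cd] small by auto
    then have V2: "(norm (V c d))\<^sup>2 \<le> (K * (d - c))\<^sup>2" "(norm (V c d))\<^sup>2 \<le> norm (V c d)"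
      using power_mono[OF V1(2) norm_ge_zero, of 2] mult_left_le_one_le[OF norm_ge_zero norm_ge_zero V1(1)]
      by (simp_all add: power2_eq_square)
    have "((\<lambda>t. \<eta> t ** w t - \<eta> c ** w t) has_integral (\<eta> d - \<eta> c - \<eta> c ** V c d)) {c..d}"
      using has_integral_linear[OF integrable_integral[OF wint[OF cd(1,3)]] cmult.bounded_linear_right[of "\<eta> c"]]
      by (intro has_integral_diff ftc cd) (simp add: V_def o_def)
    then have I: "((\<lambda>t. (\<eta> t - \<eta> c) ** w t) has_integral (\<eta> d - \<eta> c - \<eta> c ** V c d)) {c..d}"
      by (simp add: cmult.diff_left)
    have "norm ((\<eta> t - \<eta> c) ** w t) \<le> L * (d - c) * K" if "t \<in> {c..d}" for t
    proof -
      have "norm ((\<eta> t - \<eta> c) ** w t) \<le> norm (\<eta> t - \<eta> c) * norm (w t)"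
        by (rule norm_cmat2_mult_le)
      also have "\<dots> \<le> (L * (d - c)) * K"
      proof (rule mult_mono)
        have "norm (\<eta> t - \<eta> c) \<le> L * norm (t - c)"
          using that cd by (intro lipschitz_on_normD[OF lip]) auto
        also have "\<dots> \<le> L * (d - c)"
          using that L by (intro mult_left_mono) auto
        finally show "norm (\<eta> t - \<eta> c) \<le> L * (d - c)" .
      qed (use wK L cd in auto)
      finally show ?thesis .
    qed
    then have "norm (integral {c..d} (\<lambda>t. (\<eta> t - \<eta> c) ** w t)) \<le> integral {c..d} (\<lambda>t. L * (d - c) * K)"
      using I by (intro integral_norm_bound_integral) auto
    then have i1: "norm (\<eta> d - \<eta> c - \<eta> c ** V c d) \<le> L * K * (d - c)\<^sup>2"
      using integral_unique[OF I] cd(2) by (simp add: power2_eq_square mult_ac)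
    have i2: "norm (\<eta> c ** (hexp (V c d) 1 - mat 1 - V c d)) \<le> M * (2 * (K * (d - c))\<^sup>2)"
    proof -
      have "norm (\<eta> c ** (hexp (V c d) 1 - mat 1 - V c d)) \<le> norm (\<eta> c) * norm (hexp (V c d) 1 - mat 1 - V c d)"
        by (rule norm_cmat2_mult_le)
      also have "\<dots> \<le> M * (2 * (K * (d - c))\<^sup>2)"
        using hexp_close[OF V1(1)] V2(1) M(1) M(2)[of c] cd by (intro mult_mono) auto
      finally show ?thesis .
    qed
    have eq: "\<eta> d - \<eta> c ** hexp (V c d) 1
        = (\<eta> d - \<eta> c - \<eta> c ** V c d) - \<eta> c ** (hexp (V c d) 1 - mat 1 - V c d)"
      by (simp add: cmult.diff_right)
    have "norm (\<eta> d - \<eta> c ** hexp (V c d) 1)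
        \<le> norm (\<eta> d - \<eta> c - \<eta> c ** V c d) + norm (\<eta> c ** (hexp (V c d) 1 - mat 1 - V c d))"
      unfolding eq by (rule norm_triangle_ineq4)
    also have "\<dots> \<le> L * K * (d - c)\<^sup>2 + M * (2 * (K * (d - c))\<^sup>2)"
      by (rule add_mono[OF i1 i2])
    also have "\<dots> = C * (d - c)\<^sup>2"
      unfolding C_def power_mult_distrib by (simp add: algebra_simps)
    finally show "norm (\<eta> d - \<eta> c ** hexp (V c d) 1) \<le> C * (d - c)\<^sup>2" .
    have "norm (hexp (V c d) 1 - mat 1) \<le> norm (hexp (V c d) 1 - mat 1 - V c d) + norm (V c d)"
      using norm_triangle_ineq[of "hexp (V c d) 1 - mat 1 - V c d" "V c d"] by simp
    also have "\<dots> \<le> 2 * norm (V c d) + norm (V c d)"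
      using hexp_close[OF V1(1)] V2(2) by simp
    also have "\<dots> \<le> 3 * K * (d - c)" using V1(2) by simp
    finally show "norm (hexp (V c d) 1 - mat 1) \<le> 3 * K * (d - c)" .
  qed
  define T where "T = b - a"
  have "T > 0" using \<open>a < b\<close> by (simp add: T_def)
  define c where "c = C * T\<^sup>2 * exp (3 * K * T)"
  have "c \<ge> 0" using C by (simp add: c_def)
  \<comment> \<open>Each of the \<open>n\<close> pieces adds an error \<open>p = O(1 / n\<^sup>2)\<close> and amplifies the error so far by at most \<open>1 + q\<close> with \<open>q = O(1 / n)\<close>.\<close>
  have poly: "\<exists>Y l. reach Y l \<and> l \<le> integral {a..b} F \<and> norm (\<eta> b - \<eta> a ** Y) \<le> c / n"
    if n: "n > 0" "K * T \<le> n" for n :: nat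
  proof -
    define \<Delta> where "\<Delta> = T / n"
    define p q where "p = C * \<Delta>\<^sup>2" and "q = 3 * K * \<Delta>"
    define s where "s i = a + real i * \<Delta>" for i
    have \<Delta>: "\<Delta> > 0" "K * \<Delta> \<le> 1" using n \<open>T > 0\<close> by (simp_all add: \<Delta>_def)
    have p0: "p \<ge> 0" "q \<ge> 0" using C K \<Delta> by (simp_all add: p_def q_def)
    have s0: "s 0 = a" "s n = b" "\<And>i. s (Suc i) - s i = \<Delta>"
    proof -
      have "real n * \<Delta> = T" using n by (simp add: \<Delta>_def)
      then show "s n = b" by (simp add: s_def T_def)
    qed (simp_all add: s_def algebra_simps)
    have sle: "a \<le> s i" "s i \<le> s (Suc i)" "i \<le> n \<Longrightarrow> s i \<le> b" for i
    proof -
      show "a \<le> s i" "s i \<le> s (Suc i)"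
        using \<Delta> by (simp_all add: s_def)
      assume "i \<le> n"
      then have "real i * \<Delta> \<le> real n * \<Delta>"
        using \<Delta>(1) by (intro mult_right_mono) auto
      then show "s i \<le> b" using s0(2) by (simp add: s_def)
    qed
    have "\<exists>Y l. reach Y l \<and> l \<le> integral {a..s i} F \<and> norm (\<eta> (s i) - \<eta> a ** Y) \<le> real i * p * (1 + q) ^ i"
      if "i \<le> n" for i
      using that
    proof (induction i)
      case 0
      show ?case
        by (rule exI[of _ "mat 1"], rule exI[of _ 0]) (simp add: reach_unit s0)
    next
      case (Suc i)
      then obtain Y l where Y: "reach Y l" "l \<le> integral {a..s i} F"
        "norm (\<eta> (s i) - \<eta> a ** Y) \<le> real i * p * (1 + q) ^ i" by auto
      have le: "s (Suc i) \<le> b" "a \<le> s i" "s i \<le> s (Suc i)"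
        using sle Suc.prems by auto
      define E where "E = hexp (V (s i) (s (Suc i))) 1"
      have E: "norm (\<eta> (s (Suc i)) - \<eta> (s i) ** E) \<le> p" "norm (E - mat 1) \<le> q"
        using piece[OF le(2,3,1)] s0(3)[of i] \<Delta>(2) by (simp_all add: E_def p_def q_def)
      have "reach (Y ** E) (l + sqrt 2 * norm (V (s i) (s (Suc i))))"
        unfolding E_def by (rule reach_step[OF Y(1) VH[OF le(2,1)]])
      moreover have "l + sqrt 2 * norm (V (s i) (s (Suc i))) \<le> integral {a..s (Suc i)} F"
      proof -
        have "integral {a..s i} F + integral {s i..s (Suc i)} F = integral {a..s (Suc i)} F"
          by (rule Henstock_Kurzweil_Integration.integral_combine[OF le(2,3) Fint[OF order_refl le(1)]])
        then show ?thesis using Y(2) VF[OF le(2,1)] by simp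
      qed
      moreover have "norm (\<eta> (s (Suc i)) - \<eta> a ** (Y ** E)) \<le> real (Suc i) * p * (1 + q) ^ Suc i"
      proof -
        let ?A = "\<eta> (s i) - \<eta> a ** Y"
        have eq: "\<eta> (s (Suc i)) - \<eta> a ** (Y ** E) = (\<eta> (s (Suc i)) - \<eta> (s i) ** E) + (?A + ?A ** (E - mat 1))"
          by (simp add: cmult.diff_left cmult.diff_right matrix_mul_assoc)
        have "norm (\<eta> (s (Suc i)) - \<eta> a ** (Y ** E))
            \<le> norm (\<eta> (s (Suc i)) - \<eta> (s i) ** E) + (norm ?A + norm (?A ** (E - mat 1)))"
          unfolding eq by (rule order_trans[OF norm_triangle_ineq add_left_mono[OF norm_triangle_ineq]])
        also have "\<dots> \<le> p + (norm ?A + norm ?A * q)"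
          using order_trans[OF norm_cmat2_mult_le mult_left_mono[OF E(2) norm_ge_zero]] E(1)
          by (intro add_mono order_refl) auto
        also have "\<dots> = p + norm ?A * (1 + q)" by (simp add: algebra_simps)
        also have "\<dots> \<le> p * (1 + q) ^ Suc i + real i * p * (1 + q) ^ i * (1 + q)"
        proof (rule add_mono)
          have "1 \<le> (1 + q) ^ Suc i" using p0 by (intro one_le_power) auto
          then show "p \<le> p * (1 + q) ^ Suc i" using mult_left_mono[OF _ p0(1)] by fastforce
          show "norm ?A * (1 + q) \<le> real i * p * (1 + q) ^ i * (1 + q)"
            using Y(3) p0(2) by (intro mult_right_mono) auto
        qed
        also have "\<dots> = real (Suc i) * p * (1 + q) ^ Suc i" by (simp add: algebra_simps)
        finally show ?thesis .
      qed
      ultimately show ?case by blast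
    qed
    from this[OF order_refl] obtain Y l where Y: "reach Y l" "l \<le> integral {a..b} F"
      "norm (\<eta> b - \<eta> a ** Y) \<le> real n * p * (1 + q) ^ n" by (auto simp: s0)
    have "(1 + q) ^ n \<le> exp q ^ n"
      using p0 exp_ge_add_one_self[of q] by (intro power_mono) auto
    also have "\<dots> = exp (3 * K * T)"
      using n by (simp add: exp_of_nat_mult[symmetric] q_def \<Delta>_def)
    finally have "real n * p * (1 + q) ^ n \<le> real n * p * exp (3 * K * T)"
      using p0 by (intro mult_left_mono) auto
    also have "\<dots> = c / n"
      using n by (simp add: c_def p_def \<Delta>_def power2_eq_square)
    finally show ?thesis using Y by (meson order_trans)
  qed

  show "\<exists>l. reach (adj (\<eta> a) ** \<eta> b) l \<and> l \<le> integral {a..b} (\<lambda>t. sqrt 2 * norm (v t)) + \<epsilon>"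
    if eps: "\<epsilon> > 0"
  proof -
    obtain \<delta> where \<delta>: "\<delta> > 0" "\<And>h. det h = 1 \<Longrightarrow> norm (h - mat 1) < \<delta> \<Longrightarrow> \<exists>l < \<epsilon>. reach h l"
      by (rule reach_small[OF eps]) (rule that)
    define R where "R = M * (M + c) * M * c"
    have R: "R \<ge> 0" using M(1) \<open>c \<ge> 0\<close> by (simp add: R_def)
    obtain n :: nat where "max (K * T) (R / \<delta>) < n"
      using reals_Archimedean2 by blast
    then have n: "K * T \<le> n" "R / \<delta> < n" by auto
    have "real n > 0"
      using mult_pos_pos[OF K \<open>T > 0\<close>] n(1) by linarith
    then have n: "K * T \<le> n" "R / \<delta> < n" "n > 0"
      using n by auto
    obtain Y l where Y: "reach Y l" "l \<le> integral {a..b} F" "norm (\<eta> b - \<eta> a ** Y) \<le> c / n"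
      using poly[OF n(3,1)] by blast
    have da: "det (\<eta> a) = 1" "det (\<eta> b) = 1" and dY: "det Y = 1"
      using det \<open>a < b\<close> reach_det[OF Y(1)] by auto
    have Ma: "norm (\<eta> a) \<le> M" "norm (\<eta> b) \<le> M" using M(2) \<open>a < b\<close> by auto
    have n1: "real n \<ge> 1" using n(3) by simp
    have cn: "c / n \<le> c" using divide_left_mono[OF n1 \<open>c \<ge> 0\<close>] n(3) by simp
    have nY: "norm Y \<le> M * (M + c)"
    proof -
      have "Y = adj (\<eta> a) ** (\<eta> a ** Y)" using da by simp
      then have Y1: "norm Y \<le> norm (\<eta> a) * norm (\<eta> a ** Y)"
        by (metis norm_cmat2_mult_le norm_adj)
      have Y2: "norm (\<eta> a ** Y) \<le> M + c"
        using norm_triangle_ineq4[of "\<eta> b" "\<eta> b - \<eta> a ** Y"] Ma(2) Y(3) cn by simp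
      show ?thesis
        using order_trans[OF Y1 mult_mono[OF Ma(1) Y2]] M(1) by simp
    qed
    define h where "h = adj Y ** (adj (\<eta> a) ** \<eta> b)"
    have "det h = 1" by (simp add: h_def det_mult_cmat2 da dY)
    moreover have "norm (h - mat 1) < \<delta>"
    proof -
      have "h - mat 1 = adj Y ** (adj (\<eta> a) ** (\<eta> b - \<eta> a ** Y))"
        using da dY by (simp add: h_def cmult.diff_right adj_mult_self)
      then have "norm (h - mat 1) \<le> norm Y * norm (adj (\<eta> a) ** (\<eta> b - \<eta> a ** Y))"
        by (metis norm_cmat2_mult_le norm_adj)
      also have "\<dots> \<le> norm Y * (norm (\<eta> a) * norm (\<eta> b - \<eta> a ** Y))"
        by (intro mult_left_mono) (metis norm_cmat2_mult_le norm_adj, simp)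
      also have "\<dots> \<le> (M * (M + c)) * (M * (c / n))"
        using nY Ma(1) Y(3) M(1) \<open>c \<ge> 0\<close> by (intro mult_mono) auto
      also have "\<dots> = R / n" by (simp add: R_def)
      also have "\<dots> < \<delta>" using n(2,3) \<delta>(1) by (simp add: field_simps)
      finally show ?thesis .
    qed
    ultimately obtain l' where l': "l' < \<epsilon>" "reach h l'"
      using \<delta>(2) by blast
    have "Y ** h = adj (\<eta> a) ** \<eta> b"
      using dY by (simp add: h_def)
    with reach_mult[OF Y(1) l'(2)] Y(2) l'(1) show ?thesis
      unfolding vF(2) by (intro exI[of _ "l + l'"]) auto
  qed
qed

section \<open>Broken horizontal curves and the distance on SL(2)\<close>

lemma control_SL:
  assumes "det (\<gamma> t) = 1" "(\<gamma> has_vector_derivative \<gamma> t ** v) (at t)"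
  shows "control \<gamma> t = v"
  using assms by (simp add: control_def matrix_inv_SL vector_derivative_at)

text \<open>Multiplication by \<open>e\<^bsup>s/2\<^esup>\<close> adds \<open>s' e0\<close> to the control, because \<open>e0\<close> is half the unit matrix and
  central. This splitting reduces the sub-Lorentzian problem to the sub-Riemannian one.\<close>

lemma lift_has_vector_derivative:
  fixes \<gamma> :: "real \<Rightarrow> cmat2"
  assumes "(\<gamma> has_vector_derivative \<gamma> t ** v) (at t within S)" "(s has_real_derivative s') (at t within S)"
  shows "((\<lambda>t. exp (s t / 2) *\<^sub>R \<gamma> t) has_vector_derivative
     (exp (s t / 2) *\<^sub>R \<gamma> t) ** (s' *\<^sub>R e0 + v)) (at t within S)"
proof -
  have "((\<lambda>t. exp (s t / 2)) has_real_derivative exp (s t / 2) * (s' / 2)) (at t within S)"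
    using assms(2) by (auto intro!: derivative_eq_intros)
  from has_vector_derivative_scaleR[OF this assms(1)]
  have "((\<lambda>t. exp (s t / 2) *\<^sub>R \<gamma> t) has_vector_derivative
     exp (s t / 2) *\<^sub>R (\<gamma> t ** v) + (exp (s t / 2) * (s' / 2)) *\<^sub>R \<gamma> t) (at t within S)" .
  moreover have "(c *\<^sub>R \<gamma> t) ** (s' *\<^sub>R e0 + v) = c *\<^sub>R (\<gamma> t ** v) + (c * (s' / 2)) *\<^sub>R \<gamma> t" for c
  proof -
    have "(c *\<^sub>R \<gamma> t) ** (s' *\<^sub>R e0 + v) = (c *\<^sub>R \<gamma> t) ** (s' *\<^sub>R e0) + (c *\<^sub>R \<gamma> t) ** v"
      by (rule cmult.add_right)
    then show ?thesis
      by (simp add: e0_half cmult.scaleR_left cmult.scaleR_right)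
  qed
  ultimately show ?thesis by simp
qed

lemma control_scaled:
  assumes "det (\<gamma> t) = 1" "(\<gamma> has_vector_derivative \<gamma> t ** v) (at t)" "(s has_real_derivative s') (at t)"
  shows "control (\<lambda>t. exp (s t / 2) *\<^sub>R \<gamma> t) t = s' *\<^sub>R e0 + v"
  unfolding control_def vector_derivative_at[OF lift_has_vector_derivative[OF assms(2,3)]]
  by (simp add: matrix_inv_scaleR_SL[OF assms(1)] cmult.scaleR_left cmult.scaleR_right assms(1))

lemma continuous_derivative_imp_lipschitz:
  fixes f :: "real \<Rightarrow> 'a::real_normed_vector"
  assumes "\<And>t. t \<in> {a..b} \<Longrightarrow> (f has_vector_derivative f' t) (at t within {a..b})"
    and "continuous_on {a..b} f'"
  obtains L where "L-lipschitz_on {a..b} f"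
proof -
  have "bounded (f' ` {a..b})"
    using assms(2) by (intro compact_imp_bounded compact_continuous_image) auto
  then obtain L where L: "L > 0" "\<And>t. t \<in> {a..b} \<Longrightarrow> norm (f' t) \<le> L"
    by (auto simp: bounded_pos)
  have "L-lipschitz_on {a..b} f"
  proof (rule bounded_derivative_imp_lipschitz)
    show "(f has_derivative (\<lambda>x. x *\<^sub>R f' t)) (at t within {a..b})" if "t \<in> {a..b}" for t
      using assms(1)[OF that] by (simp add: has_vector_derivative_def)
    show "onorm (\<lambda>x. x *\<^sub>R f' t) \<le> L" if "t \<in> {a..b}" for t
    proof (rule onorm_le)
      show "norm (x *\<^sub>R f' t) \<le> L * norm x" for x :: real
        using mult_left_mono[OF L(2)[OF that], of "norm x"] by (simp add: mult.commute)
    qed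
  qed (use L in auto)
  then show thesis by (rule that)
qed

text \<open>A curve with finitely many corners, its control \<open>v\<close> (with arbitrary values in \<open>H0\<close> at the corners) and
  its length function \<open>l\<close>. The length function is kept because time changes of other curves are built from it.\<close>

definition broken_curve :: "(real \<Rightarrow> cmat2) \<Rightarrow> (real \<Rightarrow> cmat2) \<Rightarrow> (real \<Rightarrow> real) \<Rightarrow> real \<Rightarrow> bool" where
  "broken_curve \<gamma> v l a \<longleftrightarrow> a > 0 \<and> piecewise_C1_on 0 a \<gamma> \<and>
     (\<exists>L. L-lipschitz_on {0..a} \<gamma>) \<and> (\<exists>L. L-lipschitz_on {0..a} l) \<and>
     (\<forall>t\<in>{0..a}. det (\<gamma> t) = 1) \<and> (\<forall>t. v t \<in> H0) \<and> bounded (range v) \<and> v \<in> borel_measurable borel \<and> l 0 = 0 \<and>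
     (\<exists>F. finite F \<and> (\<forall>t\<in>{0<..<a} - F. (\<gamma> has_vector_derivative \<gamma> t ** v t) (at t) \<and>
        (l has_real_derivative sqrt 2 * norm (v t)) (at t)))"

lemma broken_curveE:
  assumes "broken_curve \<gamma> v l a"
  obtains L1 L2 F where "a > 0" "L1-lipschitz_on {0..a} \<gamma>" "L2-lipschitz_on {0..a} l"
    "\<And>t. t \<in> {0..a} \<Longrightarrow> det (\<gamma> t) = 1" "\<And>t. v t \<in> H0" "bounded (range v)" "v \<in> borel_measurable borel"
    "l 0 = 0" "finite F" "\<And>t. t \<in> {0<..<a} - F \<Longrightarrow> (\<gamma> has_vector_derivative \<gamma> t ** v t) (at t)"
    "\<And>t. t \<in> {0<..<a} - F \<Longrightarrow> (l has_real_derivative sqrt 2 * norm (v t)) (at t)"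
  using assms by (auto simp: broken_curve_def)

lemma broken_curve_constant: "det x = 1 \<Longrightarrow> broken_curve (\<lambda>_. x) (\<lambda>_. 0) (\<lambda>_. 0) 1"
  unfolding broken_curve_def
proof (intro conjI exI[of _ "{}::real set"])
  show "piecewise_C1_on 0 1 (\<lambda>_. x)"
    unfolding piecewise_C1_on_def
    by (rule exI[of _ "{0, 1}"]) (auto intro!: exI[of _ "\<lambda>_. 0"])
  show "\<exists>L. L-lipschitz_on {0..1} (\<lambda>_. x)" "\<exists>L. L-lipschitz_on {0..1} (\<lambda>_. 0::real)"
    by (auto intro: lipschitz_on_constant)
qed (auto simp: subspace_0[OF subspace_H0] cmult.zero_right)

lemma broken_curve_append:
  assumes B: "broken_curve \<gamma> v l a" and V: "V \<in> H0"
  shows "broken_curve (\<lambda>t. if t \<le> a then \<gamma> t else \<gamma> a ** hexp V (t - a))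
    (\<lambda>t. if t \<le> a then v t else V) (\<lambda>t. if t \<le> a then l t else l a + (t - a) * (sqrt 2 * norm V)) (a + 1)"
    (is "broken_curve ?g ?v ?l _")
proof -
  have pc: "piecewise_C1_on 0 a \<gamma>" using B by (simp add: broken_curve_def)
  obtain L1 L2 F where a: "a > 0" and L: "L1-lipschitz_on {0..a} \<gamma>" "L2-lipschitz_on {0..a} l"
    and det: "\<And>t. t \<in> {0..a} \<Longrightarrow> det (\<gamma> t) = 1" and vH: "\<And>t. v t \<in> H0" and vb: "bounded (range v)"
    and vm: "v \<in> borel_measurable borel" and l0: "l 0 = 0" and F: "finite F"
      "\<And>t. t \<in> {0<..<a} - F \<Longrightarrow> (\<gamma> has_vector_derivative \<gamma> t ** v t) (at t)"
      "\<And>t. t \<in> {0<..<a} - F \<Longrightarrow> (l has_real_derivative sqrt 2 * norm (v t)) (at t)"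
    by (rule broken_curveE[OF B]) (rule that)
  let ?e = "\<lambda>t. \<gamma> a ** hexp V (t - a)"
  have de: "(?e has_vector_derivative ?e t ** V) (at t within S)" for t S
  proof -
    have "((\<lambda>t. hexp V (t - a)) has_vector_derivative 1 *\<^sub>R (hexp V (t - a) ** V)) (at t within S)"
      by (rule vector_diff_chain_within[of "\<lambda>t. t - a" 1 t S "hexp V", unfolded o_def])
        (auto intro!: derivative_eq_intros hexp_has_vector_derivative V)
    from bounded_linear.has_vector_derivative[OF cmult.bounded_linear_right this]
    show ?thesis by (simp add: matrix_mul_assoc)
  qed
  have ce: "continuous_on S ?e" for S
    by (rule continuous_on_vector_derivative) (rule de)
  have ce': "continuous_on S (\<lambda>t. ?e t ** V)" for S
    by (rule bounded_linear.continuous_on[OF cmult.bounded_linear_left ce])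
  obtain L3 where L3: "L3-lipschitz_on {a..a+1} ?e"
    by (rule continuous_derivative_imp_lipschitz[OF de ce']) (rule that)
  have L4: "\<bar>sqrt 2 * norm V\<bar>-lipschitz_on {a..a+1} (\<lambda>t. l a + (t - a) * (sqrt 2 * norm V))"
    by (rule lipschitz_onI) (auto simp: dist_real_def abs_mult mult.commute simp flip: right_diff_distrib left_diff_distrib)
  have glue: "?e a = \<gamma> a" by simp
  show ?thesis
    unfolding broken_curve_def
  proof (intro conjI)
    show "a + 1 > 0" using a by simp
    show "\<exists>L. L-lipschitz_on {0..a+1} ?g"
      using lipschitz_on_concat_max[OF L(1) L3] by auto
    show "\<exists>L. L-lipschitz_on {0..a+1} ?l"
      using lipschitz_on_concat_max[OF L(2) L4] by auto
    show "\<forall>t\<in>{0..a+1}. det (?g t) = 1"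
      using det a by (auto simp: det_mult_cmat2 det_hexp[OF V])
    show "\<forall>t. ?v t \<in> H0" using vH V by auto
    show "bounded (range ?v)"
    proof (rule bounded_subset)
      show "bounded (range v \<union> {V})" using vb by simp
    qed auto
    show "?v \<in> borel_measurable borel" using vm by measurable
    show "?l 0 = 0" using l0 a by simp
    show "\<exists>F. finite F \<and> (\<forall>t\<in>{0<..<a+1} - F. (?g has_vector_derivative ?g t ** ?v t) (at t) \<and>
        (?l has_real_derivative sqrt 2 * norm (?v t)) (at t))"
    proof (intro exI[of _ "insert a F"] conjI ballI)
      show "finite (insert a F)" using F by simp
      fix t assume t: "t \<in> {0<..<a+1} - insert a F"
      show "(?g has_vector_derivative ?g t ** ?v t) (at t)"
      proof (cases "t < a")
        case True
        have "(?g has_vector_derivative \<gamma> t ** v t) (at t)"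
          by (rule has_vector_derivative_transform_within_open[OF F(2), of _ "{..<a}"]) (use t True in auto)
        then show ?thesis using True by simp
      next
        case False
        then have "t > a" using t by auto
        have "(?g has_vector_derivative ?e t ** V) (at t)"
          by (rule has_vector_derivative_transform_within_open[OF de, of "{a<..}"]) (use \<open>t > a\<close> in auto)
        then show ?thesis using \<open>t > a\<close> by simp
      qed
      show "(?l has_real_derivative sqrt 2 * norm (?v t)) (at t)"
      proof (cases "t < a")
        case True
        have "(?l has_real_derivative sqrt 2 * norm (v t)) (at t)"
          by (rule has_field_derivative_transform_within_open[OF F(3), of _ "{..<a}"]) (use t True in auto)
        then show ?thesis using True by simp
      next
        case False
        then have "t > a" using t by auto
        have "((\<lambda>t. l a + (t - a) * (sqrt 2 * norm V)) has_real_derivative sqrt 2 * norm V) (at t)"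
          by (auto intro!: derivative_eq_intros)
        then have "(?l has_real_derivative sqrt 2 * norm V) (at t)"
          by (rule has_field_derivative_transform_within_open[of _ _ _ "{a<..}"]) (use \<open>t > a\<close> in auto)
        then show ?thesis using \<open>t > a\<close> by simp
      qed
    qed
    obtain P where P: "finite P" "P \<subseteq> {0..a}" "0 \<in> P" "a \<in> P"
      and PD: "\<And>c d. c \<in> P \<Longrightarrow> d \<in> P \<Longrightarrow> c < d \<Longrightarrow> {c<..<d} \<inter> P = {} \<Longrightarrow>
           (\<exists>D. continuous_on {c..d} D \<and>
              (\<forall>t\<in>{c..d}. (\<gamma> has_vector_derivative D t) (at t within {c..d})))"
      using pc unfolding piecewise_C1_on_def by (elim exE conjE) (rule that, auto)
    show "piecewise_C1_on 0 (a + 1) ?g"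
      unfolding piecewise_C1_on_def
    proof (intro exI[of _ "insert (a + 1) P"] conjI ballI impI)
      show "finite (insert (a + 1) P)" "insert (a + 1) P \<subseteq> {0..a + 1}" "0 \<in> insert (a + 1) P" "a + 1 \<in> insert (a + 1) P"
        using P a by auto
      fix c d assume c: "c \<in> insert (a + 1) P" and d: "d \<in> insert (a + 1) P"
        and cd: "c < d \<and> {c<..<d} \<inter> insert (a + 1) P = {}"
      have "d \<le> a + 1" using d P by auto
      then have cP: "c \<in> P" using c cd by auto
      show "\<exists>D. continuous_on {c..d} D \<and> (\<forall>t\<in>{c..d}. (?g has_vector_derivative D t) (at t within {c..d}))"
      proof (cases "d \<in> P")
        case True
        then have da: "d \<le> a" using P by auto
        obtain D where D: "continuous_on {c..d} D" "\<And>t. t\<in>{c..d} \<Longrightarrow> (\<gamma> has_vector_derivative D t) (at t within {c..d})"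
          using PD[OF cP True] cd by auto
        have "(?g has_vector_derivative D t) (at t within {c..d})" if "t \<in> {c..d}" for t
          by (rule has_vector_derivative_transform[OF that _ D(2)[OF that]]) (use da in auto)
        with D(1) show ?thesis by blast
      next
        case False
        then have "d = a + 1" using d by auto
        have "c = a"
        proof (rule ccontr)
          assume "c \<noteq> a"
          then have "c < a" using cP P by force
          then have "a \<in> {c<..<d} \<inter> insert (a + 1) P" using P \<open>d = a + 1\<close> by auto
          then show False using cd by auto
        qed
        have "(?g has_vector_derivative ?e t ** V) (at t within {c..d})" if "t \<in> {c..d}" for t
          by (rule has_vector_derivative_transform[OF that _ de]) (use \<open>c = a\<close> glue in auto)
        with ce' show ?thesis by blast
      qed
    qed
  qed
qed

lemma reach_curve:
  assumes "reach h l" "det x = 1"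
  shows "\<exists>\<gamma> v \<Lambda> a. broken_curve \<gamma> v \<Lambda> a \<and> \<gamma> 0 = x \<and> \<gamma> a = x ** h \<and> \<Lambda> a = l"
  using assms(1)
proof induction
  case reach_unit
  show ?case
    by (rule exI[of _ "\<lambda>_. x"], rule exI[of _ "\<lambda>_. 0"], rule exI[of _ "\<lambda>_. 0"], rule exI[of _ 1])
      (simp add: broken_curve_constant[OF assms(2)])
next
  case (reach_step h l V)
  then obtain \<gamma> v \<Lambda> a where *: "broken_curve \<gamma> v \<Lambda> a" "\<gamma> 0 = x" "\<gamma> a = x ** h" "\<Lambda> a = l"
    by blast
  then have "a > 0" by (auto simp: broken_curve_def)
  show ?case
    by (intro exI conjI, rule broken_curve_append[OF *(1) reach_step.hyps(2)])
      (use * \<open>a > 0\<close> in \<open>auto simp: matrix_mul_assoc\<close>)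
qed

lemma broken_curve_length:
  assumes "broken_curve \<gamma> v l a"
  shows "((\<lambda>t. sqrt 2 * norm (v t)) has_integral l a) {0..a}"
    and "SL_horizontal_on {0..a} \<gamma>"
    and "riem_length \<gamma> 0 a = l a"
proof -
  obtain L1 L2 F where a: "a > 0" and L: "L1-lipschitz_on {0..a} \<gamma>" "L2-lipschitz_on {0..a} l"
    and det: "\<And>t. t \<in> {0..a} \<Longrightarrow> det (\<gamma> t) = 1" and vH: "\<And>t. v t \<in> H0" and l0: "l 0 = 0" and F: "finite F"
      "\<And>t. t \<in> {0<..<a} - F \<Longrightarrow> (\<gamma> has_vector_derivative \<gamma> t ** v t) (at t)"
      "\<And>t. t \<in> {0<..<a} - F \<Longrightarrow> (l has_real_derivative sqrt 2 * norm (v t)) (at t)"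
    by (rule broken_curveE[OF assms]) (rule that)
  have N: "negligible (F \<union> {0, a})"
    using F(1) by (intro negligible_finite) auto
  have "((\<lambda>t. sqrt 2 * norm (v t)) has_integral (l a - l 0)) {0..a}"
  proof (rule AC_FTC[OF _ lipschitz_imp_AC[OF L(2)] N])
    show "(l has_vector_derivative sqrt 2 * norm (v t)) (at t within {0..a})" if "t \<in> {0..a} - (F \<union> {0, a})" for t
      using F(3)[of t] that
      by (auto simp: has_real_derivative_iff_has_vector_derivative intro: has_vector_derivative_at_within)
  qed (use a in simp)
  then show I: "((\<lambda>t. sqrt 2 * norm (v t)) has_integral l a) {0..a}"
    by (simp add: l0)
  have c: "control \<gamma> t = v t" if "t \<in> {0<..<a} - F" for t
    using control_SL[OF _ F(2)[OF that]] det that by auto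
  show "SL_horizontal_on {0..a} \<gamma>"
    unfolding SL_horizontal_on_def
  proof (intro conjI)
    show "\<gamma> ` {0..a} \<subseteq> SL" using det by (auto simp: SL_def)
    show "lipschitzian_on {0..a} \<gamma>"
      unfolding lipschitzian_on_def using lipschitz_on_subset[OF L(1)] by blast
    show "ae_on {0..a} (\<lambda>t. \<gamma> differentiable at t \<and> control \<gamma> t \<in> H0)"
    proof (rule ae_onI[OF negligible_finite[OF F(1)]])
      fix t assume "t \<in> interior {0..a} - F"
      then have t: "t \<in> {0<..<a} - F" by simp
      then show "\<gamma> differentiable at t \<and> control \<gamma> t \<in> H0"
        using c[OF t] F(2)[OF t] vH by (auto simp: differentiable_def has_vector_derivative_def)
    qed
  qed
  have "((\<lambda>t. sqrt (scalar_prod (control \<gamma> t) (control \<gamma> t))) has_integral l a) {0..a}"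
    by (rule has_integral_spike[OF N _ I]) (use c vH in \<open>auto simp: sqrt_scalar_prod_H0\<close>)
  then show "riem_length \<gamma> 0 a = l a"
    unfolding riem_length_def by (rule integral_unique)
qed

lemma riem_dist_le_reach:
  assumes "reach h l" "det x = 1"
  shows "riem_dist x (x ** h) \<le> ereal l"
proof -
  obtain \<gamma> v \<Lambda> a where *: "broken_curve \<gamma> v \<Lambda> a" "\<gamma> 0 = x" "\<gamma> a = x ** h" "\<Lambda> a = l"
    using reach_curve[OF assms] by blast
  have "ereal l \<in> {ereal (riem_length \<gamma> 0 a) | \<gamma> a.
     a > 0 \<and> piecewise_C1_on 0 a \<gamma> \<and> SL_horizontal_on {0..a} \<gamma> \<and> \<gamma> 0 = x \<and> \<gamma> a = x ** h}"
    using broken_curve_length[OF *(1)] * unfolding broken_curve_def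
    by (intro CollectI exI[of _ \<gamma>] exI[of _ a]) auto
  then show ?thesis
    unfolding riem_dist_def by (rule Inf_lower)
qed

lemma SL_horizontal_onE:
  assumes "SL_horizontal_on {a..b} \<eta>"
  obtains L N where "L-lipschitz_on {a..b} \<eta>" "\<And>t. t \<in> {a..b} \<Longrightarrow> det (\<eta> t) = 1" "negligible N"
    "\<And>t. t \<in> {a..b} - N \<Longrightarrow> a < t \<and> t < b \<and> (\<eta> has_vector_derivative \<eta> t ** control \<eta> t) (at t) \<and> control \<eta> t \<in> H0"
proof -
  have det: "\<And>t. t \<in> {a..b} \<Longrightarrow> det (\<eta> t) = 1"
    using assms unfolding SL_horizontal_on_def SL_def by blast
  obtain L where L: "L-lipschitz_on {a..b} \<eta>"
    using assms unfolding SL_horizontal_on_def lipschitzian_on_def by blast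
  have "ae_on {a..b} (\<lambda>t. \<eta> differentiable (at t) \<and> control \<eta> t \<in> H0)"
    using assms by (simp add: SL_horizontal_on_def)
  then obtain N where N: "negligible N"
    "\<And>t. t \<in> {a..b} - N \<Longrightarrow> a < t \<and> t < b \<and> \<eta> differentiable (at t) \<and> control \<eta> t \<in> H0"
    by (rule ae_on_IccE) (rule that)
  have "(\<eta> has_vector_derivative \<eta> t ** control \<eta> t) (at t)" if "t \<in> {a..b} - N" for t
  proof -
    have "(\<eta> has_vector_derivative vector_derivative \<eta> (at t)) (at t)"
      using N(2)[OF that] by (simp add: vector_derivative_works)
    moreover have "\<eta> t ** control \<eta> t = vector_derivative \<eta> (at t)"
      using det that by (simp add: control_def matrix_inv_SL)
    ultimately show ?thesis by simp
  qed
  with that[OF L det N(1)] N(2) show thesis by blast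
qed

lemma riem_length_reach:
  assumes "SL_horizontal_on {a..b} \<eta>" "a < b" "\<epsilon> > 0"
  obtains l where "reach (adj (\<eta> a) ** \<eta> b) l" "l \<le> riem_length \<eta> a b + \<epsilon>"
proof -
  obtain L N where *: "L-lipschitz_on {a..b} \<eta>" "\<And>t. t \<in> {a..b} \<Longrightarrow> det (\<eta> t) = 1" "negligible N"
    "\<And>t. t \<in> {a..b} - N \<Longrightarrow> a < t \<and> t < b \<and> (\<eta> has_vector_derivative \<eta> t ** control \<eta> t) (at t) \<and> control \<eta> t \<in> H0"
    by (rule SL_horizontal_onE[OF assms(1)]) (rule that)
  have "riem_length \<eta> a b = integral {a..b} (\<lambda>t. sqrt 2 * norm (control \<eta> t))"
    unfolding riem_length_def
    by (rule integral_spike[OF *(3)]) (use *(4) in \<open>auto simp: sqrt_scalar_prod_H0\<close>)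
  with polygon_approximation(2)[OF assms(2) * assms(3)] show thesis
    using that by auto
qed

lemma riem_dist_le_length:
  assumes "SL_horizontal_on {a..b} \<eta>" "a < b"
  shows "riem_dist (\<eta> a) (\<eta> b) \<le> ereal (riem_length \<eta> a b)"
proof (rule ereal_le_epsilon2)
  fix e :: real assume "e > 0"
  have "a \<in> {a..b}" using assms(2) by simp
  then have d: "det (\<eta> a) = 1"
    using assms(1) unfolding SL_horizontal_on_def SL_def by blast
  obtain l where l: "reach (adj (\<eta> a) ** \<eta> b) l" "l \<le> riem_length \<eta> a b + e"
    by (rule riem_length_reach[OF assms \<open>e > 0\<close>]) (rule that)
  have "riem_dist (\<eta> a) (\<eta> b) \<le> ereal l"
    using riem_dist_le_reach[OF l(1) d] d by simp
  also have "\<dots> \<le> ereal (riem_length \<eta> a b) + ereal e"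
    using l(2) by simp
  finally show "riem_dist (\<eta> a) (\<eta> b) \<le> ereal (riem_length \<eta> a b) + ereal e" .
qed

text \<open>Together with \<open>riem_dist_le_reach\<close>: the distance is the infimum of the lengths of broken paths.\<close>

lemma riem_dist_ge:
  assumes "\<And>l. reach (adj x ** y) l \<Longrightarrow> c \<le> l"
  shows "ereal c \<le> riem_dist x y"
  unfolding riem_dist_def
proof (rule Inf_greatest)
  fix r assume "r \<in> {ereal (riem_length \<gamma> 0 a) |\<gamma> a.
              0 < a \<and> piecewise_C1_on 0 a \<gamma> \<and> SL_horizontal_on {0..a} \<gamma> \<and> \<gamma> 0 = x \<and> \<gamma> a = y}"
  then obtain \<gamma> a where *: "r = ereal (riem_length \<gamma> 0 a)" "0 < a" "SL_horizontal_on {0..a} \<gamma>" "\<gamma> 0 = x" "\<gamma> a = y"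
    by blast
  have "c \<le> riem_length \<gamma> 0 a"
  proof (rule field_le_epsilon)
    fix e :: real assume "e > 0"
    obtain l where "reach (adj (\<gamma> 0) ** \<gamma> a) l" "l \<le> riem_length \<gamma> 0 a + e"
      by (rule riem_length_reach[OF *(3,2) \<open>e > 0\<close>]) (rule that)
    then show "c \<le> riem_length \<gamma> 0 a + e"
      using assms *(4,5) by fastforce
  qed
  then show "ereal c \<le> r" by (simp add: *(1))
qed

section \<open>Curves of constant speed and local minimality\<close>

locale SL_curve =
  fixes \<gamma> u :: "real \<Rightarrow> cmat2" and \<sigma> :: real
  assumes deriv: "(\<gamma> has_vector_derivative \<gamma> t ** u t) (at t)"
    and det: "det (\<gamma> t) = 1"
    and u_H0: "u t \<in> H0"
    and speed: "sqrt 2 * norm (u t) = \<sigma>"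
    and cont_u: "continuous_on UNIV u"
begin

lemma cont: "continuous_on S \<gamma>"
  by (rule continuous_on_vector_derivative) (rule has_vector_derivative_at_within[OF deriv])

lemma cont_deriv: "continuous_on S (\<lambda>t. \<gamma> t ** u t)"
  by (rule cmult.continuous_on[OF cont continuous_on_subset[OF cont_u]]) simp

lemma speed_nonneg: "\<sigma> \<ge> 0"
  using speed[of 0] by (metis mult_nonneg_nonneg norm_ge_zero real_sqrt_ge_zero zero_le_numeral)

lemma control: "control \<gamma> t = u t"
  by (rule control_SL[OF det deriv])

lemma horizontal: "SL_horizontal_on S \<gamma>"
  unfolding SL_horizontal_on_def
proof (intro conjI)
  show "\<gamma> ` S \<subseteq> SL" using det by (auto simp: SL_def)
  show "lipschitzian_on S \<gamma>"
    unfolding lipschitzian_on_def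
  proof (intro allI impI)
    fix a b
    obtain L where "L-lipschitz_on {a..b} \<gamma>"
      by (rule continuous_derivative_imp_lipschitz[OF has_vector_derivative_at_within[OF deriv] cont_deriv])
    then show "\<exists>L. L-lipschitz_on {a..b} \<gamma>" by blast
  qed
  show "ae_on S (\<lambda>t. \<gamma> differentiable at t \<and> control \<gamma> t \<in> H0)"
    using deriv u_H0 by (intro AE_I2) (auto simp: control differentiable_def has_vector_derivative_def)
qed

lemma riem_length: "a \<le> b \<Longrightarrow> riem_length \<gamma> a b = \<sigma> * (b - a)"
  by (simp add: riem_length_def control sqrt_scalar_prod_H0 u_H0 speed)

lemma shortest_arc_iff:
  "shortest_arc \<gamma> a b \<longleftrightarrow> a < b \<and> riem_dist (\<gamma> a) (\<gamma> b) = ereal (\<sigma> * (b - a))"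
  by (auto simp: shortest_arc_def horizontal riem_length)

lemma shortest_arcI:
  assumes "a < b" "\<And>l. reach (adj (\<gamma> a) ** \<gamma> b) l \<Longrightarrow> \<sigma> * (b - a) \<le> l"
  shows "shortest_arc \<gamma> a b"
  using riem_dist_le_length[OF horizontal assms(1)] riem_dist_ge[OF assms(2)] assms(1)
  by (simp add: shortest_arc_iff riem_length antisym)

lemma reparametrize:
  assumes "\<kappa> > 0"
  shows "SL_curve (\<lambda>t. \<gamma> (\<kappa> * t)) (\<lambda>t. \<kappa> *\<^sub>R u (\<kappa> * t)) (\<kappa> * \<sigma>)"
proof
  fix t
  show "((\<lambda>t. \<gamma> (\<kappa> * t)) has_vector_derivative \<gamma> (\<kappa> * t) ** (\<kappa> *\<^sub>R u (\<kappa> * t))) (at t)"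
  proof -
    have "((\<lambda>t. \<kappa> * t) has_vector_derivative \<kappa>) (at t)"
      unfolding has_real_derivative_iff_has_vector_derivative[symmetric]
      by (auto intro!: derivative_eq_intros)
    from vector_diff_chain_at[OF this deriv] show ?thesis
      by (simp add: o_def cmult.scaleR_right)
  qed
  show "det (\<gamma> (\<kappa> * t)) = 1" by (rule det)
  show "\<kappa> *\<^sub>R u (\<kappa> * t) \<in> H0" by (rule subspace_scale[OF subspace_H0 u_H0])
  show "sqrt 2 * norm (\<kappa> *\<^sub>R u (\<kappa> * t)) = \<kappa> * \<sigma>"
    using speed[of "\<kappa> * t"] assms by simp
  show "continuous_on UNIV (\<lambda>t. \<kappa> *\<^sub>R u (\<kappa> * t))"
    by (intro continuous_intros continuous_on_compose2[OF cont_u]) auto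
qed

lemma arclength: "arclength_param_on S \<sigma> \<gamma>"
  by (simp add: arclength_param_on_def riem_length)

end

lemma borel_measurable_lebesgue_on:
  fixes f :: "real \<Rightarrow> 'a::euclidean_space"
  assumes "f \<in> borel_measurable borel"
  shows "f \<in> borel_measurable (lebesgue_on S)"
  by (rule measurable_restrict_space1) (use assms in \<open>simp add: measurable_completion\<close>)

text \<open>At the point where the norm is largest, the integral of \<open>x' = x v\<close> bounds it by its initial value plus
  half of itself.\<close>

lemma broken_curve_norm_le:
  assumes B: "broken_curve x v l a" and small: "l a \<le> 1/2" and M: "norm (x 0) \<le> M"
    and \<tau>: "\<tau> \<in> {0..a}"
  shows "norm (x \<tau>) \<le> 2 * M"
proof -
  obtain L F where a: "a > 0" and L: "L-lipschitz_on {0..a} x" and F: "finite F"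
      "\<And>t. t \<in> {0<..<a} - F \<Longrightarrow> (x has_vector_derivative x t ** v t) (at t)"
    by (rule broken_curveE[OF B]) (rule that)
  have cx: "continuous_on {0..a} x" by (rule lipschitz_on_continuous_on[OF L])
  obtain t where t: "t \<in> {0..a}" "\<And>s. s \<in> {0..a} \<Longrightarrow> norm (x s) \<le> norm (x t)"
  proof -
    have "\<exists>t\<in>{0..a}. \<forall>s\<in>{0..a}. norm (x s) \<le> norm (x t)"
      using a by (intro continuous_attains_sup continuous_on_norm cx) auto
    then show thesis using that by blast
  qed
  define m where "m = norm (x t)"
  have I: "((\<lambda>s. sqrt 2 * norm (v s)) has_integral l a) {0..a}"
    by (rule broken_curve_length(1)[OF B])
  have vi: "(\<lambda>s. norm (v s)) integrable_on {0..a}"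
    using has_integral_mult_right[OF I, of "1 / sqrt 2"] by (auto simp: integrable_on_def)
  have va: "sqrt 2 * integral {0..a} (\<lambda>s. norm (v s)) = l a"
    using integral_unique[OF I] by simp
  have f: "((\<lambda>s. x s ** v s) has_integral (x t - x 0)) {0..t}"
    using t F cx by (intro fundamental_theorem_of_calculus_interior_strong[OF F(1)])
      (auto intro: continuous_on_subset)
  have "norm (integral {0..t} (\<lambda>s. x s ** v s)) \<le> integral {0..t} (\<lambda>s. m * norm (v s))"
  proof (rule integral_norm_bound_integral)
    show "(\<lambda>s. x s ** v s) integrable_on {0..t}" using f by blast
    show "(\<lambda>s. m * norm (v s)) integrable_on {0..t}"
      using integrable_on_subinterval[OF vi, of 0 t] t by (intro integrable_on_mult_right) auto
    fix s assume "s \<in> {0..t}"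
    then show "norm (x s ** v s) \<le> m * norm (v s)"
      using order_trans[OF norm_cmat2_mult_le mult_right_mono[OF t(2)]] t(1) by (simp add: m_def)
  qed
  also have "\<dots> = m * integral {0..t} (\<lambda>s. norm (v s))" by simp
  also have "\<dots> \<le> m * integral {0..a} (\<lambda>s. norm (v s))"
    using t integrable_on_subinterval[OF vi, of 0 t]
    by (intro mult_left_mono integral_subset_le vi) (auto simp: m_def)
  also have "\<dots> \<le> m * (1/2)"
  proof (rule mult_left_mono)
    have "1 * integral {0..a} (\<lambda>s. norm (v s)) \<le> sqrt 2 * integral {0..a} (\<lambda>s. norm (v s))"
      by (intro mult_right_mono integral_nonneg vi) auto
    then show "integral {0..a} (\<lambda>s. norm (v s)) \<le> 1/2" using va small by simp
  qed (simp add: m_def)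
  finally have "norm (x t - x 0) \<le> m / 2"
    using integral_unique[OF f] by simp
  then have "m \<le> 2 * M"
    using norm_triangle_ineq[of "x t - x 0" "x 0"] M by (simp add: m_def)
  with t(2)[OF \<tau>] show ?thesis by (simp add: m_def)
qed

text \<open>Normal extremals of the sub-Riemannian problem on SL(2): the momentum is a constant \<open>X\<close> in the right
  trivialization, \<open>\<gamma>\<^sup>-\<^sup>1 X \<gamma>\<close> in the left one, and the control is its component in \<open>H0\<close>.\<close>

locale SL_extremal = SL_curve +
  fixes X :: cmat2
  assumes extremal: "w \<in> H0 \<Longrightarrow> u t \<bullet> w = (adj (\<gamma> t) ** X ** \<gamma> t) \<bullet> w"
begin

text \<open>Short pieces of extremals are shortest. Let \<open>x\<close> be a competitor with control \<open>v\<close>, and run the extremal along it with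
  a time change \<open>\<theta>\<close>. For \<open>y = x \<gamma>(\<theta>)\<^sup>-\<^sup>1\<close> and \<open>w = v - \<theta>' u(\<theta>)\<close> one has
  \<open>y' = x w \<gamma>(\<theta>)\<^sup>-\<^sup>1\<close>, and the function \<open>\<phi> = 2 Re tr(X y)\<close> satisfies
  \<open>\<phi>' = 2 (u \<bullet> w) + O(norm (y - 1) norm w)\<close> precisely because \<open>u\<close> is the \<open>H0\<close>-component of
  \<open>\<gamma>\<^sup>-\<^sup>1 X \<gamma>\<close>. As \<open>y\<close> is the unit at both ends, \<open>\<phi>'\<close> has integral 0.
  If \<open>x\<close> were shorter, then \<open>2 (u \<bullet> w)\<close> would be less than \<open>- norm w\<^sup>2 / \<theta>'\<close>, whose integral is at most \<open>- I\<^sup>2 / T\<close>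
  for \<open>I\<close> the integral of \<open>norm w\<close> and \<open>T\<close> the length of the time interval, while the error integrates to
  \<open>O(I\<^sup>2)\<close>. For small \<open>T\<close> this is a contradiction.\<close>

lemma local_lower_bound:
  assumes B: "broken_curve x v l a" and ends: "x 0 = \<gamma> p" "x a = \<gamma> q" and "p < q"
    and M: "M \<ge> 1" "\<And>t. t \<in> {p..q} \<Longrightarrow> norm (\<gamma> t) \<le> M"
    and small: "\<sigma> * (q - p) \<le> 1/2" "(4 * M ^ 4 * norm X) * (q - p) \<le> 1"
  shows "\<sigma> * (q - p) \<le> l a"
proof (rule ccontr)
  assume "\<not> \<sigma> * (q - p) \<le> l a"
  then have less: "l a < \<sigma> * (q - p)" by simp
  obtain L1 L2 F where a: "a > 0" and L: "L1-lipschitz_on {0..a} x" "L2-lipschitz_on {0..a} l"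
    and detx: "\<And>t. t \<in> {0..a} \<Longrightarrow> det (x t) = 1" and vH: "\<And>t. v t \<in> H0" and vb: "bounded (range v)"
    and vm: "v \<in> borel_measurable borel" and l0: "l 0 = 0" and F: "finite F"
      "\<And>t. t \<in> {0<..<a} - F \<Longrightarrow> (x has_vector_derivative x t ** v t) (at t)"
      "\<And>t. t \<in> {0<..<a} - F \<Longrightarrow> (l has_real_derivative sqrt 2 * norm (v t)) (at t)"
    by (rule broken_curveE[OF B]) (rule that)
  have cx: "continuous_on {0..a} x" and cl: "continuous_on {0..a} l"
    using L by (auto intro: lipschitz_on_continuous_on)
  have la: "l a \<ge> 0"
    using has_integral_nonneg[OF broken_curve_length(1)[OF B]] by simp
  define T where "T = q - p"
  have T: "T > 0" using \<open>p < q\<close> by (simp add: T_def)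
  have xM: "norm (x \<tau>) \<le> 2 * M" if "\<tau> \<in> {0..a}" for \<tau>
    using broken_curve_norm_le[OF B _ _ that] less small(1) M(2)[of p] \<open>p < q\<close> ends(1) by simp

  \<comment> \<open>The competitor keeps its parameter; the extremal is run along it, at a speed proportional to that of the competitor. The slack \<open>\<delta>\<close> keeps this time change strictly increasing where the competitor rests.\<close>
  define l' where "l' = (l a + \<sigma> * T) / 2"
  have l': "l a < l'" "l' < \<sigma> * T" "l' > 0"
    using less la by (auto simp: l'_def T_def)
  define \<delta> where "\<delta> = (l' - l a) / a"
  have \<delta>: "\<delta> > 0" "\<delta> * a = l' - l a" using l' a by (simp_all add: \<delta>_def)
  define \<theta> where "\<theta> = (\<lambda>\<tau>. p + (l \<tau> + \<delta> * \<tau>) * (T / l'))"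
  define \<theta>' where "\<theta>' = (\<lambda>\<tau>. (sqrt 2 * norm (v \<tau>) + \<delta>) * (T / l'))"
  have \<theta>'pos: "\<theta>' \<tau> > 0" for \<tau>
    unfolding \<theta>'_def using \<delta>(1) l'(3) T by (intro mult_pos_pos add_nonneg_pos) auto
  have \<theta>ends: "\<theta> 0 = p" "\<theta> a = q"
    using l0 \<delta>(2) l'(3) by (simp_all add: \<theta>_def T_def)
  have c\<theta>: "continuous_on {0..a} \<theta>"
    unfolding \<theta>_def by (intro continuous_intros cl)
  have d\<theta>: "(\<theta> has_real_derivative \<theta>' \<tau>) (at \<tau>)" if "\<tau> \<in> {0<..<a} - F" for \<tau>
  proof -
    have "((\<lambda>\<tau>. l \<tau> + \<delta> * \<tau>) has_real_derivative sqrt 2 * norm (v \<tau>) + \<delta>) (at \<tau>)"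
      using F(3)[OF that] by (auto intro!: derivative_eq_intros)
    from DERIV_add[OF DERIV_const[of p] DERIV_cmult_right[OF this, of "T / l'"]] show ?thesis
      unfolding \<theta>_def \<theta>'_def by (simp only: add_0_left)
  qed
  have I\<theta>: "(\<theta>' has_integral (\<theta> d - \<theta> c)) {c..d}" if "0 \<le> c" "c \<le> d" "d \<le> a" for c d
    using that c\<theta> d\<theta> by (intro fundamental_theorem_of_calculus_interior_strong[OF F(1)])
      (auto simp: has_real_derivative_iff_has_vector_derivative[symmetric] intro: continuous_on_subset)
  have \<theta>in: "\<theta> \<tau> \<in> {p..q}" if "\<tau> \<in> {0..a}" for \<tau>
    using has_integral_nonneg[OF I\<theta>[of 0 \<tau>]] has_integral_nonneg[OF I\<theta>[of \<tau> a]] that \<theta>'pos \<theta>ends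
    by (auto simp: less_imp_le)
  define \<kappa> where "\<kappa> = l' / T"
  have \<kappa>: "0 \<le> \<kappa>" "\<kappa> < \<sigma>"
    using l' T by (simp_all add: \<kappa>_def divide_less_eq)
  have v\<kappa>: "sqrt 2 * norm (v \<tau>) \<le> \<kappa> * \<theta>' \<tau>" for \<tau>
    using l'(3) T \<delta>(1) by (simp add: \<kappa>_def \<theta>'_def)

  \<comment> \<open>The deviation of the velocities, whose integral \<open>I\<close> bounds the deviation of the curves.\<close>
  define w where "w = (\<lambda>\<tau>. v \<tau> - \<theta>' \<tau> *\<^sub>R u (\<theta> \<tau>))"
  have wH: "w \<tau> \<in> H0" for \<tau>
    unfolding w_def by (intro subspace_diff[OF subspace_H0] subspace_scale[OF subspace_H0] vH u_H0)
  have wi: "(\<lambda>\<tau>. norm (w \<tau>)) integrable_on {0..a}"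
  proof -
    obtain K where K: "\<And>\<tau>. norm (v \<tau>) \<le> K"
      using vb by (auto simp: bounded_iff)
    have m1: "v \<in> borel_measurable (lebesgue_on {0..a})"
      by (rule borel_measurable_lebesgue_on[OF vm])
    have "continuous_on {0..a} (\<lambda>\<tau>. u (\<theta> \<tau>))"
      by (rule continuous_on_compose2[OF cont_u c\<theta>]) simp
    then have m2: "(\<lambda>\<tau>. u (\<theta> \<tau>)) \<in> borel_measurable (lebesgue_on {0..a})"
      by (rule continuous_imp_measurable_on_sets_lebesgue) simp
    have m3: "(\<lambda>\<tau>. norm (w \<tau>)) \<in> borel_measurable (lebesgue_on {0..a})"
      unfolding w_def \<theta>'_def using m1 m2 by measurable
    have bd: "norm (norm (w \<tau>)) \<le> K + ((sqrt 2 * K + \<delta>) * (T / l')) * \<sigma>" for \<tau>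
    proof -
      have "norm (u (\<theta> \<tau>)) \<le> \<sigma>"
        using speed[of "\<theta> \<tau>"] mult_right_mono[of 1 "sqrt 2" "norm (u (\<theta> \<tau>))"] by simp
      moreover have "\<theta>' \<tau> \<le> (sqrt 2 * K + \<delta>) * (T / l')"
        unfolding \<theta>'_def using K T l'(3) by (intro mult_right_mono add_mono mult_left_mono) auto
      ultimately have "\<theta>' \<tau> * norm (u (\<theta> \<tau>)) \<le> ((sqrt 2 * K + \<delta>) * (T / l')) * \<sigma>"
        using \<theta>'pos[of \<tau>] by (intro mult_mono) auto
      then show ?thesis
        using norm_triangle_ineq4[of "v \<tau>" "\<theta>' \<tau> *\<^sub>R u (\<theta> \<tau>)"] K[of \<tau>] \<theta>'pos[of \<tau>]
        by (simp add: w_def abs_of_pos)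
    qed
    show ?thesis
      by (rule measurable_bounded_by_integrable_imp_integrable[OF m3 integrable_const_ivl bd]) simp
  qed
  define I where "I = integral {0..a} (\<lambda>\<tau>. norm (w \<tau>))"
  have I0: "I \<ge> 0" unfolding I_def by (intro integral_nonneg wi) auto

  define y where "y = (\<lambda>\<tau>. x \<tau> ** adj (\<gamma> (\<theta> \<tau>)))"
  have cy: "continuous_on {0..a} y"
    unfolding y_def
    by (intro cmult.continuous_on cx bounded_linear.continuous_on[OF bounded_linear_adj]
        continuous_on_compose2[OF cont c\<theta>]) auto
  have dy: "(y has_vector_derivative x \<tau> ** w \<tau> ** adj (\<gamma> (\<theta> \<tau>))) (at \<tau>)" if \<tau>: "\<tau> \<in> {0<..<a} - F" for \<tau>
  proof -
    have "((\<lambda>\<tau>. \<gamma> (\<theta> \<tau>)) has_vector_derivative \<theta>' \<tau> *\<^sub>R (\<gamma> (\<theta> \<tau>) ** u (\<theta> \<tau>))) (at \<tau>)"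
      using vector_diff_chain_at[OF d\<theta>[OF \<tau>, unfolded has_real_derivative_iff_has_vector_derivative] deriv]
      by (simp add: o_def)
    from bounded_linear.has_vector_derivative[OF bounded_linear_adj this]
    have "((\<lambda>\<tau>. adj (\<gamma> (\<theta> \<tau>))) has_vector_derivative - (\<theta>' \<tau> *\<^sub>R (u (\<theta> \<tau>) ** adj (\<gamma> (\<theta> \<tau>))))) (at \<tau>)"
      using adj_trace0[OF H0_trace[OF u_H0]]
      by (simp add: adj_mult linear_simps(5)[OF bounded_linear_adj] cmult.minus_left)
    from cmult.has_vector_derivative[OF F(2)[OF \<tau>] this]
    show ?thesis
      unfolding y_def w_def
      by (simp add: cmult.diff_left cmult.diff_right cmult.minus_right cmult.scaleR_left cmult.scaleR_right
          matrix_mul_assoc)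
  qed
  have y1: "norm (y \<tau> - mat 1) \<le> 2 * M\<^sup>2 * I" if \<tau>: "\<tau> \<in> {0..a}" for \<tau>
  proof -
    have f: "((\<lambda>s. x s ** w s ** adj (\<gamma> (\<theta> s))) has_integral (y \<tau> - y 0)) {0..\<tau>}"
      using \<tau> dy cy by (intro fundamental_theorem_of_calculus_interior_strong[OF F(1)])
        (auto intro: continuous_on_subset)
    have wi': "(\<lambda>s. norm (w s)) integrable_on {0..\<tau>}"
      using integrable_on_subinterval[OF wi, of 0 \<tau>] \<tau> by auto
    have "norm (integral {0..\<tau>} (\<lambda>s. x s ** w s ** adj (\<gamma> (\<theta> s)))) \<le> integral {0..\<tau>} (\<lambda>s. (2 * M\<^sup>2) * norm (w s))"
    proof (rule integral_norm_bound_integral)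
      show "(\<lambda>s. x s ** w s ** adj (\<gamma> (\<theta> s))) integrable_on {0..\<tau>}" using f by blast
      show "(\<lambda>s. (2 * M\<^sup>2) * norm (w s)) integrable_on {0..\<tau>}"
        by (rule integrable_on_mult_right[OF wi'])
      fix s assume "s \<in> {0..\<tau>}"
      then have s: "s \<in> {0..a}" using \<tau> by auto
      have "norm (x s ** w s ** adj (\<gamma> (\<theta> s))) \<le> norm (x s) * norm (w s) * norm (adj (\<gamma> (\<theta> s)))"
        by (rule order_trans[OF norm_cmat2_mult_le mult_right_mono[OF norm_cmat2_mult_le norm_ge_zero]])
      also have "\<dots> \<le> (2 * M) * norm (w s) * M"
        using xM[OF s] M(2)[OF \<theta>in[OF s]] M(1) by (intro mult_mono) auto
      also have "\<dots> = (2 * M\<^sup>2) * norm (w s)" by (simp add: power2_eq_square)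
      finally show "norm (x s ** w s ** adj (\<gamma> (\<theta> s))) \<le> (2 * M\<^sup>2) * norm (w s)" .
    qed
    also have "\<dots> = (2 * M\<^sup>2) * integral {0..\<tau>} (\<lambda>s. norm (w s))" by simp
    also have "\<dots> \<le> (2 * M\<^sup>2) * I"
      unfolding I_def using \<tau> wi' by (intro mult_left_mono integral_subset_le wi) auto
    also have "y 0 = mat 1"
      using detx[of 0] a by (simp add: y_def \<theta>ends ends(1)[symmetric] mult_adj)
    ultimately show ?thesis
      using integral_unique[OF f] by simp
  qed

  \<comment> \<open>The calibration \<open>\<phi>\<close> takes equal values at both ends. Its derivative is the first variation of the length plus an error that is quadratic in the deviation.\<close>
  define \<phi> where "\<phi> = (\<lambda>\<tau>. 2 * Re (trace (X ** y \<tau>)))"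
  define \<phi>' where "\<phi>' = (\<lambda>\<tau>. 2 * Re (trace (X ** (x \<tau> ** w \<tau> ** adj (\<gamma> (\<theta> \<tau>))))))"
  have bl: "bounded_linear (\<lambda>A::cmat2. 2 * Re (trace (X ** A)))"
    by (intro bounded_linearI') (simp_all add: trace_cmat2 cmat2_mult_nth algebra_simps)
  have I\<phi>: "(\<phi>' has_integral (\<phi> a - \<phi> 0)) {0..a}"
    unfolding \<phi>_def \<phi>'_def
  proof (rule fundamental_theorem_of_calculus_interior_strong[OF F(1)])
    show "continuous_on {0..a} (\<lambda>\<tau>. 2 * Re (trace (X ** y \<tau>)))"
      by (rule bounded_linear.continuous_on[OF bl cy])
  qed (use a bounded_linear.has_vector_derivative[OF bl dy] in auto)
  have "\<phi> a = \<phi> 0"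
    using detx[of 0] detx[of a] a
    by (simp add: \<phi>_def y_def \<theta>ends ends[symmetric] mult_adj)
  define \<mu> where "\<mu> = I / T"
  define C where "C = 4 * M ^ 4 * norm X"
  have bound: "\<phi>' \<tau> \<le> ((\<kappa>\<^sup>2 - \<sigma>\<^sup>2) / 2 + \<mu>\<^sup>2) * \<theta>' \<tau> + (C * I - 2 * \<mu>) * norm (w \<tau>)" if \<tau>: "\<tau> \<in> {0..a}" for \<tau>
  proof -
    let ?g = "\<gamma> (\<theta> \<tau>)" and ?u = "u (\<theta> \<tau>)" and ?w = "w \<tau>"
    have "\<phi>' \<tau> = 2 * Re (trace ((adj ?g ** X ** x \<tau>) ** ?w))"
      unfolding \<phi>'_def
      by (simp add: matrix_mul_assoc trace_cycle[of "X ** x \<tau> ** ?w" "adj ?g"])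
    also have "\<dots> = 2 * ((adj ?g ** X ** x \<tau>) \<bullet> ?w)"
      by (simp add: Re_trace_H0[OF wH])
    also have "x \<tau> = ?g + (y \<tau> - mat 1) ** ?g"
      by (simp add: y_def cmult.diff_left det)
    also have "adj ?g ** X ** (?g + (y \<tau> - mat 1) ** ?g) = adj ?g ** X ** ?g + adj ?g ** X ** ((y \<tau> - mat 1) ** ?g)"
      by (rule cmult.add_right)
    also have "2 * (\<dots> \<bullet> ?w) = 2 * (?u \<bullet> ?w) + 2 * ((adj ?g ** X ** ((y \<tau> - mat 1) ** ?g)) \<bullet> ?w)"
      by (simp add: inner_add_left extremal[OF wH])
    also have "2 * ((adj ?g ** X ** ((y \<tau> - mat 1) ** ?g)) \<bullet> ?w) \<le> (C * I) * norm ?w"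
    proof -
      have "norm (adj ?g ** X ** ((y \<tau> - mat 1) ** ?g)) \<le> (norm ?g * norm X) * (norm (y \<tau> - mat 1) * norm ?g)"
        by (rule order_trans[OF norm_cmat2_mult_le mult_mono])
          (use norm_cmat2_mult_le[of "adj ?g" X] norm_cmat2_mult_le in auto)
      also have "\<dots> \<le> (M * norm X) * ((2 * M\<^sup>2 * I) * M)"
        using M(2)[OF \<theta>in[OF \<tau>]] y1[OF \<tau>] M(1) I0 by (intro mult_mono) auto
      also have "\<dots> = C * I / 2" by (simp add: C_def power2_eq_square power4_eq_xxxx)
      finally have n: "norm (adj ?g ** X ** ((y \<tau> - mat 1) ** ?g)) \<le> C * I / 2" .
      have "(adj ?g ** X ** ((y \<tau> - mat 1) ** ?g)) \<bullet> ?w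
          \<le> norm (adj ?g ** X ** ((y \<tau> - mat 1) ** ?g)) * norm ?w"
        by (rule norm_cauchy_schwarz)
      also have "\<dots> \<le> C * I / 2 * norm ?w"
        using n by (rule mult_right_mono) simp
      finally show ?thesis by simp
    qed
    also have "2 * (?u \<bullet> ?w) \<le> ((\<kappa>\<^sup>2 - \<sigma>\<^sup>2) / 2 + \<mu>\<^sup>2) * \<theta>' \<tau> - 2 * \<mu> * norm ?w"
    proof -
      let ?t = "\<theta>' \<tau>"
      have "2 * (norm (v \<tau>))\<^sup>2 \<le> \<kappa>\<^sup>2 * ?t\<^sup>2"
        using power_mono[OF v\<kappa>[of \<tau>], of 2] by (simp add: power_mult_distrib)
      moreover have "(norm (v \<tau>))\<^sup>2 = ?t\<^sup>2 * (norm ?u)\<^sup>2 + 2 * ?t * (?u \<bullet> ?w) + (norm ?w)\<^sup>2"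
      proof -
        have "v \<tau> = ?t *\<^sub>R ?u + ?w" by (simp add: w_def)
        then show ?thesis
          by (simp only: power2_norm_eq_inner) (simp add: inner_add_left inner_add_right inner_commute power2_eq_square algebra_simps)
      qed
      moreover have s2: "\<sigma>\<^sup>2 = 2 * (norm ?u)\<^sup>2"
        unfolding speed[of "\<theta> \<tau>", symmetric] by (simp add: power_mult_distrib)
      ultimately have q: "?t\<^sup>2 * \<sigma>\<^sup>2 + 4 * ?t * (?u \<bullet> ?w) + 2 * (norm ?w)\<^sup>2 \<le> \<kappa>\<^sup>2 * ?t\<^sup>2"
        unfolding s2 by (simp add: algebra_simps)
      define z m where "z = ?t * (?u \<bullet> ?w)" and "m = \<mu> * ?t * norm ?w"
      have "?t\<^sup>2 * \<sigma>\<^sup>2 + 4 * z + 2 * (norm ?w)\<^sup>2 \<le> \<kappa>\<^sup>2 * ?t\<^sup>2"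
        using q by (simp add: z_def)
      moreover have "2 * m \<le> (norm ?w)\<^sup>2 + \<mu>\<^sup>2 * ?t\<^sup>2"
        using zero_le_power2[of "norm ?w - \<mu> * ?t"]
        by (simp add: m_def power2_diff power_mult_distrib mult_ac)
      ultimately have "2 * z \<le> (\<kappa>\<^sup>2 * ?t\<^sup>2 - ?t\<^sup>2 * \<sigma>\<^sup>2) / 2 + \<mu>\<^sup>2 * ?t\<^sup>2 - 2 * m"
        by (simp add: field_simps)
      also have "\<dots> = ?t * (((\<kappa>\<^sup>2 - \<sigma>\<^sup>2) / 2 + \<mu>\<^sup>2) * ?t - 2 * \<mu> * norm ?w)"
        by (simp add: m_def field_simps power2_eq_square)
      finally have "?t * (2 * (?u \<bullet> ?w)) \<le> ?t * (((\<kappa>\<^sup>2 - \<sigma>\<^sup>2) / 2 + \<mu>\<^sup>2) * ?t - 2 * \<mu> * norm ?w)"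
        by (simp add: z_def)
      then show ?thesis using \<theta>'pos[of \<tau>] by simp
    qed
    finally show ?thesis by (simp add: algebra_simps)
  qed
  have "\<phi> a - \<phi> 0 \<le> ((\<kappa>\<^sup>2 - \<sigma>\<^sup>2) / 2 + \<mu>\<^sup>2) * (\<theta> a - \<theta> 0) + (C * I - 2 * \<mu>) * I"
  proof (rule has_integral_le[OF I\<phi> _ bound])
    show "((\<lambda>\<tau>. ((\<kappa>\<^sup>2 - \<sigma>\<^sup>2) / 2 + \<mu>\<^sup>2) * \<theta>' \<tau> + (C * I - 2 * \<mu>) * norm (w \<tau>)) has_integral
        ((\<kappa>\<^sup>2 - \<sigma>\<^sup>2) / 2 + \<mu>\<^sup>2) * (\<theta> a - \<theta> 0) + (C * I - 2 * \<mu>) * I) {0..a}"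
      using a I\<theta>[of 0 a] wi unfolding I_def
      by (intro has_integral_add has_integral_mult_right) (auto simp: integrable_integral)
  qed
  then have "0 \<le> ((\<kappa>\<^sup>2 - \<sigma>\<^sup>2) / 2 + \<mu>\<^sup>2) * T + (C * I - 2 * \<mu>) * I"
    using \<open>\<phi> a = \<phi> 0\<close> by (simp add: \<theta>ends T_def)
  also have "\<dots> = (\<kappa>\<^sup>2 - \<sigma>\<^sup>2) / 2 * T + (C * T - 1) * (I\<^sup>2 / T)"
    using T by (simp add: \<mu>_def field_simps power2_eq_square)
  also have "\<dots> < 0"
  proof -
    have "\<kappa>\<^sup>2 < \<sigma>\<^sup>2" using \<kappa> by (intro power_strict_mono) auto
    then have "(\<kappa>\<^sup>2 - \<sigma>\<^sup>2) / 2 * T < 0" using T by (intro mult_neg_pos) auto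
    moreover have "(C * T - 1) * (I\<^sup>2 / T) \<le> 0"
      using small(2) T by (intro mult_nonpos_nonneg) (auto simp: C_def T_def)
    ultimately show ?thesis by linarith
  qed
  finally show False by simp
qed

lemma locally_shortest: "\<exists>\<epsilon>>0. shortest_arc \<gamma> (t - \<epsilon>) (t + \<epsilon>)"
proof -
  have "bounded (\<gamma> ` {t-1..t+1})"
    by (intro compact_imp_bounded compact_continuous_image cont) simp
  then obtain M0 where M0: "\<And>s. s \<in> {t-1..t+1} \<Longrightarrow> norm (\<gamma> s) \<le> M0"
    unfolding bounded_iff by blast
  define M where "M = max 1 M0"
  define C where "C = 4 * M ^ 4 * norm X"
  have C: "C \<ge> 0" by (simp add: C_def)
  define \<epsilon> where "\<epsilon> = min 1 (1 / (4 * (\<sigma> + C + 1)))"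
  have pos: "\<sigma> + C + 1 > 0" using C speed_nonneg by simp
  then have \<epsilon>: "\<epsilon> > 0" "\<epsilon> \<le> 1" "\<epsilon> \<le> 1 / (4 * (\<sigma> + C + 1))" by (auto simp: \<epsilon>_def)
  then have e: "(\<sigma> + C + 1) * \<epsilon> \<le> 1/4"
    using pos by (simp add: field_simps)
  have s\<epsilon>: "\<sigma> * \<epsilon> \<le> 1/4" "C * \<epsilon> \<le> 1/4"
  proof -
    have "\<sigma> * \<epsilon> \<le> (\<sigma> + C + 1) * \<epsilon>" "C * \<epsilon> \<le> (\<sigma> + C + 1) * \<epsilon>"
      using C speed_nonneg \<epsilon>(1) by (intro mult_right_mono; simp)+
    with e show "\<sigma> * \<epsilon> \<le> 1/4" "C * \<epsilon> \<le> 1/4" by linarith+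
  qed
  have "shortest_arc \<gamma> (t - \<epsilon>) (t + \<epsilon>)"
  proof (rule shortest_arcI)
    show "t - \<epsilon> < t + \<epsilon>" using \<epsilon>(1) by simp
    fix l assume "reach (adj (\<gamma> (t - \<epsilon>)) ** \<gamma> (t + \<epsilon>)) l"
    from reach_curve[OF this det[of "t - \<epsilon>"]] obtain x v \<Lambda> a where *: "broken_curve x v \<Lambda> a"
      "x 0 = \<gamma> (t - \<epsilon>)" "x a = \<gamma> (t + \<epsilon>)" "\<Lambda> a = l"
      by (auto simp: det)
    have "\<sigma> * (t + \<epsilon> - (t - \<epsilon>)) \<le> \<Lambda> a"
    proof (rule local_lower_bound[OF *(1-3)])
      show "norm (\<gamma> s) \<le> M" if "s \<in> {t - \<epsilon>..t + \<epsilon>}" for s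
        using M0[of s] that \<epsilon>(2) by (auto simp: M_def)
    qed (use \<epsilon>(1) s\<epsilon> in \<open>auto simp: M_def[symmetric] C_def[symmetric]\<close>, simp add: M_def)
    then show "\<sigma> * (t + \<epsilon> - (t - \<epsilon>)) \<le> l" by (simp add: *)
  qed
  with \<epsilon>(1) show ?thesis by blast
qed

end

section \<open>Lifting curves to GL+(2)\<close>

lemma lipschitz_bilinear:
  assumes "bounded_bilinear pr" and f: "L1-lipschitz_on {a..b::real} f" and g: "L2-lipschitz_on {a..b} g"
  obtains L where "L-lipschitz_on {a..b} (\<lambda>t. pr (f t) (g t))"
proof -
  interpret bounded_bilinear pr by fact
  obtain M where M: "M \<ge> 0" "\<And>x y. norm (pr x y) \<le> norm x * norm y * M"
    using nonneg_bounded by blast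
  obtain A where A: "A \<ge> 0" "\<And>t. t \<in> {a..b} \<Longrightarrow> norm (f t) \<le> A"
    by (rule AC_on_bounded[OF lipschitz_imp_AC[OF f]]) (rule that)
  obtain B where B: "B \<ge> 0" "\<And>t. t \<in> {a..b} \<Longrightarrow> norm (g t) \<le> B"
    by (rule AC_on_bounded[OF lipschitz_imp_AC[OF g]]) (rule that)
  have "(L1 * B * M + A * L2 * M)-lipschitz_on {a..b} (\<lambda>t. pr (f t) (g t))"
  proof (rule lipschitz_onI)
    show "0 \<le> L1 * B * M + A * L2 * M"
      using A B M lipschitz_on_nonneg[OF f] lipschitz_on_nonneg[OF g] by simp
    fix s t assume s: "s \<in> {a..b}" and t: "t \<in> {a..b}"
    have "pr (f s) (g s) - pr (f t) (g t) = pr (f s - f t) (g s) + pr (f t) (g s - g t)"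
      by (simp add: diff_left diff_right)
    then have "norm (pr (f s) (g s) - pr (f t) (g t))
        \<le> norm (f s - f t) * norm (g s) * M + norm (f t) * norm (g s - g t) * M"
      using norm_triangle_ineq[of "pr (f s - f t) (g s)" "pr (f t) (g s - g t)"]
        M(2)[of "f s - f t" "g s"] M(2)[of "f t" "g s - g t"] by simp
    also have "\<dots> \<le> (L1 * norm (s - t)) * B * M + A * (L2 * norm (s - t)) * M"
      using A B M s t lipschitz_on_normD[OF f s t] lipschitz_on_normD[OF g s t] lipschitz_on_nonneg[OF f]
      by (intro add_mono mult_right_mono mult_mono) auto
    finally show "dist (pr (f s) (g s)) (pr (f t) (g t)) \<le> (L1 * B * M + A * L2 * M) * dist s t"
      by (simp add: dist_norm algebra_simps)
  qed
  then show thesis by (rule that)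
qed

lemma lipschitz_C1_compose:
  fixes f :: "real \<Rightarrow> real" and h :: "real \<Rightarrow> real"
  assumes f: "L-lipschitz_on {a..b} f" and "f ` {a..b} \<subseteq> {m..M}"
    and h: "\<And>x. x \<in> {m..M} \<Longrightarrow> (h has_real_derivative h' x) (at x)" "continuous_on {m..M} h'"
  obtains L' where "L'-lipschitz_on {a..b} (\<lambda>t. h (f t))"
proof -
  have "(h has_vector_derivative h' x) (at x within {m..M})" if "x \<in> {m..M}" for x
    using h(1)[OF that]
    by (auto simp: has_real_derivative_iff_has_vector_derivative intro: has_vector_derivative_at_within)
  then obtain K where "K-lipschitz_on {m..M} h"
    using continuous_derivative_imp_lipschitz[OF _ h(2)] by blast
  then have "K-lipschitz_on (f ` {a..b}) h"
    using assms(2) by (rule lipschitz_on_subset)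
  from that[OF lipschitz_on_compose2[OF f this]] show thesis .
qed

lemma lipschitz_exp_half:
  fixes f :: "real \<Rightarrow> real"
  assumes f: "L-lipschitz_on {a..b} f"
  obtains L' where "L'-lipschitz_on {a..b} (\<lambda>t. exp (f t / 2))"
proof -
  obtain A where A: "\<And>t. t \<in> {a..b} \<Longrightarrow> norm (f t) \<le> A"
    by (rule AC_on_bounded[OF lipschitz_imp_AC[OF f]]) (rule that)
  show thesis
  proof (rule lipschitz_C1_compose[OF f, of "-A" A "\<lambda>x. exp (x / 2)" "\<lambda>x. exp (x / 2) / 2"])
    show "f ` {a..b} \<subseteq> {-A..A}" using A by (force simp: abs_le_iff)
    show "((\<lambda>x. exp (x / 2)) has_real_derivative exp (x / 2) / 2) (at x)" for x :: real
      by (auto intro!: derivative_eq_intros)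
    show "continuous_on {-A..A} (\<lambda>x. exp (x / 2) / 2)" by (intro continuous_intros) auto
  qed (rule that)
qed

lemma lipschitz_scaled:
  fixes g :: "real \<Rightarrow> cmat2"
  assumes "L1-lipschitz_on {a..b} g" "L2-lipschitz_on {a..b} s"
  obtains L where "L-lipschitz_on {a..b} (\<lambda>t. exp (s t / 2) *\<^sub>R g t)"
proof -
  obtain L' where "L'-lipschitz_on {a..b} (\<lambda>t. exp (s t / 2))"
    by (rule lipschitz_exp_half[OF assms(2)]) (rule that)
  from lipschitz_bilinear[OF bounded_bilinear_scaleR this assms(1)] that show thesis by blast
qed

lemma det_has_vector_derivative:
  fixes g :: "real \<Rightarrow> cmat2"
  assumes "(g has_vector_derivative g t ** c) (at t within S)"
  shows "((\<lambda>t. det (g t)) has_vector_derivative det (g t) * trace c) (at t within S)"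
proof -
  have bl: "bounded_linear (\<lambda>A::cmat2. A $ i $ j)" for i j
    by (intro bounded_linear_compose[OF bounded_linear_vec_nth bounded_linear_vec_nth])
  have d: "((\<lambda>t. g t $ i $ j) has_vector_derivative (g t ** c) $ i $ j) (at t within S)" for i j
    by (rule bounded_linear.has_vector_derivative[OF bl assms])
  have "((\<lambda>t. g t $ 1 $ 1 * g t $ 2 $ 2 - g t $ 1 $ 2 * g t $ 2 $ 1) has_vector_derivative
     (g t $ 1 $ 1 * (g t ** c) $ 2 $ 2 + (g t ** c) $ 1 $ 1 * g t $ 2 $ 2)
      - (g t $ 1 $ 2 * (g t ** c) $ 2 $ 1 + (g t ** c) $ 1 $ 2 * g t $ 2 $ 1)) (at t within S)"
    by (intro has_vector_derivative_diff has_vector_derivative_mult d)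
  then show ?thesis
    unfolding det_cmat2 trace_cmat2 cmat2_mult_nth by (simp add: algebra_simps)
qed

lemma GL_plus_inverse:
  assumes "A \<in> GL_plus"
  shows "A ** matrix_inv A = mat 1"
proof -
  define r where "r = 1 / sqrt (Re (det A))"
  have "det (r *\<^sub>R A) = 1"
    using assms by (simp add: r_def GL_plus_def det_scaleR_cmat2 power_divide complex_is_Real_iff complex_eq_iff)
  from mult_adj[OF this] have "A ** (r *\<^sub>R adj (r *\<^sub>R A)) = mat 1"
    by (simp add: cmult.scaleR_left cmult.scaleR_right)
  then show ?thesis
    using matrix_inv_cmat2 by metis
qed

lemma control_has_vector_derivative:
  assumes "g differentiable (at t)" "g t \<in> GL_plus"
  shows "(g has_vector_derivative g t ** control g t) (at t)"
  using assms by (simp add: control_def matrix_mul_assoc GL_plus_inverse vector_derivative_works[symmetric])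

lemma trace_H: "c \<in> H \<Longrightarrow> trace c = of_real (Re (trace c))"
  by (simp add: H_iff trace_cmat2 complex_eq_iff)

text \<open>The reverse Cauchy-Schwarz inequality for the timelike vectors \<open>(1, B)\<close> and \<open>(k, b)\<close> of the Lorentzian plane.\<close>

lemma reverse_cauchy_schwarz:
  assumes "0 \<le> B" "B < 1" "0 \<le> b" "b \<le> k"
  shows "sqrt (1 - B\<^sup>2) * sqrt (k\<^sup>2 - b\<^sup>2) \<le> k - B * b"
proof -
  have "B\<^sup>2 \<le> 1" using assms by (simp add: abs_square_le_1)
  have "(1 - B\<^sup>2) * (k\<^sup>2 - b\<^sup>2) = (k - B * b)\<^sup>2 - (b - B * k)\<^sup>2"
    by (simp add: power2_eq_square algebra_simps)
  also have "\<dots> \<le> (k - B * b)\<^sup>2" by simp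
  finally have "sqrt ((1 - B\<^sup>2) * (k\<^sup>2 - b\<^sup>2)) \<le> sqrt ((k - B * b)\<^sup>2)"
    by (rule real_sqrt_le_mono)
  moreover have "B * b \<le> k" using mult_mono[of B 1 b k] assms by simp
  ultimately show ?thesis by (simp add: real_sqrt_mult)
qed

text \<open>A future directed curve splits as \<open>g = e\<^bsup>s/2\<^esup> \<eta>\<close> with \<open>\<eta>\<close> in SL(2), and its length is the integral of
  \<open>\<surd>(s'\<^sup>2 - b\<^sup>2)\<close> with \<open>b\<close> the speed of \<open>\<eta>\<close>. The reverse Cauchy-Schwarz inequality makes the
  integrand linear in \<open>s'\<close> and \<open>b\<close>. The integral of \<open>s'\<close> depends on the endpoints only, that of \<open>b\<close> is bounded below
  by the distance of the projected endpoints.\<close>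

lemma lorentz_length_le:
  fixes g :: "real \<Rightarrow> cmat2"
  assumes "a < b" and fut: "future_directed_on {a..b} g" and nsp: "nonspacelike_on {a..b} g"
    and ends: "g a = exp (s0 / 2) *\<^sub>R x" "g b = exp (s1 / 2) *\<^sub>R y" "det x = 1" "det y = 1"
    and D: "\<And>l. reach (adj x ** y) l \<Longrightarrow> D \<le> l" and B: "0 \<le> B" "B < 1"
  shows "sqrt (1 - B\<^sup>2) * lorentz_length g a b \<le> (s1 - s0) - B * D"
proof -
  have hor: "horizontal_on {a..b} g" using fut by (simp add: future_directed_on_def)
  obtain L where L: "L-lipschitz_on {a..b} g"
    using hor unfolding horizontal_on_def lipschitzian_on_def by blast
  have GL: "det (g t) \<in> \<real>" "Re (det (g t)) > 0" if "t \<in> {a..b}" for t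
    using hor that unfolding horizontal_on_def GL_plus_def by blast+
  have ae: "ae_on {a..b} (\<lambda>t. g differentiable at t \<and> control g t \<in> H)"
    "ae_on {a..b} (\<lambda>t. pseudo_prod (control g t) (control g t) \<ge> 0)"
    "ae_on {a..b} (\<lambda>t. pseudo_prod (control g t) e0 > 0)"
    using fut nsp by (simp_all add: future_directed_on_def horizontal_on_def nonspacelike_on_def)
  obtain N1 where N1: "negligible N1" "\<And>t. t \<in> {a..b} - N1 \<Longrightarrow> a < t \<and> t < b \<and> g differentiable at t \<and> control g t \<in> H"
    by (rule ae_on_IccE[OF ae(1)]) (rule that)
  obtain N2 where N2: "negligible N2" "\<And>t. t \<in> {a..b} - N2 \<Longrightarrow> a < t \<and> t < b \<and> pseudo_prod (control g t) (control g t) \<ge> 0"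
    by (rule ae_on_IccE[OF ae(2)]) (rule that)
  obtain N3 where N3: "negligible N3" "\<And>t. t \<in> {a..b} - N3 \<Longrightarrow> a < t \<and> t < b \<and> pseudo_prod (control g t) e0 > 0"
    by (rule ae_on_IccE[OF ae(3)]) (rule that)
  define N where "N = N1 \<union> N2 \<union> N3"
  have N: "negligible N" using N1 N2 N3 by (simp add: N_def negligible_Un)
  define c where "c = control g"
  define k where "k t = Re (trace (c t))" for t
  define w where "w t = c t - k t *\<^sub>R e0" for t
  have t: "a < t" "t < b" "(g has_vector_derivative g t ** c t) (at t)" "c t \<in> H" "w t \<in> H0"
    "k t > 0" "pseudo_prod (c t) (c t) = (k t)\<^sup>2 - (sqrt 2 * norm (w t))\<^sup>2" "sqrt 2 * norm (w t) \<le> k t"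
    if t: "t \<in> {a..b} - N" for t
  proof -
    show "a < t" "t < b" using N1(2)[of t] t by (auto simp: N_def)
    show cH: "c t \<in> H" using N1(2)[of t] t by (auto simp: N_def c_def)
    show kp: "k t > 0" using N3(2)[of t] t by (auto simp: N_def c_def k_def pseudo_prod_e0)
    show wH: "w t \<in> H0" unfolding w_def k_def by (rule H_decomp[OF cH])
    have "c t = k t *\<^sub>R e0 + w t" by (simp add: w_def)
    then show p: "pseudo_prod (c t) (c t) = (k t)\<^sup>2 - (sqrt 2 * norm (w t))\<^sup>2"
      using pseudo_prod_H0[OF wH, of "k t"] by (simp add: power_mult_distrib)
    have "0 \<le> pseudo_prod (c t) (c t)" using N2(2)[of t] t by (auto simp: N_def c_def)
    then have "(sqrt 2 * norm (w t))\<^sup>2 \<le> (k t)\<^sup>2" using p by simp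
    then show "sqrt 2 * norm (w t) \<le> k t" by (rule power2_le_imp_le) (use kp in simp)
    show "(g has_vector_derivative g t ** c t) (at t)"
      using N1(2)[of t] t hor unfolding c_def
      by (intro control_has_vector_derivative) (auto simp: N_def horizontal_on_def)
  qed

  \<comment> \<open>The factor \<open>e\<^bsup>s/2\<^esup>\<close> of \<open>g\<close> is read off from the determinant, \<open>s = ln det g\<close>.\<close>
  define d where "d t = Re (det (g t))" for t
  have dpos: "d t > 0" if "t \<in> {a..b}" for t using GL(2)[OF that] by (simp add: d_def)
  have detd: "det (g t) = of_real (d t)" if "t \<in> {a..b}" for t
    using GL(1)[OF that] by (simp add: d_def complex_is_Real_iff complex_eq_iff)
  have "\<exists>L. L-lipschitz_on {a..b} d"
  proof -
    obtain K where "K-lipschitz_on (g ` {a..b}) adj"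
      by (rule bounded_linear.lipschitz_boundE[OF bounded_linear_adj]) (rule that)
    from lipschitz_on_compose2[OF L this] have "(K * L)-lipschitz_on {a..b} (\<lambda>t. adj (g t))" .
    then obtain L2 where L2: "L2-lipschitz_on {a..b} (\<lambda>t. g t ** adj (g t))"
      using lipschitz_bilinear[OF bounded_bilinear_cmat2_mult L] by blast
    have "bounded_linear (\<lambda>A::cmat2. Re (A $ 1 $ 1))"
      by (intro bounded_linear_compose[OF bounded_linear_Re] bounded_linear_compose[OF bounded_linear_vec_nth bounded_linear_vec_nth])
    then obtain K where "K-lipschitz_on ((\<lambda>t. g t ** adj (g t)) ` {a..b}) (\<lambda>A::cmat2. Re (A $ 1 $ 1))"
      by (rule bounded_linear.lipschitz_boundE) (rule that)
    from lipschitz_on_compose2[OF L2 this]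
    have "(K * L2)-lipschitz_on {a..b} (\<lambda>t. Re ((g t ** adj (g t)) $ 1 $ 1))" .
    moreover have "Re ((g t ** adj (g t)) $ 1 $ 1) = d t" for t
      by (simp add: d_def det_cmat2 cmat2_mult_nth adj_def)
    ultimately show ?thesis by auto
  qed
  then obtain Ld where Ld: "Ld-lipschitz_on {a..b} d" by blast
  define s where "s t = ln (d t)" for t
  have "\<exists>L. L-lipschitz_on {a..b} s"
  proof -
    have cd: "continuous_on {a..b} d" by (rule lipschitz_on_continuous_on[OF Ld])
    obtain t0 where t0: "t0 \<in> {a..b}" "\<And>t. t \<in> {a..b} \<Longrightarrow> d t0 \<le> d t"
    proof -
      have "\<exists>t\<in>{a..b}. \<forall>r\<in>{a..b}. d t \<le> d r"
        using \<open>a < b\<close> by (intro continuous_attains_inf cd) auto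
      then show thesis using that by blast
    qed
    obtain t1 where t1: "t1 \<in> {a..b}" "\<And>t. t \<in> {a..b} \<Longrightarrow> d t \<le> d t1"
    proof -
      have "\<exists>t\<in>{a..b}. \<forall>r\<in>{a..b}. d r \<le> d t"
        using \<open>a < b\<close> by (intro continuous_attains_sup cd) auto
      then show thesis using that by blast
    qed
    have pos: "x > 0" if "x \<in> {d t0..d t1}" for x using dpos[OF t0(1)] that by auto
    obtain L' where "L'-lipschitz_on {a..b} (\<lambda>t. ln (d t))"
    proof (rule lipschitz_C1_compose[OF Ld, of "d t0" "d t1" ln "\<lambda>x. 1 / x"])
      show "d ` {a..b} \<subseteq> {d t0..d t1}" using t0 t1 by auto
      show "(ln has_real_derivative 1 / x) (at x)" if "x \<in> {d t0..d t1}" for x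
        using pos[OF that] by (auto intro!: derivative_eq_intros)
      show "continuous_on {d t0..d t1} (\<lambda>x. 1 / x)"
        using pos by (intro continuous_intros) force+
    qed
    then show ?thesis unfolding s_def by blast
  qed
  then obtain Ls where Ls: "Ls-lipschitz_on {a..b} s" by blast
  have ds: "(s has_real_derivative k t) (at t)" if "t \<in> {a..b} - N" for t
  proof -
    have tab: "t \<in> {a..b}" using that by auto
    have tr: "trace (c t) = of_real (k t)"
      unfolding k_def by (rule trace_H[OF t(4)[OF that]])
    have "((\<lambda>t. det (g t)) has_vector_derivative of_real (d t * k t)) (at t)"
      using det_has_vector_derivative[OF t(3)[OF that]] unfolding tr detd[OF tab] by simp
    from bounded_linear.has_vector_derivative[OF bounded_linear_Re this]
    have "(d has_real_derivative d t * k t) (at t)"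
      unfolding has_real_derivative_iff_has_vector_derivative d_def[abs_def] by simp
    then have "((\<lambda>t. ln (d t)) has_real_derivative (1 / d t) * (d t * k t)) (at t)"
      using dpos[OF tab] by (auto intro!: derivative_eq_intros)
    then show ?thesis using dpos[OF tab] by (simp add: s_def[abs_def])
  qed
  have Ik: "(k has_integral (s b - s a)) {a..b}"
    using \<open>a < b\<close> ds
    by (intro AC_FTC[OF _ lipschitz_imp_AC[OF Ls] N])
      (auto simp: has_real_derivative_iff_has_vector_derivative intro: has_vector_derivative_at_within)

  \<comment> \<open>The other factor lies in SL(2) and has the traceless part \<open>w\<close> of the control as its control.\<close>
  define \<eta> where "\<eta> t = exp (- s t / 2) *\<^sub>R g t" for t
  obtain L\<eta> where L\<eta>: "L\<eta>-lipschitz_on {a..b} \<eta>"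
  proof -
    have "Ls-lipschitz_on {a..b} (\<lambda>t. - s t)" using Ls by (simp add: lipschitz_on_minus)
    from lipschitz_scaled[OF L this] that show thesis unfolding \<eta>_def[abs_def] by blast
  qed
  have det\<eta>: "det (\<eta> t) = 1" if "t \<in> {a..b}" for t
  proof -
    have "(exp (- s t / 2))\<^sup>2 = exp (- s t)"
      by (simp only: exp_double[symmetric]) simp
    then have "(exp (- s t / 2))\<^sup>2 * d t = 1"
      using dpos[OF that] by (simp add: s_def exp_minus)
    then show ?thesis
      unfolding \<eta>_def det_scaleR_cmat2 detd[OF that] of_real_mult[symmetric] by (simp only: of_real_1)
  qed
  have d\<eta>: "a < t \<and> t < b \<and> (\<eta> has_vector_derivative \<eta> t ** w t) (at t) \<and> w t \<in> H0" if "t \<in> {a..b} - N" for t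
  proof -
    have "((\<lambda>t. - s t) has_real_derivative - k t) (at t)"
      using ds[OF that] by (auto intro!: derivative_eq_intros)
    from lift_has_vector_derivative[OF t(3)[OF that] this] show ?thesis
      using t[OF that] by (simp add: \<eta>_def[abs_def] w_def)
  qed
  have wint: "(\<lambda>t. sqrt 2 * norm (w t)) integrable_on {a..b}"
    by (rule polygon_approximation(1)[OF \<open>a < b\<close> L\<eta> det\<eta> N d\<eta>])
  define W where "W = integral {a..b} (\<lambda>t. sqrt 2 * norm (w t))"
  have s: "s a = s0" "s b = s1" "\<eta> a = x" "\<eta> b = y"
  proof -
    show *: "s a = s0" "s b = s1"
      using ends by (simp_all add: s_def d_def det_scaleR_cmat2 exp_double[symmetric])
    show "\<eta> a = x" "\<eta> b = y"
      unfolding \<eta>_def * using ends by (simp_all add: flip: exp_add)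
  qed
  have "D \<le> W"
  proof (rule field_le_epsilon)
    fix e :: real assume "e > 0"
    from polygon_approximation(2)[OF \<open>a < b\<close> L\<eta> det\<eta> N d\<eta> this]
    obtain l where "reach (adj (\<eta> a) ** \<eta> b) l" "l \<le> W + e" by (auto simp: W_def)
    then show "D \<le> W + e" using D[of l] by (simp add: s)
  qed
  have I: "((\<lambda>t. k t - B * (sqrt 2 * norm (w t))) has_integral (s1 - s0) - B * W) {a..b}"
    using has_integral_diff[OF Ik has_integral_mult_right[OF integrable_integral[OF wint], of B]]
    unfolding s W_def .
  have le: "sqrt (1 - B\<^sup>2) * sqrt (pseudo_prod (c t) (c t)) \<le> k t - B * (sqrt 2 * norm (w t))"
    if "t \<in> {a..b} - N" for t
    unfolding t(7)[OF that] using B t(8)[OF that] by (intro reverse_cauchy_schwarz) auto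
  have B2: "B\<^sup>2 \<le> 1" using B by (simp add: abs_square_le_1)
  have "sqrt (1 - B\<^sup>2) * lorentz_length g a b \<le> (s1 - s0) - B * W"
  proof (cases "(\<lambda>t. sqrt (pseudo_prod (c t) (c t))) integrable_on {a..b}")
    case True
    from has_integral_mult_right[OF integrable_integral[OF True], of "sqrt (1 - B\<^sup>2)"]
    have "((\<lambda>t. sqrt (1 - B\<^sup>2) * sqrt (pseudo_prod (c t) (c t))) has_integral
        sqrt (1 - B\<^sup>2) * lorentz_length g a b) {a..b}"
      unfolding lorentz_length_def c_def .
    from has_integral_spike[OF N _ this, of "\<lambda>t. if t \<in> N then k t - B * (sqrt 2 * norm (w t)) else sqrt (1 - B\<^sup>2) * sqrt (pseudo_prod (c t) (c t))"]
    have "((\<lambda>t. if t \<in> N then k t - B * (sqrt 2 * norm (w t)) else sqrt (1 - B\<^sup>2) * sqrt (pseudo_prod (c t) (c t))) has_integral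
        sqrt (1 - B\<^sup>2) * lorentz_length g a b) {a..b}" by auto
    from has_integral_le[OF this I] show ?thesis using le by auto
  next
    case False
    then have "lorentz_length g a b = 0"
      unfolding lorentz_length_def c_def[symmetric] by (rule not_integrable_integral)
    moreover have "((\<lambda>t. if t \<in> N then 0 else k t - B * (sqrt 2 * norm (w t))) has_integral (s1 - s0) - B * W) {a..b}"
      by (rule has_integral_spike[OF N _ I]) auto
    then have "0 \<le> (s1 - s0) - B * W"
    proof (rule has_integral_nonneg)
      fix t assume "t \<in> {a..b}"
      have bb: "B * (sqrt 2 * norm (w t)) \<le> 1 * (sqrt 2 * norm (w t))"
        using B by (intro mult_right_mono) auto
      have "B * (sqrt 2 * norm (w t)) \<le> k t" if "t \<notin> N"
        by (rule order_trans[OF bb]) (use t(8)[of t] that \<open>t \<in> {a..b}\<close> in simp)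
      then show "0 \<le> (if t \<in> N then 0 else k t - B * (sqrt 2 * norm (w t)))"
        by simp
    qed
    ultimately show ?thesis by simp
  qed
  also have "\<dots> \<le> (s1 - s0) - B * D" using \<open>D \<le> W\<close> B by (simp add: mult_left_mono)
  finally show ?thesis .
qed

lemma lorentz_length_le_dist:
  assumes "a < b" "future_directed_on {a..b} g" "nonspacelike_on {a..b} g"
  shows "ereal (lorentz_length g a b) \<le> lorentz_dist (g a) (g b)"
  unfolding lorentz_dist_def using assms by (intro Sup_upper) blast

lemma pseudo_prod_split_e0: "v \<in> H0 \<Longrightarrow> pseudo_prod (c *\<^sub>R e0 + v) e0 = c"
  unfolding pseudo_prod_e0 by (simp add: trace_cmat2 e0_def H0_iff)

context SL_curve
begin

text \<open>Up to reparametrization these are the curves of the theorem, with \<open>C\<close> the constant component of the control along \<open>e0\<close>.\<close>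

definition lift :: "real \<Rightarrow> real \<Rightarrow> cmat2" where
  "lift C t = exp (C * t / 2) *\<^sub>R \<gamma> t"

lemma control_lift: "control (lift C) t = C *\<^sub>R e0 + u t"
proof -
  have "((\<lambda>t. C * t) has_real_derivative C) (at t)"
    by (auto intro!: derivative_eq_intros)
  from control_scaled[OF det deriv this] show ?thesis
    by (simp add: lift_def[abs_def])
qed

lemma lift_deriv: "(lift C has_vector_derivative lift C t ** (C *\<^sub>R e0 + u t)) (at t)"
proof -
  have "((\<lambda>t. C * t) has_real_derivative C) (at t)"
    by (auto intro!: derivative_eq_intros)
  from lift_has_vector_derivative[OF deriv this] show ?thesis
    by (simp add: lift_def[abs_def])
qed

lemma pseudo_prod_lift: "pseudo_prod (control (lift C) t) (control (lift C) t) = C\<^sup>2 - \<sigma>\<^sup>2"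
  unfolding control_lift pseudo_prod_H0[OF u_H0] speed[of t, symmetric]
  by (simp add: power_mult_distrib)

lemma pseudo_prod_lift_e0: "pseudo_prod (control (lift C) t) e0 = C"
  by (simp add: control_lift pseudo_prod_split_e0[OF u_H0])

lemma lift_horizontal: "horizontal_on S (lift C)"
  unfolding horizontal_on_def
proof (intro conjI)
  show "lift C ` S \<subseteq> GL_plus"
    by (auto simp: GL_plus_def lift_def det_scaleR_cmat2 det simp flip: of_real_power)
  have cl: "continuous_on T (lift C)" for T
    unfolding lift_def by (intro continuous_intros cont) auto
  show "lipschitzian_on S (lift C)"
    unfolding lipschitzian_on_def
  proof (intro allI impI)
    fix a b
    have "continuous_on {a..b} (\<lambda>t. lift C t ** (C *\<^sub>R e0 + u t))"
      by (intro cmult.continuous_on cl continuous_intros continuous_on_subset[OF cont_u]) auto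
    from continuous_derivative_imp_lipschitz[OF has_vector_derivative_at_within[OF lift_deriv] this]
    show "\<exists>L. L-lipschitz_on {a..b} (lift C)" by blast
  qed
  have "C *\<^sub>R e0 + u t \<in> H" for t
    using u_H0[of t] by (auto simp: H0_iff H_iff e0_half)
  then show "ae_on S (\<lambda>t. lift C differentiable at t \<and> control (lift C) t \<in> H)"
    using lift_deriv by (intro AE_I2) (auto simp: control_lift differentiable_def has_vector_derivative_def)
qed

lemma lift_future_directed: "C > 0 \<Longrightarrow> future_directed_on S (lift C)"
  by (simp add: future_directed_on_def lift_horizontal pseudo_prod_lift_e0)

lemma lift_nonspacelike: "\<sigma> \<le> C \<Longrightarrow> nonspacelike_on S (lift C)"
  using speed_nonneg by (simp add: nonspacelike_on_def lift_horizontal pseudo_prod_lift power_mono)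

lemma lift_timelike: "\<sigma> < C \<Longrightarrow> timelike_on S (lift C)"
  using speed_nonneg by (simp add: timelike_on_def lift_horizontal pseudo_prod_lift power_strict_mono)

lemma lift_isotropic: "C > 0 \<Longrightarrow> \<sigma> = C \<Longrightarrow> isotropic_on S (lift C)"
proof -
  assume C: "C > 0" "\<sigma> = C"
  have "control (lift C) t \<noteq> 0" for t
    using pseudo_prod_lift_e0[of C t] C(1) by (auto simp: pseudo_prod_e0 trace_cmat2)
  then show ?thesis
    using C by (simp add: isotropic_on_def lift_horizontal pseudo_prod_lift)
qed

lemma lorentz_length_lift: "a \<le> b \<Longrightarrow> lorentz_length (lift C) a b = sqrt (C\<^sup>2 - \<sigma>\<^sup>2) * (b - a)"
  by (simp add: lorentz_length_def pseudo_prod_lift)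

text \<open>Over a shortest arc the estimate \<open>lorentz_length_le\<close> with \<open>B = \<sigma> / C\<close> is attained by the lift.\<close>

lemma longest_arc_lift:
  assumes C: "C > 0" "\<sigma> \<le> C" and "shortest_arc \<gamma> a b"
  shows "longest_arc (lift C) a b"
proof -
  have ab: "a < b" and dist: "riem_dist (\<gamma> a) (\<gamma> b) = ereal (\<sigma> * (b - a))"
    using assms(3) by (simp_all add: shortest_arc_iff)
  define T where "T = b - a"
  have T: "T > 0" using ab by (simp add: T_def)
  have low: "\<sigma> * T \<le> l" if "reach (adj (\<gamma> a) ** \<gamma> b) l" for l
    using riem_dist_le_reach[OF that det[of a]] dist by (simp add: det T_def)
  have s0: "\<sigma> \<ge> 0" by (rule speed_nonneg)
  have upper: "lorentz_length g c d \<le> sqrt (C\<^sup>2 - \<sigma>\<^sup>2) * T"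
    if g: "c < d" "future_directed_on {c..d} g" "nonspacelike_on {c..d} g" "g c = lift C a" "g d = lift C b" for g c d
  proof -
    have main: "sqrt (1 - B\<^sup>2) * lorentz_length g c d \<le> C * T - B * (\<sigma> * T)" if "0 \<le> B" "B < 1" for B
      using lorentz_length_le[OF g(1-3), of "C * a" "\<gamma> a" "C * b" "\<gamma> b" "\<sigma> * T" B] g(4,5) low that
      by (simp add: lift_def det) (simp add: T_def algebra_simps)
    show ?thesis
    proof (cases "\<sigma> < C")
      case True
      have pos: "C\<^sup>2 - \<sigma>\<^sup>2 > 0" using True s0 by (simp add: power_strict_mono)
      have "1 - (\<sigma> / C)\<^sup>2 = (C\<^sup>2 - \<sigma>\<^sup>2) / C\<^sup>2" using C by (simp add: field_simps)
      then have "sqrt (1 - (\<sigma> / C)\<^sup>2) = sqrt (C\<^sup>2 - \<sigma>\<^sup>2) / C" using C by (simp add: real_sqrt_divide)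
      with main[of "\<sigma> / C"] True s0 C
      have "sqrt (C\<^sup>2 - \<sigma>\<^sup>2) / C * lorentz_length g c d \<le> C * T - \<sigma> / C * (\<sigma> * T)" by simp
      also have "\<dots> = (C\<^sup>2 - \<sigma>\<^sup>2) / C * T" using C by (simp add: field_simps power2_eq_square)
      also have "\<dots> = sqrt (C\<^sup>2 - \<sigma>\<^sup>2) / C * (sqrt (C\<^sup>2 - \<sigma>\<^sup>2) * T)"
        using pos by (simp flip: mult.assoc)
      finally show ?thesis
        by (rule mult_left_le_imp_le) (use pos C in simp)
    next
      case False
      then have "\<sigma> = C" using C by simp
      have "lorentz_length g c d \<le> 0"
      proof (rule ccontr)
        assume "\<not> ?thesis"
        then have l: "lorentz_length g c d > 0" by simp
        \<comment> \<open>Here \<open>B = 1\<close> is excluded, so \<open>B = 1 - e\<^sup>2\<close> with a small \<open>e\<close> is used instead.\<close>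
        define e where "e = min 1 (lorentz_length g c d / (2 * (C * T)))"
        have CT: "C * T > 0" using C T by simp
        have e: "e > 0" "e \<le> 1" "e \<le> lorentz_length g c d / (2 * (C * T))"
          using l CT by (auto simp: e_def)
        have e2: "e\<^sup>2 \<le> 1" using e by (simp add: abs_square_le_1)
        have "e * lorentz_length g c d \<le> sqrt (1 - (1 - e\<^sup>2)\<^sup>2) * lorentz_length g c d"
        proof (rule mult_right_mono)
          have "e\<^sup>2 * 1 \<le> e\<^sup>2 * (2 - e\<^sup>2)" using e2 by (intro mult_left_mono) auto
          also have "\<dots> = 1 - (1 - e\<^sup>2)\<^sup>2" by (simp add: power2_eq_square algebra_simps)
          finally show "e \<le> sqrt (1 - (1 - e\<^sup>2)\<^sup>2)" by (simp add: real_le_rsqrt)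
        qed (use l in simp)
        also have "\<dots> \<le> C * T - (1 - e\<^sup>2) * (\<sigma> * T)"
          using e e2 by (intro main) auto
        also have "\<dots> = e * (e * (C * T))"
          unfolding \<open>\<sigma> = C\<close> by (simp add: power2_eq_square algebra_simps)
        finally have "lorentz_length g c d \<le> e * (C * T)"
          using e(1) by simp
        also have "\<dots> \<le> lorentz_length g c d / 2"
          using e(3) CT by (simp add: pos_le_divide_eq mult.left_commute mult.commute[of _ e])
        finally show False using l by simp
      qed
      then show ?thesis by (simp add: \<open>\<sigma> = C\<close>)
    qed
  qed
  have fn: "future_directed_on {a..b} (lift C)" "nonspacelike_on {a..b} (lift C)"
    by (rule lift_future_directed[OF C(1)] lift_nonspacelike[OF C(2)])+
  have "lorentz_dist (lift C a) (lift C b) = ereal (lorentz_length (lift C) a b)"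
  proof (rule antisym)
    show "ereal (lorentz_length (lift C) a b) \<le> lorentz_dist (lift C a) (lift C b)"
      by (rule lorentz_length_le_dist[OF ab fn])
    show "lorentz_dist (lift C a) (lift C b) \<le> ereal (lorentz_length (lift C) a b)"
      unfolding lorentz_dist_def using upper ab
      by (intro Sup_least) (auto simp: lorentz_length_lift T_def)
  qed
  with ab C show ?thesis
    by (simp add: longest_arc_def lift_future_directed lift_nonspacelike)
qed

text \<open>If some broken path were shorter than \<open>\<gamma>\<close>, its lift with height proportional to its arclength would not use
  up all the height available, and spending the rest increases the Lorentzian length above that of the lift of \<open>\<gamma>\<close>.\<close>

lemma shortest_arc_of_longest_lift:
  assumes C: "\<sigma> > 0" "\<sigma> \<le> C" and longest: "longest_arc (lift C) a b"
  shows "shortest_arc \<gamma> a b"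
proof (rule shortest_arcI)
  show ab: "a < b" using longest by (simp add: longest_arc_def)
  fix l assume l: "reach (adj (\<gamma> a) ** \<gamma> b) l"
  define T where "T = b - a"
  have T: "T > 0" using ab by (simp add: T_def)
  show "\<sigma> * (b - a) \<le> l"
  proof (rule ccontr)
    assume "\<not> \<sigma> * (b - a) \<le> l"
    then have less: "l < \<sigma> * T" by (simp add: T_def)
    from reach_curve[OF l det[of a]] obtain x v \<Lambda> d where B: "broken_curve x v \<Lambda> d"
      and ends: "x 0 = \<gamma> a" "x d = \<gamma> b" "\<Lambda> d = l" by (auto simp: det)
    obtain L1 L2 F where d: "d > 0" and L: "L1-lipschitz_on {0..d} x" "L2-lipschitz_on {0..d} \<Lambda>"
      and detx: "\<And>t. t \<in> {0..d} \<Longrightarrow> det (x t) = 1" and vH: "\<And>t. v t \<in> H0" and vb: "bounded (range v)"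
      and vm: "v \<in> borel_measurable borel" and l0: "\<Lambda> 0 = 0" and F: "finite F"
        "\<And>t. t \<in> {0<..<d} - F \<Longrightarrow> (x has_vector_derivative x t ** v t) (at t)"
        "\<And>t. t \<in> {0<..<d} - F \<Longrightarrow> (\<Lambda> has_real_derivative sqrt 2 * norm (v t)) (at t)"
      by (rule broken_curveE[OF B]) (rule that)
    \<comment> \<open>With slope \<open>\<alpha> = C / \<sigma>\<close> the ratio of height to arclength is that of the lift; the height that is left over, because \<open>l\<close> is too short, is spent at the additional rate \<open>\<beta>\<close>.\<close>
    define \<alpha> where "\<alpha> = C / \<sigma>"
    have \<alpha>: "\<alpha> \<ge> 1" "C = \<alpha> * \<sigma>" using C by (simp_all add: \<alpha>_def)
    define \<beta> where "\<beta> = \<alpha> * (\<sigma> * T - l) / d"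
    have \<beta>: "\<beta> > 0" "\<beta> * d = \<alpha> * (\<sigma> * T - l)" using \<alpha> less d by (simp_all add: \<beta>_def)
    define S where "S = (\<lambda>t. C * a + \<alpha> * \<Lambda> t + \<beta> * t)"
    define k where "k = (\<lambda>t. \<alpha> * (sqrt 2 * norm (v t)) + \<beta>)"
    have kpos: "k t > 0" "sqrt 2 * norm (v t) \<le> k t" for t
    proof -
      have "1 * (sqrt 2 * norm (v t)) \<le> \<alpha> * (sqrt 2 * norm (v t))"
        using \<alpha>(1) by (intro mult_right_mono) auto
      moreover have "0 \<le> sqrt 2 * norm (v t)" by simp
      ultimately show "k t > 0" "sqrt 2 * norm (v t) \<le> k t"
        using \<beta>(1) unfolding k_def by linarith+
    qed
    have Sends: "S 0 = C * a" "S d = C * b"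
      using l0 ends(3) \<beta>(2) by (simp_all add: S_def T_def \<alpha>(2) algebra_simps)
    have dS: "(S has_real_derivative k t) (at t)" if "t \<in> {0<..<d} - F" for t
      unfolding S_def k_def using F(3)[OF that] by (auto intro!: derivative_eq_intros)
    have "\<exists>L. L-lipschitz_on {0..d} S"
    proof -
      have "(0 + \<bar>\<alpha>\<bar> * L2 + \<bar>\<beta>\<bar> * 1)-lipschitz_on {0..d} S"
        unfolding S_def by (intro lipschitz_on_add lipschitz_on_cmult_real lipschitz_on_constant lipschitz_on_id L(2))
      then show ?thesis by blast
    qed
    then obtain LS where LS: "LS-lipschitz_on {0..d} S" by blast
    define G where "G = (\<lambda>t. exp (S t / 2) *\<^sub>R x t)"
    have "\<exists>LG. LG-lipschitz_on {0..d} G"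
      unfolding G_def by (rule lipschitz_scaled[OF L(1) LS]) blast
    then obtain LG where LG: "LG-lipschitz_on {0..d} G" by blast
    have cG: "control G t = k t *\<^sub>R e0 + v t" if "t \<in> {0<..<d} - F" for t
      unfolding G_def using detx that by (intro control_scaled F(2) dS that) auto
    have N: "negligible (F \<union> {0, d})"
      using F(1) by (intro negligible_finite) auto
    have hor: "horizontal_on {0..d} G"
      unfolding horizontal_on_def
    proof (intro conjI)
      show "G ` {0..d} \<subseteq> GL_plus"
        using detx by (auto simp: GL_plus_def G_def det_scaleR_cmat2 simp flip: of_real_power)
      show "lipschitzian_on {0..d} G"
        unfolding lipschitzian_on_def using lipschitz_on_subset[OF LG] by blast
      show "ae_on {0..d} (\<lambda>t. G differentiable at t \<and> control G t \<in> H)"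
      proof (rule ae_onI[OF N])
        fix t assume "t \<in> interior {0..d} - (F \<union> {0, d})"
        then have t: "t \<in> {0<..<d} - F" by auto
        have "G differentiable at t"
          unfolding G_def using lift_has_vector_derivative[OF F(2)[OF t] dS[OF t]]
          by (auto simp: differentiable_def has_vector_derivative_def)
        moreover have "k t *\<^sub>R e0 + v t \<in> H"
          using vH[of t] by (auto simp: H0_iff H_iff e0_half)
        ultimately show "G differentiable at t \<and> control G t \<in> H" by (simp add: cG[OF t])
      qed
    qed
    have pp: "pseudo_prod (control G t) (control G t) = (k t)\<^sup>2 - (sqrt 2 * norm (v t))\<^sup>2"
      "pseudo_prod (control G t) e0 = k t" if "t \<in> {0<..<d} - F" for t
      unfolding cG[OF that]
      by (simp_all add: pseudo_prod_H0[OF vH] pseudo_prod_split_e0[OF vH] power_mult_distrib)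
    have "(sqrt 2 * norm (v t))\<^sup>2 \<le> (k t)\<^sup>2" for t
      by (rule power_mono[OF kpos(2)]) simp
    then have "ae_on {0..d} (\<lambda>t. pseudo_prod (control G t) e0 > 0)"
      "ae_on {0..d} (\<lambda>t. pseudo_prod (control G t) (control G t) \<ge> 0)"
      using pp kpos by (intro ae_onI[OF N]; simp)+
    then have fut: "future_directed_on {0..d} G" "nonspacelike_on {0..d} G"
      unfolding future_directed_on_def nonspacelike_on_def using hor by blast+
    define R where "R = (\<lambda>t. sqrt ((k t)\<^sup>2 - (sqrt 2 * norm (v t))\<^sup>2))"
    obtain K where K: "\<And>t. norm (v t) \<le> K"
      using vb unfolding bounded_iff by blast
    have Rint: "R integrable_on {0..d}"
    proof -
      have "R \<in> borel_measurable borel"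
        unfolding R_def k_def using vm by measurable
      then have "R \<in> borel_measurable (lebesgue_on {0..d})"
        by (rule borel_measurable_lebesgue_on)
      moreover have "norm (R t) \<le> \<alpha> * (sqrt 2 * K) + \<beta>" for t
      proof -
        have "0 \<le> (k t)\<^sup>2 - (sqrt 2 * norm (v t))\<^sup>2"
          using power_mono[OF kpos(2)[of t], of 2] by simp
        then have "norm (R t) = R t" by (simp add: R_def)
        also have "\<dots> \<le> sqrt ((k t)\<^sup>2)" unfolding R_def by (intro real_sqrt_le_mono) simp
        also have "\<dots> = k t" using kpos(1)[of t] by simp
        also have "\<dots> \<le> \<alpha> * (sqrt 2 * K) + \<beta>"
          unfolding k_def using K[of t] \<alpha>(1) by (intro add_right_mono mult_left_mono) auto
        finally show ?thesis .
      qed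
      ultimately show ?thesis
        by (rule measurable_bounded_by_integrable_imp_integrable[OF _ integrable_const_ivl]) simp
    qed
    have len: "lorentz_length G 0 d = integral {0..d} R"
      unfolding lorentz_length_def R_def by (rule integral_spike[OF N]) (use pp in auto)
    define A where "A = sqrt (\<alpha>\<^sup>2 - 1)"
    have \<alpha>2: "\<alpha>\<^sup>2 \<ge> 1" using \<alpha>(1) by (simp add: one_le_power)
    have A: "A \<ge> 0" "A\<^sup>2 = \<alpha>\<^sup>2 - 1" "A < \<alpha>"
    proof -
      show "A \<ge> 0" "A\<^sup>2 = \<alpha>\<^sup>2 - 1" using \<alpha>2 by (simp_all add: A_def)
      have "A < sqrt (\<alpha>\<^sup>2)" unfolding A_def by (rule real_sqrt_less_mono) simp
      then show "A < \<alpha>" using \<alpha>(1) by simp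
    qed
    have lower: "A * (sqrt 2 * norm (v t)) + \<beta> \<le> R t" for t
    proof -
      define b where "b = sqrt 2 * norm (v t)"
      have "b \<ge> 0" by (simp add: b_def)
      have "(A * b + \<beta>)\<^sup>2 = A\<^sup>2 * b\<^sup>2 + 2 * (\<beta> * b) * A + \<beta>\<^sup>2"
        by (simp add: power2_eq_square algebra_simps)
      also have "\<dots> \<le> A\<^sup>2 * b\<^sup>2 + 2 * (\<beta> * b) * \<alpha> + \<beta>\<^sup>2"
        using \<beta>(1) \<open>b \<ge> 0\<close> A(3) by (intro add_mono mult_left_mono order_refl) auto
      also have "\<dots> = (\<alpha> * b + \<beta>)\<^sup>2 - b\<^sup>2"
        unfolding A(2) by (simp add: power2_eq_square algebra_simps)
      finally show ?thesis
        unfolding R_def k_def b_def[symmetric] by (rule real_le_rsqrt)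
    qed
    have "((\<lambda>t. A * (sqrt 2 * norm (v t)) + \<beta>) has_integral A * l + \<beta> * d) {0..d}"
    proof -
      have "((\<lambda>t. sqrt 2 * norm (v t)) has_integral l) {0..d}"
        using broken_curve_length(1)[OF B] by (simp add: ends)
      from has_integral_add[OF has_integral_mult_right[OF this, of A] has_integral_const_real[of \<beta> 0 d]]
      show ?thesis using d by (simp add: mult.commute)
    qed
    from has_integral_le[OF this integrable_integral[OF Rint]] lower
    have "A * l + \<beta> * d \<le> lorentz_length G 0 d" by (simp add: len)
    moreover have "ereal (lorentz_length G 0 d) \<le> lorentz_dist (lift C a) (lift C b)"
    proof -
      have "G 0 = lift C a" "G d = lift C b"
        by (simp_all add: G_def lift_def Sends ends)
      then show ?thesis using lorentz_length_le_dist[OF d fut] by simp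
    qed
    moreover have "lorentz_dist (lift C a) (lift C b) = ereal (sqrt (C\<^sup>2 - \<sigma>\<^sup>2) * T)"
      using longest ab lorentz_length_lift[of a b C] by (simp add: longest_arc_def T_def)
    ultimately have "A * l + \<beta> * d \<le> sqrt (C\<^sup>2 - \<sigma>\<^sup>2) * T" by simp
    also have "sqrt (C\<^sup>2 - \<sigma>\<^sup>2) = A * \<sigma>"
    proof -
      have "C\<^sup>2 - \<sigma>\<^sup>2 = (\<alpha>\<^sup>2 - 1) * \<sigma>\<^sup>2" by (simp add: \<alpha>(2) power_mult_distrib algebra_simps)
      then show ?thesis using C(1) by (simp add: A_def real_sqrt_mult)
    qed
    finally have "(\<alpha> - A) * (\<sigma> * T - l) \<le> 0"
      unfolding \<beta>(2) by (simp add: algebra_simps)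
    moreover have "(\<alpha> - A) * (\<sigma> * T - l) > 0"
      using A(3) less by (intro mult_pos_pos) auto
    ultimately show False by simp
  qed
qed

end

section \<open>The momentum of an extremal\<close>

lemma ae_on_UNIV_E:
  assumes "ae_on UNIV P"
  obtains N where "negligible N" "\<And>t. t \<notin> N \<Longrightarrow> P t"
proof -
  obtain N where "negligible N" "\<And>t. t \<in> interior UNIV \<Longrightarrow> t \<notin> N \<Longrightarrow> P t"
    by (rule ae_onE[OF assms]) (rule that)
  then show thesis using that by simp
qed

lemma AC_zero_deriv_const:
  fixes F :: "real \<Rightarrow> 'a::banach"
  assumes ac: "\<And>a b. AC_on a b F" and N: "negligible N"
    and deriv: "\<And>t. t \<notin> N \<Longrightarrow> (F has_vector_derivative 0) (at t)"
  shows "F t = F 0"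
proof -
  have *: "F b = F a" if "a \<le> b" for a b
  proof -
    have "((\<lambda>_. 0) has_integral (F b - F a)) {a..b}"
      by (rule AC_FTC[OF that ac N]) (auto intro: has_vector_derivative_at_within deriv)
    then show ?thesis by simp
  qed
  show ?thesis
    using *[of 0 t] *[of t 0] by (cases "t \<ge> 0") auto
qed

lemma AC_on_sum:
  assumes "\<And>i. i \<in> I \<Longrightarrow> AC_on a b (f i)"
  shows "AC_on a b (\<lambda>t. \<Sum>i\<in>I. f i t)"
  using assms by (induction I rule: infinite_finite_induct) (auto intro: AC_on_const AC_on_add)

lemma lipschitzian_AC: "lipschitzian_on UNIV g \<Longrightarrow> AC_on a b g"
  unfolding lipschitzian_on_def using lipschitz_imp_AC by blast

lemma AC_on_exp: "AC_on a b (\<lambda>t. exp (c * t) :: real)"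
proof -
  have "((\<lambda>t. exp (c * t)) has_vector_derivative c * exp (c * t)) (at t within {a..b})" for t
    unfolding has_real_derivative_iff_has_vector_derivative[symmetric]
    by (auto intro!: derivative_eq_intros)
  moreover have "continuous_on {a..b} (\<lambda>t. c * exp (c * t))"
    by (intro continuous_intros)
  ultimately obtain L where "L-lipschitz_on {a..b} (\<lambda>t. exp (c * t))"
    by (rule continuous_derivative_imp_lipschitz) (rule that)
  then show ?thesis by (rule lipschitz_imp_AC)
qed

lemma cmat2_entry_linear: "bounded_linear (\<lambda>A::cmat2. A $ i $ j)"
  by (intro bounded_linear_compose[OF bounded_linear_vec_nth bounded_linear_vec_nth])

lemma gl_plus_iff: "w \<in> gl_plus \<longleftrightarrow> Im (trace w) = 0"
  by (simp add: gl_plus_def complex_is_Real_iff)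

lemma gl_dual_zero: "gl_dual \<phi> \<Longrightarrow> \<phi> 0 = 0"
  unfolding gl_dual_def by (metis (no_types) gl_plus_iff mult_zero_left scaleR_zero_left trace_0 zero_complex.sel(2))

lemma basis_e_gl_plus: "k \<in> {0..6} \<Longrightarrow> basis_e k \<in> gl_plus"
  unfolding gl_plus_eq_span by (intro span_base imageI)

lemma subspace_gl_plus: "subspace gl_plus"
  unfolding gl_plus_eq_span by simp

lemma gl_dual_sum:
  assumes "gl_dual \<phi>" "finite I" "\<And>i. i \<in> I \<Longrightarrow> b i \<in> gl_plus"
  shows "\<phi> (\<Sum>i\<in>I. r i *\<^sub>R b i) = (\<Sum>i\<in>I. r i * \<phi> (b i))"
  using assms(2,3)
proof (induction I rule: finite_induct)
  case empty
  then show ?case using gl_dual_zero[OF assms(1)] by simp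
next
  case (insert i I)
  have m: "r i *\<^sub>R b i \<in> gl_plus" "(\<Sum>i\<in>I. r i *\<^sub>R b i) \<in> gl_plus"
    using insert.prems
    by (auto intro!: subspace_scale[OF subspace_gl_plus] subspace_sum[OF subspace_gl_plus])
  have "\<phi> (r i *\<^sub>R b i + (\<Sum>i\<in>I. r i *\<^sub>R b i)) = \<phi> (r i *\<^sub>R b i) + \<phi> (\<Sum>i\<in>I. r i *\<^sub>R b i)"
    using assms(1) m unfolding gl_dual_def by blast
  also have "\<phi> (r i *\<^sub>R b i) = r i * \<phi> (b i)"
    using assms(1) insert.prems unfolding gl_dual_def by blast
  finally show ?case using insert by simp
qed

lemma gl_dual_expand:
  assumes "gl_dual \<phi>" "w \<in> gl_plus"
  shows "\<phi> w = (\<Sum>k=0..6. coord k w * \<phi> (basis_e k))"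
proof -
  have "\<phi> w = \<phi> (\<Sum>k=0..6. coord k w *\<^sub>R basis_e k)"
    by (subst coord_expansion[OF assms(2), symmetric]) (rule refl)
  also have "\<dots> = (\<Sum>k=0..6. coord k w * \<phi> (basis_e k))"
    by (rule gl_dual_sum[OF assms(1)]) (auto intro: basis_e_gl_plus)
  finally show ?thesis .
qed

text \<open>Nondegeneracy of the invariant form; the entries of \<open>X\<close> are found by comparing coefficients in the basis.\<close>

lemma gl_dual_representation:
  assumes "gl_dual \<phi>"
  obtains X :: cmat2 where "\<And>w. trace w = 0 \<Longrightarrow> \<phi> w = Re (trace (X ** w))"
proof -
  define q where "q k = \<phi> (basis_e k)" for k
  define X where "X = mat2 (Complex (q 3) (- q 6)) (Complex (q 1 + q 5) (q 2 - q 4))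
    (Complex (q 1 - q 5) (- q 2 - q 4)) (- Complex (q 3) (- q 6))"
  have "\<phi> w = Re (trace (X ** w))" if "trace w = 0" for w
  proof -
    have w: "Re (w$2$2) = - Re (w$1$1)" "Im (w$2$2) = - Im (w$1$1)"
      using that by (auto simp: trace_cmat2 complex_eq_iff add_eq_0_iff)
    have "\<phi> w = (\<Sum>k=0..6. coord k w * q k)"
      unfolding q_def using that by (intro gl_dual_expand[OF assms]) (simp add: gl_plus_iff)
    also have "\<dots> = Re (trace (X ** w))"
      unfolding set_upto6 coord_def
      by (simp add: inner_cmat2 basis_e_entries[simplified] trace_cmat2 cmat2_mult_nth X_def w)
        (simp add: algebra_simps)
    finally show ?thesis .
  qed
  then show thesis by (rule that)
qed

lemma coord_linear: "bounded_linear (coord k)"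
  unfolding coord_def by (intro bounded_linear_const_mult bounded_linear_inner_left)

lemma lie_bracket_linear: "bounded_linear (lie_bracket c)"
  unfolding lie_bracket_def
  by (intro bounded_linear_sub cmult.bounded_linear_right cmult.bounded_linear_left)

lemma trace_lie_bracket: "trace (lie_bracket u w) = 0"
  by (simp add: lie_bracket_def trace_cmat2 cmat2_mult_nth algebra_simps)

text \<open>The adjoint equation says that the covector is constant in the right trivialization: along
  \<open>Z = \<gamma>\<^sup>-\<^sup>1 v \<gamma>\<close>, for which \<open>Z' = - [u, Z]\<close>, the two contributions to the derivative of
  \<open>\<psi>(Z)\<close> cancel.\<close>

lemma adjoint_transport:
  fixes \<gamma> :: "real \<Rightarrow> cmat2"
  assumes dual: "\<And>t. gl_dual (\<psi> t)" and ac: "abs_continuous_covector \<psi>"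
    and \<gamma>ac: "\<And>a b. AC_on a b \<gamma>" and \<gamma>det: "\<And>t. det (\<gamma> t) = 1" and \<gamma>0: "\<gamma> 0 = mat 1"
    and N: "negligible N"
    and d\<gamma>: "\<And>t. t \<notin> N \<Longrightarrow> (\<gamma> has_vector_derivative \<gamma> t ** w t) (at t) \<and> w t \<in> H0"
    and d\<psi>: "\<And>t v. t \<notin> N \<Longrightarrow> v \<in> gl_plus \<Longrightarrow>
       ((\<lambda>s. \<psi> s v) has_real_derivative \<psi> t (lie_bracket (r t *\<^sub>R e0 + w t) v)) (at t)"
    and v: "trace v = 0"
  shows "\<psi> t (adj (\<gamma> t) ** v ** \<gamma> t) = \<psi> 0 v"
proof -
  define Z where "Z t = adj (\<gamma> t) ** v ** \<gamma> t" for t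
  have trZ: "trace (Z t) = 0" for t
    using trace_cycle[of "adj (\<gamma> t)" "v ** \<gamma> t"] \<gamma>det[of t] v
    by (simp add: Z_def matrix_mul_assoc[symmetric]) (simp add: matrix_mul_assoc)
  have Zgl: "Z t \<in> gl_plus" for t by (simp add: gl_plus_iff trZ)
  have acZ: "AC_on a b Z" for a b
    unfolding Z_def[abs_def]
    by (intro AC_on_bilinear[OF bounded_bilinear_cmat2_mult] AC_on_linear[OF bounded_linear_adj] AC_on_const \<gamma>ac)
  define F where "F t = (\<Sum>k=0..6. coord k (Z t) * \<psi> t (basis_e k))" for t
  have F: "F t = \<psi> t (Z t)" for t
    unfolding F_def by (rule gl_dual_expand[OF dual Zgl, symmetric])
  have "F t = F 0"
  proof (rule AC_zero_deriv_const[OF _ N])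
    show "AC_on a b F" for a b
      unfolding F_def[abs_def]
    proof (rule AC_on_sum, rule AC_on_bilinear[OF bounded_bilinear_mult])
      fix k :: nat assume "k \<in> {0..6}"
      show "AC_on a b (\<lambda>t. coord k (Z t))" by (rule AC_on_linear[OF coord_linear acZ])
      show "AC_on a b (\<lambda>t. \<psi> t (basis_e k))"
        using ac basis_e_gl_plus[OF \<open>k \<in> {0..6}\<close>] unfolding AC_on_real abs_continuous_covector_def by blast
    qed
    fix t assume t: "t \<notin> N"
    define c where "c = r t *\<^sub>R e0 + w t"
    have "((\<lambda>t. adj (\<gamma> t)) has_vector_derivative - (w t ** adj (\<gamma> t))) (at t)"
      using bounded_linear.has_vector_derivative[OF bounded_linear_adj conjunct1[OF d\<gamma>[OF t]]]
        adj_trace0[OF H0_trace[OF conjunct2[OF d\<gamma>[OF t]]]]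
      by (simp add: adj_mult cmult.minus_left)
    note dZ = cmult.has_vector_derivative[OF cmult.has_vector_derivative[OF this has_vector_derivative_const[of v]]
        conjunct1[OF d\<gamma>[OF t]]]
    have "adj (\<gamma> t) ** v ** (\<gamma> t ** w t) + (adj (\<gamma> t) ** 0 + - (w t ** adj (\<gamma> t)) ** v) ** \<gamma> t
        = - lie_bracket c (Z t)"
      by (simp add: Z_def lie_bracket_def c_def e0_half cmult.add_left cmult.add_right cmult.minus_left cmult.zero_right
          cmult.scaleR_left cmult.scaleR_right matrix_mul_assoc)
    with dZ have dZ: "(Z has_vector_derivative - lie_bracket c (Z t)) (at t)"
      by (simp add: Z_def[abs_def])
    have "((\<lambda>t. coord k (Z t) * \<psi> t (basis_e k)) has_vector_derivative
        coord k (Z t) * \<psi> t (lie_bracket c (basis_e k)) + coord k (- lie_bracket c (Z t)) * \<psi> t (basis_e k)) (at t)"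
      if "k \<in> {0..6}" for k
      using bounded_linear.has_vector_derivative[OF coord_linear dZ, of k] d\<psi>[OF t basis_e_gl_plus[OF that]]
      unfolding c_def by (intro has_vector_derivative_mult)
        (auto simp: has_real_derivative_iff_has_vector_derivative)
    then have "(F has_vector_derivative (\<Sum>k=0..6. coord k (Z t) * \<psi> t (lie_bracket c (basis_e k))
        + coord k (- lie_bracket c (Z t)) * \<psi> t (basis_e k))) (at t)"
      unfolding F_def[abs_def] by (rule has_vector_derivative_sum)
    also have "(\<Sum>k=0..6. coord k (Z t) * \<psi> t (lie_bracket c (basis_e k))
        + coord k (- lie_bracket c (Z t)) * \<psi> t (basis_e k)) = 0"
    proof -
      have "(\<Sum>k=0..6. coord k (Z t) * \<psi> t (lie_bracket c (basis_e k)))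
          = \<psi> t (\<Sum>k=0..6. coord k (Z t) *\<^sub>R lie_bracket c (basis_e k))"
        by (rule gl_dual_sum[OF dual, symmetric]) (auto simp: gl_plus_iff trace_lie_bracket)
      also have "(\<Sum>k=0..6. coord k (Z t) *\<^sub>R lie_bracket c (basis_e k)) = lie_bracket c (\<Sum>k=0..6. coord k (Z t) *\<^sub>R basis_e k)"
        using lie_bracket_linear[of c]
        by (simp add: bounded_linear.linear linear_sum linear_scale)
      also have "\<dots> = lie_bracket c (Z t)"
        by (subst coord_expansion[OF Zgl, symmetric]) (rule refl)
      finally have 1: "(\<Sum>k=0..6. coord k (Z t) * \<psi> t (lie_bracket c (basis_e k))) = \<psi> t (lie_bracket c (Z t))" .
      have "(\<Sum>k=0..6. coord k (- lie_bracket c (Z t)) * \<psi> t (basis_e k)) = - (\<Sum>k=0..6. coord k (lie_bracket c (Z t)) * \<psi> t (basis_e k))"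
        by (simp add: coord_def sum_negf)
      also have "\<dots> = - \<psi> t (lie_bracket c (Z t))"
        by (subst gl_dual_expand[OF dual, of "lie_bracket c (Z t)"]) (simp_all add: gl_plus_iff trace_lie_bracket)
      finally show ?thesis using 1 by (simp add: sum.distrib)
    qed
    finally show "(F has_vector_derivative 0) (at t)" .
  qed
  moreover have "Z 0 = v"
    by (simp add: Z_def \<gamma>0 adj_mult_self[of "mat 1", simplified] cmat2_eq_iff cmat2_mult_nth adj_def)
  ultimately show ?thesis by (simp add: F Z_def)
qed

text \<open>Both kinds of extremals meet these hypotheses: the minimum condition determines \<open>\<psi>\<close> on \<open>H0\<close> as a
  multiple of the control. Since \<open>\<psi>\<close> is a transported constant, the control is a function of the
  position, and the curve is the lift of a sub-Riemannian extremal of constant speed.\<close>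

lemma extremal_structure:
  fixes g :: "real \<Rightarrow> cmat2"
  assumes g0: "g 0 = mat 1" and hor: "horizontal_on UNIV g"
    and dual: "\<And>t. gl_dual (\<psi> t)" and ac: "abs_continuous_covector \<psi>" and adjeq: "adjoint_equation g \<psi>"
    and M: "M > 0" and "\<sigma> \<ge> 0"
    and ae: "ae_on UNIV (\<lambda>t. (\<forall>w\<in>H0. \<psi> t w = - 2 * M * (control g t \<bullet> w)) \<and>
       Re (trace (control g t)) = C \<and> 2 * (norm (control g t - C *\<^sub>R e0))\<^sup>2 = \<sigma>\<^sup>2)"
  obtains \<gamma> u X where "SL_extremal \<gamma> u \<sigma> X" "\<gamma> 0 = mat 1" "\<And>t. g t = exp (C * t / 2) *\<^sub>R \<gamma> t"
proof -
  have ae2: "ae_on UNIV (\<lambda>t. g differentiable (at t) \<and> control g t \<in> H)"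
    and GL: "\<And>t. g t \<in> GL_plus" and lip: "lipschitzian_on UNIV g"
    using hor by (auto simp: horizontal_on_def)
  obtain N1 where N1: "negligible N1" "\<And>t. t \<notin> N1 \<Longrightarrow> (\<forall>w\<in>H0. \<psi> t w = - 2 * M * (control g t \<bullet> w)) \<and>
       Re (trace (control g t)) = C \<and> 2 * (norm (control g t - C *\<^sub>R e0))\<^sup>2 = \<sigma>\<^sup>2"
    by (rule ae_on_UNIV_E[OF ae]) (rule that)
  obtain N2 where N2: "negligible N2" "\<And>t. t \<notin> N2 \<Longrightarrow> g differentiable (at t) \<and> control g t \<in> H"
    by (rule ae_on_UNIV_E[OF ae2]) (rule that)
  obtain N3 where N3: "negligible N3" "\<And>t. t \<notin> N3 \<Longrightarrow> \<forall>w\<in>gl_plus.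
       ((\<lambda>s. \<psi> s w) has_real_derivative \<psi> t (lie_bracket (control g t) w)) (at t)"
    by (rule ae_on_UNIV_E[OF adjeq[unfolded adjoint_equation_def]]) (rule that)
  define N where "N = N1 \<union> N2 \<union> N3"
  have N: "negligible N" using N1 N2 N3 by (simp add: N_def negligible_Un)
  define w where "w t = control g t - C *\<^sub>R e0" for t
  have acg: "AC_on a b g" for a b by (rule lipschitzian_AC[OF lip])
  have dg: "(g has_vector_derivative g t ** control g t) (at t)" if "t \<notin> N" for t
    using N2(2)[of t] GL that by (intro control_has_vector_derivative) (auto simp: N_def)
  have wH: "w t \<in> H0" and trc: "trace (control g t) = of_real C" if "t \<notin> N" for t
  proof -
    have "control g t \<in> H" "Re (trace (control g t)) = C"
      using N1(2)[of t] N2(2)[of t] that by (auto simp: N_def)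
    then show "w t \<in> H0" "trace (control g t) = of_real C"
      using H_decomp[of "control g t"] trace_H[of "control g t"] by (auto simp: w_def)
  qed

  \<comment> \<open>Liouville: the determinant grows at the rate given by the trace of the control.\<close>
  have detg: "det (g t) = of_real (exp (C * t))" for t
  proof -
    have "exp (- C * t) *\<^sub>R det (g t) = exp (- C * 0) *\<^sub>R det (g 0)"
    proof (rule AC_zero_deriv_const[OF _ N])
      have "AC_on a b (\<lambda>t. (g t ** adj (g t)) $ 1 $ 1)" for a b
        by (intro AC_on_linear[OF cmat2_entry_linear] AC_on_bilinear[OF bounded_bilinear_cmat2_mult]
            AC_on_linear[OF bounded_linear_adj] acg)
      then have "AC_on a b (\<lambda>t. det (g t))" for a b
        by (simp add: det_cmat2 cmat2_mult_nth adj_def)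
      then show "AC_on a b (\<lambda>t. exp (- C * t) *\<^sub>R det (g t))" for a b
        by (intro AC_on_bilinear[OF bounded_bilinear_scaleR] AC_on_exp)
      fix t assume t: "t \<notin> N"
      have "((\<lambda>t. exp (- C * t)) has_real_derivative - C * exp (- C * t)) (at t)"
        by (auto intro!: derivative_eq_intros)
      from has_vector_derivative_scaleR[OF this det_has_vector_derivative[OF dg[OF t]]]
      show "((\<lambda>t. exp (- C * t) *\<^sub>R det (g t)) has_vector_derivative 0) (at t)"
        by (simp add: trc[OF t] scaleR_conv_of_real)
    qed
    then have "exp (- C * t) *\<^sub>R det (g t) = 1" by (simp add: g0)
    moreover have "exp (C * t) * exp (- C * t) = 1" by (simp flip: exp_add)
    then have "det (g t) = exp (C * t) *\<^sub>R (exp (- C * t) *\<^sub>R det (g t))"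
      by (simp only: scaleR_scaleR scaleR_one)
    ultimately show ?thesis by (simp add: scaleR_conv_of_real)
  qed
  define \<gamma> where "\<gamma> t = exp (- C * t / 2) *\<^sub>R g t" for t
  have g: "g t = exp (C * t / 2) *\<^sub>R \<gamma> t" for t
    by (simp add: \<gamma>_def flip: exp_add)
  have \<gamma>0: "\<gamma> 0 = mat 1" by (simp add: \<gamma>_def g0)
  have \<gamma>det: "det (\<gamma> t) = 1" for t
  proof -
    have "(exp (- C * t / 2))\<^sup>2 * exp (C * t) = (1::real)"
      by (simp only: exp_double[symmetric] exp_add[symmetric]) simp
    then show ?thesis
      unfolding \<gamma>_def det_scaleR_cmat2 detg of_real_mult[symmetric] by (simp only: of_real_1)
  qed
  have \<gamma>ac: "AC_on a b \<gamma>" for a b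
    using AC_on_bilinear[OF bounded_bilinear_scaleR AC_on_exp[of a b "- C / 2"] acg[of a b]]
    by (simp add: \<gamma>_def[abs_def] mult.commute)
  have d\<gamma>: "(\<gamma> has_vector_derivative \<gamma> t ** w t) (at t) \<and> w t \<in> H0" if "t \<notin> N" for t
  proof -
    have "((\<lambda>t. - C * t) has_real_derivative - C) (at t)"
      by (auto intro!: derivative_eq_intros)
    from lift_has_vector_derivative[OF dg[OF that] this] wH[OF that] show ?thesis
      by (simp add: \<gamma>_def[abs_def] w_def)
  qed

  \<comment> \<open>\<open>X\<close> is the constant momentum in the right trivialization, normalized so that the control is its Hermitian part, transported back.\<close>
  have "gl_dual (\<lambda>v. \<psi> 0 v / (- 2 * M))"
    using dual[of 0] by (simp add: gl_dual_def diff_divide_distrib add_divide_distrib)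
  then obtain X where X: "\<And>v. trace v = 0 \<Longrightarrow> \<psi> 0 v / (- 2 * M) = Re (trace (X ** v))"
    by (rule gl_dual_representation) (rule that)
  define u where "u t = prH0 (adj (\<gamma> t) ** X ** \<gamma> t)" for t
  have wu: "w t = u t" if t: "t \<notin> N" for t
    unfolding u_def
  proof (rule prH0_unique[OF wH[OF t]])
    fix v assume v: "v \<in> H0"
    have c: "control g t = C *\<^sub>R e0 + w t" by (simp add: w_def)
    have "e0 \<bullet> v = 0" using v by (simp add: H0_iff inner_cmat2 e0_def)
    then have "\<psi> t v = - 2 * M * (w t \<bullet> v)"
      using N1(2)[of t] t v by (simp add: N_def c inner_add_left)
    moreover have "\<psi> t v = \<psi> 0 (\<gamma> t ** v ** adj (\<gamma> t))"
    proof -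
      have tr: "trace (\<gamma> t ** v ** adj (\<gamma> t)) = 0"
        using trace_cycle[of "\<gamma> t ** v" "adj (\<gamma> t)"] H0_trace[OF v] \<gamma>det[of t] by simp
      have d\<psi>: "((\<lambda>s. \<psi> s v) has_real_derivative \<psi> t (lie_bracket (C *\<^sub>R e0 + w t) v)) (at t)"
        if "t \<notin> N" "v \<in> gl_plus" for t v
        using N3(2)[of t] that by (simp add: N_def w_def)
      have "\<psi> t (adj (\<gamma> t) ** (\<gamma> t ** v ** adj (\<gamma> t)) ** \<gamma> t) = \<psi> 0 (\<gamma> t ** v ** adj (\<gamma> t))"
        by (rule adjoint_transport[OF dual ac \<gamma>ac \<gamma>det \<gamma>0 N d\<gamma> d\<psi> tr])
      moreover have "adj (\<gamma> t) ** (\<gamma> t ** v ** adj (\<gamma> t)) ** \<gamma> t = v"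
        using \<gamma>det[of t] by (simp flip: matrix_mul_assoc add: adj_mult_self)
      ultimately show ?thesis by simp
    qed
    moreover have "\<psi> 0 (\<gamma> t ** v ** adj (\<gamma> t)) / (- 2 * M) = (adj (\<gamma> t) ** X ** \<gamma> t) \<bullet> v"
    proof -
      have tr: "trace (\<gamma> t ** v ** adj (\<gamma> t)) = 0"
        using trace_cycle[of "\<gamma> t ** v" "adj (\<gamma> t)"] H0_trace[OF v] \<gamma>det[of t] by simp
      have "\<psi> 0 (\<gamma> t ** v ** adj (\<gamma> t)) / (- 2 * M) = Re (trace (X ** (\<gamma> t ** v ** adj (\<gamma> t))))"
        by (rule X[OF tr])
      also have "\<dots> = Re (trace ((adj (\<gamma> t) ** X ** \<gamma> t) ** v))"
        by (simp add: matrix_mul_assoc trace_cycle[of "X ** \<gamma> t ** v" "adj (\<gamma> t)"])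
      also have "\<dots> = (adj (\<gamma> t) ** X ** \<gamma> t) \<bullet> v" by (rule Re_trace_H0[OF v])
      finally show ?thesis .
    qed
    ultimately show "w t \<bullet> v = (adj (\<gamma> t) ** X ** \<gamma> t) \<bullet> v"
      using M by simp
  qed

  \<comment> \<open>The control agrees almost everywhere with the continuous \<open>u\<close>, so \<open>\<gamma>\<close> is \<open>C\<^sup>1\<close> and all relations hold everywhere.\<close>
  have c\<gamma>: "continuous_on UNIV \<gamma>"
  proof -
    have "continuous_on (\<Union>n::nat. {- real n<..<real n}) \<gamma>"
    proof (rule continuous_on_open_UN)
      show "continuous_on {- real n<..<real n} \<gamma>" for n
        by (rule continuous_on_subset[OF AC_on_continuous[OF \<gamma>ac, of "- real n" "real n"]]) auto
    qed auto
    moreover have "(\<Union>n::nat. {- real n<..<real n}) = UNIV"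
    proof -
      have "\<exists>n::nat. \<bar>x\<bar> < real n" for x by (rule reals_Archimedean2)
      then show ?thesis by (auto simp: abs_less_iff) (metis minus_less_iff)
    qed
    ultimately show ?thesis by simp
  qed
  have cu: "continuous_on UNIV u"
    unfolding u_def[abs_def]
    by (intro bounded_linear.continuous_on[OF bounded_linear_prH0] cmult.continuous_on
        bounded_linear.continuous_on[OF bounded_linear_adj] c\<gamma> continuous_on_const)
  have du: "(\<gamma> has_vector_derivative \<gamma> t ** u t) (at t)" for t
  proof -
    have ftc: "((\<lambda>t. \<gamma> t ** u t) has_integral (\<gamma> b - \<gamma> a)) {a..b}" if "a \<le> b" for a b
    proof (rule AC_FTC[OF that \<gamma>ac N])
      fix x assume "x \<in> {a..b} - N"
      then show "(\<gamma> has_vector_derivative \<gamma> x ** u x) (at x within {a..b})"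
        using d\<gamma>[of x] wu[of x] by (auto intro: has_vector_derivative_at_within)
    qed
    have "continuous_on {t - 1..t + 1} (\<lambda>t. \<gamma> t ** u t)"
      by (intro cmult.continuous_on continuous_on_subset[OF c\<gamma>] continuous_on_subset[OF cu]) auto
    from integral_has_vector_derivative[OF this, of t]
    have "((\<lambda>x. integral {t - 1..x} (\<lambda>t. \<gamma> t ** u t)) has_vector_derivative \<gamma> t ** u t) (at t within {t - 1..t + 1})"
      by simp
    then have "((\<lambda>x. integral {t - 1..x} (\<lambda>t. \<gamma> t ** u t)) has_vector_derivative \<gamma> t ** u t) (at t)"
      by (simp add: at_within_Icc_at)
    from has_vector_derivative_add[OF has_vector_derivative_const[of "\<gamma> (t - 1)"] this]
    have "((\<lambda>x. \<gamma> (t - 1) + integral {t - 1..x} (\<lambda>t. \<gamma> t ** u t)) has_vector_derivative \<gamma> t ** u t) (at t)"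
      by simp
    then show ?thesis
    proof (rule has_vector_derivative_transform_within_open[of _ _ _ "{t - 1<..}"])
      fix y assume "y \<in> {t - 1<..}"
      then show "\<gamma> (t - 1) + integral {t - 1..y} (\<lambda>t. \<gamma> t ** u t) = \<gamma> y"
        using integral_unique[OF ftc[of "t - 1" y]] by simp
    qed auto
  qed
  have speed: "sqrt 2 * norm (u t) = \<sigma>" for t
  proof (rule ccontr)
    assume "sqrt 2 * norm (u t) \<noteq> \<sigma>"
    then have ne: "{t. sqrt 2 * norm (u t) \<noteq> \<sigma>} \<noteq> {}" by blast
    have "open {t. sqrt 2 * norm (u t) \<noteq> \<sigma>}"
      by (intro open_Collect_neq continuous_intros cu)
    moreover have "{t. sqrt 2 * norm (u t) \<noteq> \<sigma>} \<subseteq> N"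
    proof (rule subsetI, rule ccontr)
      fix t assume "t \<in> {t. sqrt 2 * norm (u t) \<noteq> \<sigma>}" and t: "t \<notin> N"
      have "2 * (norm (w t))\<^sup>2 = \<sigma>\<^sup>2"
        using N1(2)[of t] t by (simp add: N_def w_def)
      then have "(sqrt 2 * norm (u t))\<^sup>2 = \<sigma>\<^sup>2"
        by (simp add: power_mult_distrib wu[OF t])
      then have "sqrt 2 * norm (u t) = \<sigma>"
        using \<open>\<sigma> \<ge> 0\<close> by (simp add: power2_eq_iff_nonneg)
      then show False using \<open>t \<in> _\<close> by simp
    qed
    ultimately show False
      using open_not_negligible ne negligible_subset[OF N] by blast
  qed
  have "SL_extremal \<gamma> u \<sigma> X"
  proof
    show "u t \<bullet> v = (adj (\<gamma> t) ** X ** \<gamma> t) \<bullet> v" if "v \<in> H0" for v t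
      unfolding u_def by (rule inner_prH0[OF that])
  qed (use du \<gamma>det speed cu in \<open>auto simp: u_def prH0_in\<close>)
  then show thesis by (rule that[OF _ \<gamma>0 g])
qed

section \<open>The minimum condition\<close>

lemma coord_add: "coord k (u + v) = coord k u + coord k v"
  and coord_scale: "coord k (r *\<^sub>R u) = r * coord k u"
  by (simp_all add: coord_def inner_add_left algebra_simps)

lemma pseudo_prod_commute: "pseudo_prod u v = pseudo_prod v u"
  by (simp add: pseudo_prod_def mult.commute)

lemma pseudo_prod_add_left: "pseudo_prod (u + v) w = pseudo_prod u w + pseudo_prod v w"
  by (simp add: pseudo_prod_def coord_add distrib_right sum.distrib)

lemma pseudo_prod_scale_left: "pseudo_prod (r *\<^sub>R u) w = r * pseudo_prod u w"
  by (simp add: pseudo_prod_def coord_scale right_diff_distrib sum_distrib_left mult.assoc)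

lemma pseudo_prod_line:
  "pseudo_prod (u + \<tau> *\<^sub>R v) (u + \<tau> *\<^sub>R v) = pseudo_prod u u + 2 * \<tau> * pseudo_prod u v + \<tau>\<^sup>2 * pseudo_prod v v"
proof -
  have r: "pseudo_prod w (u + \<tau> *\<^sub>R v) = pseudo_prod w u + \<tau> * pseudo_prod w v" for w
    using pseudo_prod_add_left[of u "\<tau> *\<^sub>R v" w] pseudo_prod_scale_left[of \<tau> v w]
    by (simp add: pseudo_prod_commute)
  show ?thesis
    by (simp add: pseudo_prod_add_left pseudo_prod_scale_left r pseudo_prod_commute[of v u] power2_eq_square algebra_simps)
qed

lemma H_gl_plus: "H \<subseteq> gl_plus"
  by (auto simp: H_iff gl_plus_iff trace_cmat2)

lemma subspace_H: "subspace H"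
  by (simp add: H_def)

lemma H0_H: "H0 \<subseteq> H"
  by (auto simp: H0_iff H_iff)

lemma e0_H: "e0 \<in> H"
  by (simp add: H_iff e0_def)

lemma gl_dual_line:
  assumes "gl_dual \<phi>" "u \<in> H" "v \<in> H"
  shows "\<phi> (r *\<^sub>R (u + \<tau> *\<^sub>R v)) = r * (\<phi> u + \<tau> * \<phi> v)"
proof -
  have gl: "u \<in> gl_plus" "v \<in> gl_plus" using assms H_gl_plus by auto
  then have "\<tau> *\<^sub>R v \<in> gl_plus" "u + \<tau> *\<^sub>R v \<in> gl_plus"
    by (auto intro!: subspace_scale[OF subspace_gl_plus] subspace_add[OF subspace_gl_plus])
  with gl assms(1) show ?thesis unfolding gl_dual_def by simp
qed

text \<open>Both sides agree at \<open>0\<close>, so their derivatives at the interior minimum of the difference do, too. This is the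
  Lagrange multiplier rule for quadratic constraints: a perturbed point is scaled back to the constraint by
  the square root of its norm.\<close>

lemma first_order_sqrt:
  fixes p q r M A :: real
  assumes ev: "\<forall>\<^sub>F \<tau> in nhds 0. M * sqrt (1 + 2 * \<tau> * q + \<tau>\<^sup>2 * r) \<le> M + \<tau> * p"
  shows "p = M * q"
proof -
  define f where "f \<tau> = M + \<tau> * p - M * sqrt (1 + 2 * \<tau> * q + \<tau>\<^sup>2 * r)" for \<tau>
  have "(f has_real_derivative p - M * q) (at 0)"
    unfolding f_def by (auto intro!: derivative_eq_intros)
  moreover obtain d where d: "d > 0" "\<And>\<tau>. dist \<tau> 0 < d \<Longrightarrow> M * sqrt (1 + 2 * \<tau> * q + \<tau>\<^sup>2 * r) \<le> M + \<tau> * p"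
    using ev unfolding eventually_nhds_metric by blast
  moreover have "\<forall>\<tau>. \<bar>0 - \<tau>\<bar> < d \<longrightarrow> f 0 \<le> f \<tau>"
    using d(2) by (auto simp: f_def dist_real_def)
  ultimately have "p - M * q = 0"
    by (intro DERIV_local_min[where f = f and x = 0 and d = d])
  then show ?thesis by simp
qed

lemma eventually_nhds_pos:
  fixes f :: "real \<Rightarrow> real"
  assumes "isCont f a" "f a > 0"
  shows "\<forall>\<^sub>F x in nhds a. f x > 0"
  using order_tendstoD(1)[OF assms(1)[unfolded isCont_def tendsto_at_iff_tendsto_nhds] assms(2)] .

lemma timelike_minimum:
  assumes \<phi>: "gl_dual \<phi>" and u: "u \<in> H" "pseudo_prod u u = 1" "pseudo_prod u e0 > 0"
    and min: "is_arg_min \<phi> (\<lambda>v. v \<in> U) u" "\<phi> u = M" and v: "v \<in> H"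
  shows "\<phi> v = M * pseudo_prod u v"
proof (rule first_order_sqrt)
  define s where "s \<tau> = 1 + 2 * \<tau> * pseudo_prod u v + \<tau>\<^sup>2 * pseudo_prod v v" for \<tau>
  have "\<forall>\<^sub>F \<tau> in nhds 0. s \<tau> > 0 \<and> pseudo_prod u e0 + \<tau> * pseudo_prod v e0 > 0"
  proof (rule eventually_conj)
    have "isCont s 0" unfolding s_def by (intro continuous_intros)
    then show "\<forall>\<^sub>F \<tau> in nhds 0. s \<tau> > 0"
      by (rule eventually_nhds_pos) (simp add: s_def)
    have "isCont (\<lambda>\<tau>. pseudo_prod u e0 + \<tau> * pseudo_prod v e0) 0" by (intro continuous_intros)
    then show "\<forall>\<^sub>F \<tau> in nhds 0. pseudo_prod u e0 + \<tau> * pseudo_prod v e0 > 0"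
      by (rule eventually_nhds_pos) (simp add: u(3))
  qed
  then show "\<forall>\<^sub>F \<tau> in nhds 0. M * sqrt (1 + 2 * \<tau> * pseudo_prod u v + \<tau>\<^sup>2 * pseudo_prod v v) \<le> M + \<tau> * \<phi> v"
  proof eventually_elim
    case (elim \<tau>)
    define x where "x = (1 / sqrt (s \<tau>)) *\<^sub>R (u + \<tau> *\<^sub>R v)"
    have "x \<in> H"
      unfolding x_def using u(1) v by (intro subspace_scale[OF subspace_H] subspace_add[OF subspace_H])
    moreover have "pseudo_prod x x = 1"
    proof -
      have "pseudo_prod x x = (1 / sqrt (s \<tau>)) * ((1 / sqrt (s \<tau>)) * pseudo_prod (u + \<tau> *\<^sub>R v) (u + \<tau> *\<^sub>R v))"
        unfolding x_def pseudo_prod_scale_left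
        by (subst pseudo_prod_commute) (simp add: pseudo_prod_scale_left)
      also have "pseudo_prod (u + \<tau> *\<^sub>R v) (u + \<tau> *\<^sub>R v) = s \<tau>"
        by (simp add: pseudo_prod_line u(2) s_def)
      finally show ?thesis using elim by (simp add: field_simps)
    qed
    moreover have "pseudo_prod x e0 > 0"
      unfolding x_def pseudo_prod_scale_left pseudo_prod_add_left using elim by simp
    ultimately have "x \<in> U" by (simp add: U_def)
    then have "M \<le> \<phi> x"
      using min by (auto simp: is_arg_min_def not_less)
    also have "\<phi> x = (1 / sqrt (s \<tau>)) * (M + \<tau> * \<phi> v)"
      unfolding x_def gl_dual_line[OF \<phi> u(1) v] min(2) ..
    finally show ?case
      unfolding s_def[symmetric] using elim by (simp add: field_simps)
  qed
qed

lemma isotropic_minimum: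
  assumes \<phi>: "gl_dual \<phi>" and w: "w \<in> W"
    and min: "is_arg_min \<phi> (\<lambda>v. v \<in> W) w" "\<phi> w = -1" and v: "v \<in> H0"
  shows "\<phi> v = pseudo_prod w v"
proof -
  have w': "w \<in> H" "pseudo_prod w e0 = 0" "pseudo_prod w w = -1" using w by (auto simp: W_def)
  have v': "v \<in> H" "pseudo_prod v e0 = 0"
    using v H0_H H0_trace[OF v] by (auto simp: pseudo_prod_e0)
  have "\<phi> v = (-1) * - pseudo_prod w v"
  proof (rule first_order_sqrt)
    define s where "s \<tau> = 1 + 2 * \<tau> * (- pseudo_prod w v) + \<tau>\<^sup>2 * (- pseudo_prod v v)" for \<tau>
    have "isCont s 0" unfolding s_def by (intro continuous_intros)
    then have "\<forall>\<^sub>F \<tau> in nhds 0. s \<tau> > 0"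
      by (rule eventually_nhds_pos) (simp add: s_def)
    then show "\<forall>\<^sub>F \<tau> in nhds 0. (-1) * sqrt (1 + 2 * \<tau> * (- pseudo_prod w v) + \<tau>\<^sup>2 * (- pseudo_prod v v)) \<le> -1 + \<tau> * \<phi> v"
    proof eventually_elim
      case (elim \<tau>)
      define x where "x = (1 / sqrt (s \<tau>)) *\<^sub>R (w + \<tau> *\<^sub>R v)"
      have "x \<in> H"
        unfolding x_def using w' v' by (intro subspace_scale[OF subspace_H] subspace_add[OF subspace_H])
      moreover have "pseudo_prod x x = -1"
      proof -
        have "pseudo_prod x x = (1 / sqrt (s \<tau>)) * ((1 / sqrt (s \<tau>)) * pseudo_prod (w + \<tau> *\<^sub>R v) (w + \<tau> *\<^sub>R v))"
          unfolding x_def pseudo_prod_scale_left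
          by (subst pseudo_prod_commute) (simp add: pseudo_prod_scale_left)
        also have "pseudo_prod (w + \<tau> *\<^sub>R v) (w + \<tau> *\<^sub>R v) = - s \<tau>"
          by (simp add: pseudo_prod_line w'(3) s_def)
        finally show ?thesis using elim by (simp add: field_simps)
      qed
      moreover have "pseudo_prod x e0 = 0"
        unfolding x_def pseudo_prod_scale_left pseudo_prod_add_left using w' v' by simp
      ultimately have "x \<in> W" by (simp add: W_def)
      then have "-1 \<le> \<phi> x"
        using min by (auto simp: is_arg_min_def not_less)
      also have "\<phi> x = (1 / sqrt (s \<tau>)) * (-1 + \<tau> * \<phi> v)"
        unfolding x_def gl_dual_line[OF \<phi> w'(1) v'(1)] min(2) ..
      finally show ?case
        unfolding s_def[symmetric] using elim by (simp add: field_simps)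
    qed
  qed
  then show ?thesis by simp
qed

lemma pseudo_prod_H_H0:
  assumes "u \<in> H" "w \<in> H0"
  shows "pseudo_prod u w = - 2 * (u \<bullet> w)"
proof -
  define c where "c = Re (trace u)"
  have "u - c *\<^sub>R e0 \<in> H0" unfolding c_def by (rule H_decomp[OF assms(1)])
  from pseudo_prod_H[OF this assms(2), of c 0]
  have "pseudo_prod u w = - 2 * ((u - c *\<^sub>R e0) \<bullet> w)" by simp
  moreover have "e0 \<bullet> w = 0" using assms(2) by (simp add: H0_iff inner_cmat2 e0_def)
  ultimately show ?thesis by (simp add: inner_diff_left)
qed

lemma pseudo_prod_H_self:
  assumes "u \<in> H"
  shows "pseudo_prod u u = (Re (trace u))\<^sup>2 - 2 * (norm (u - Re (trace u) *\<^sub>R e0))\<^sup>2"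
  using pseudo_prod_H0[OF H_decomp[OF assms], of "Re (trace u)"] by simp

text \<open>The value of \<open>\<psi>\<close> at the central element \<open>e0\<close> is constant by the adjoint equation, hence so is
  the component \<open>C\<close> of the control along \<open>e0\<close>; the speed \<open>\<sigma>\<close> of the traceless part follows from
  \<open>C\<^sup>2 - \<sigma>\<^sup>2 = 1\<close>.\<close>

lemma normal_timelike_structure:
  assumes "normal_timelike_extremal g" "g 0 = mat 1"
  obtains C \<sigma> \<gamma> u X where "SL_extremal \<gamma> u \<sigma> X" "\<gamma> 0 = mat 1" "\<And>t. g t = exp (C * t / 2) *\<^sub>R \<gamma> t"
    "C > 0" "C\<^sup>2 - \<sigma>\<^sup>2 = 1"
proof -
  obtain \<psi> M0 where fut: "future_directed_on UNIV g"
    and unit: "ae_on UNIV (\<lambda>t. pseudo_prod (control g t) (control g t) = 1)"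
    and M0: "M0 > 0" and dual: "\<And>t. gl_dual (\<psi> t)" and ac: "abs_continuous_covector \<psi>"
    and adjeq: "adjoint_equation g \<psi>"
    and min: "ae_on UNIV (\<lambda>t. is_arg_min (\<psi> t) (\<lambda>v. v \<in> U) (control g t) \<and> \<psi> t (control g t) = M0)"
    using assms(1) unfolding normal_timelike_extremal_def by blast
  have hor: "horizontal_on UNIV g" and fut': "ae_on UNIV (\<lambda>t. pseudo_prod (control g t) e0 > 0)"
    and H: "ae_on UNIV (\<lambda>t. g differentiable (at t) \<and> control g t \<in> H)"
    using fut by (auto simp: future_directed_on_def horizontal_on_def)
  have "ae_on UNIV (\<lambda>t. control g t \<in> H \<and> pseudo_prod (control g t) (control g t) = 1 \<and>
      pseudo_prod (control g t) e0 > 0 \<and> (\<forall>v\<in>H. \<psi> t v = M0 * pseudo_prod (control g t) v) \<and>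
      (\<forall>w\<in>gl_plus. ((\<lambda>s. \<psi> s w) has_real_derivative \<psi> t (lie_bracket (control g t) w)) (at t)))"
    using H unit fut' min adjeq[unfolded adjoint_equation_def]
  proof eventually_elim
    case (elim t)
    then show ?case using timelike_minimum[OF dual] by simp
  qed
  then obtain N where N: "negligible N" and p: "\<And>t. t \<notin> N \<Longrightarrow> control g t \<in> H \<and> pseudo_prod (control g t) (control g t) = 1 \<and>
      pseudo_prod (control g t) e0 > 0 \<and> (\<forall>v\<in>H. \<psi> t v = M0 * pseudo_prod (control g t) v) \<and>
      (\<forall>w\<in>gl_plus. ((\<lambda>s. \<psi> s w) has_real_derivative \<psi> t (lie_bracket (control g t) w)) (at t))"
    by (rule ae_on_UNIV_E) (rule that)
  define C where "C = \<psi> 0 e0 / M0"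
  have e0const: "\<psi> t e0 = \<psi> 0 e0" for t
  proof (rule AC_zero_deriv_const[OF _ N])
    have e0gl: "e0 \<in> gl_plus" using e0_H H_gl_plus by auto
    show "AC_on a b (\<lambda>t. \<psi> t e0)" for a b
      using ac e0gl unfolding AC_on_real abs_continuous_covector_def by blast
    fix t assume "t \<notin> N"
    moreover have "lie_bracket c e0 = 0" for c
      by (simp add: lie_bracket_def e0_half cmult.scaleR_left cmult.scaleR_right)
    ultimately show "((\<lambda>t. \<psi> t e0) has_vector_derivative 0) (at t)"
      using p[of t] e0gl gl_dual_zero[OF dual[of t]]
      by (auto simp: has_real_derivative_iff_has_vector_derivative)
  qed
  have tr: "Re (trace (control g t)) = C" if "t \<notin> N" for t
    using p[OF that] e0const[of t] e0_H M0
    by (simp add: C_def pseudo_prod_e0 nonzero_eq_divide_eq mult.commute)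
  have C2: "2 * (norm (control g t - C *\<^sub>R e0))\<^sup>2 = C\<^sup>2 - 1" if "t \<notin> N" for t
    using p[OF that] pseudo_prod_H_self[of "control g t"] tr[OF that] by simp
  have "N \<noteq> UNIV" using N by auto
  then obtain t0 where "t0 \<notin> N" by blast
  then have "C > 0" using p[of t0] tr[of t0] by (simp add: pseudo_prod_e0)
  have "C\<^sup>2 - 1 \<ge> 0" using C2[OF \<open>t0 \<notin> N\<close>, symmetric] by simp
  define \<sigma> where "\<sigma> = sqrt (C\<^sup>2 - 1)"
  have \<sigma>: "\<sigma> \<ge> 0" "\<sigma>\<^sup>2 = C\<^sup>2 - 1" using \<open>C\<^sup>2 - 1 \<ge> 0\<close> by (simp_all add: \<sigma>_def)
  have ae: "ae_on UNIV (\<lambda>t. (\<forall>w\<in>H0. \<psi> t w = - 2 * M0 * (control g t \<bullet> w)) \<and>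
       Re (trace (control g t)) = C \<and> 2 * (norm (control g t - C *\<^sub>R e0))\<^sup>2 = \<sigma>\<^sup>2)"
  proof (rule ae_onI[OF N])
    fix t assume "t \<in> interior UNIV - N"
    then have t: "t \<notin> N" by simp
    have min: "\<psi> t w = - 2 * M0 * (control g t \<bullet> w)" if "w \<in> H0" for w
      using p[OF t] H0_H that pseudo_prod_H_H0[of "control g t" w] by auto
    show "(\<forall>w\<in>H0. \<psi> t w = - 2 * M0 * (control g t \<bullet> w)) \<and>
       Re (trace (control g t)) = C \<and> 2 * (norm (control g t - C *\<^sub>R e0))\<^sup>2 = \<sigma>\<^sup>2"
      unfolding \<sigma>(2) using min tr[OF t] C2[OF t] by blast
  qed
  show thesis
    by (rule extremal_structure[OF assms(2) hor dual ac adjeq M0 \<sigma>(1) ae], rule that)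
      (use \<open>C > 0\<close> \<sigma>(2) in auto)
qed

lemma normal_isotropic_structure:
  assumes "normal_isotropic_extremal g" "g 0 = mat 1"
  obtains \<gamma> u X where "SL_extremal \<gamma> u 1 X" "\<gamma> 0 = mat 1" "\<And>t. g t = exp (1 * t / 2) *\<^sub>R \<gamma> t"
proof -
  obtain \<psi> where fut: "future_directed_on UNIV g"
    and W: "ae_on UNIV (\<lambda>t. control g t - e0 \<in> W)"
    and dual: "\<And>t. gl_dual (\<psi> t)" and ac: "abs_continuous_covector \<psi>"
    and adjeq: "adjoint_equation g \<psi>"
    and min: "ae_on UNIV (\<lambda>t. is_arg_min (\<psi> t) (\<lambda>v. v \<in> W) (control g t - e0) \<and> \<psi> t (control g t - e0) = -1)"
    using assms(1) unfolding normal_isotropic_extremal_def by blast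
  have hor: "horizontal_on UNIV g" using fut by (simp add: future_directed_on_def)
  have ae: "ae_on UNIV (\<lambda>t. (\<forall>w\<in>H0. \<psi> t w = - 2 * 1 * (control g t \<bullet> w)) \<and>
       Re (trace (control g t)) = 1 \<and> 2 * (norm (control g t - 1 *\<^sub>R e0))\<^sup>2 = 1\<^sup>2)"
    using W min
  proof eventually_elim
    case (elim t)
    define w where "w = control g t - e0"
    have w: "w \<in> W" "is_arg_min (\<psi> t) (\<lambda>v. v \<in> W) w" "\<psi> t w = -1" using elim by (auto simp: w_def)
    have w': "w \<in> H" "Re (trace w) = 0" "pseudo_prod w w = -1"
      using w(1) by (auto simp: W_def pseudo_prod_e0)
    have c: "control g t = e0 + w" by (simp add: w_def)
    have "\<psi> t v = - 2 * 1 * (control g t \<bullet> v)" if v: "v \<in> H0" for v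
    proof -
      have "e0 \<bullet> v = 0" using v by (simp add: H0_iff inner_cmat2 e0_def)
      then show ?thesis
        using isotropic_minimum[OF dual w v] pseudo_prod_H_H0[OF w'(1) v] by (simp add: c inner_add_left)
    qed
    moreover have "Re (trace (control g t)) = 1"
      using w'(2) by (simp add: c trace_cmat2 e0_def)
    moreover have "2 * (norm (control g t - 1 *\<^sub>R e0))\<^sup>2 = 1\<^sup>2"
      using pseudo_prod_H_self[OF w'(1)] w' by (simp add: c)
    ultimately show ?case by blast
  qed
  show thesis
    by (rule extremal_structure[OF assms(2) hor dual ac adjeq zero_less_one zero_le_one ae]) (rule that)
qed

lemma SL_extremal_reparametrize:
  assumes "SL_extremal \<gamma> u \<sigma> X" "\<kappa> > 0"
  shows "SL_extremal (\<lambda>t. \<gamma> (\<kappa> * t)) (\<lambda>t. \<kappa> *\<^sub>R u (\<kappa> * t)) (\<kappa> * \<sigma>) (\<kappa> *\<^sub>R X)"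
proof -
  interpret SL_extremal \<gamma> u \<sigma> X by fact
  interpret r: SL_curve "\<lambda>t. \<gamma> (\<kappa> * t)" "\<lambda>t. \<kappa> *\<^sub>R u (\<kappa> * t)" "\<kappa> * \<sigma>"
    by (rule reparametrize[OF assms(2)])
  show ?thesis
    by unfold_locales (simp add: extremal cmult.scaleR_left cmult.scaleR_right)
qed

section \<open>Normal extremals of GL+(2)\<close>

theorem theorem8:
  fixes g :: "real \<Rightarrow> complex^2^2"
  assumes "normal_extremal g" and "g 0 = mat 1"
  shows "(GL_geodesic g \<and>
            ((\<forall>t. g t = exp (t / 2) *\<^sub>R mat 1) \<or> (\<exists>\<kappa> \<gamma>. lifts_SL_geodesic g \<kappa> \<gamma>))) \<and>
         (\<forall>\<kappa> \<gamma>. lifts_SL_geodesic g \<kappa> \<gamma> \<longrightarrow>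
            (\<forall>t0>0. longest_arc (\<lambda>t. exp (t / 2) *\<^sub>R \<gamma> t) 0 t0 \<longleftrightarrow> shortest_arc \<gamma> 0 t0)) \<and>
         (\<forall>k>0. longest_arc g 0 k \<longrightarrow>
            (\<forall>t\<in>{0..k}. g t = exp (t / 2) *\<^sub>R mat 1) \<or>
            (timelike_on {0..k} g \<and>
              (\<exists>c>0. \<exists>\<gamma>. shortest_arc \<gamma> 0 (k * sinh c) \<and>
                 arclength_param_on {0..k * sinh c} 1 \<gamma> \<and> \<gamma> 0 = mat 1 \<and>
                 (\<forall>t\<in>{0..k}. g t = exp (cosh c * t / 2) *\<^sub>R \<gamma> (sinh c * t)))) \<or>
            (isotropic_on {0..k} g \<and>
              (\<exists>\<gamma>. shortest_arc \<gamma> 0 k \<and> arclength_param_on {0..k} 1 \<gamma> \<and> \<gamma> 0 = mat 1 \<and>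
                 (\<forall>t\<in>{0..k}. g t = exp (t / 2) *\<^sub>R \<gamma> t))))"
proof -
  obtain C \<sigma> \<gamma> u X where extr: "SL_extremal \<gamma> u \<sigma> X" and \<gamma>0: "\<gamma> 0 = mat 1"
    and g: "\<And>t. g t = exp (C * t / 2) *\<^sub>R \<gamma> t"
    and C: "C > 0" "C\<^sup>2 - \<sigma>\<^sup>2 = 1 \<or> C = 1 \<and> \<sigma> = 1"
  proof (cases "normal_timelike_extremal g")
    case True
    show thesis
      by (rule normal_timelike_structure[OF True assms(2)]) (rule that, auto)
  next
    case False
    then have iso: "normal_isotropic_extremal g" using assms(1) by (simp add: normal_extremal_def)
    obtain \<gamma> u X where "SL_extremal \<gamma> u 1 X" "\<gamma> 0 = mat 1" "\<And>t. g t = exp (1 * t / 2) *\<^sub>R \<gamma> t"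
      by (rule normal_isotropic_structure[OF iso assms(2)]) (rule that)
    then show thesis by (intro that[of \<gamma> u 1 X 1]) auto
  qed
  interpret SL_extremal \<gamma> u \<sigma> X by fact
  have s0: "\<sigma> \<ge> 0" by (rule speed_nonneg)
  have \<sigma>C: "\<sigma> \<le> C"
  proof (rule power2_le_imp_le)
    show "\<sigma>\<^sup>2 \<le> C\<^sup>2" using C(2) by auto
  qed (use C in simp)
  have gl: "g = lift C" by (rule ext) (simp add: g lift_def)
  have geo: "GL_geodesic g"
    unfolding GL_geodesic_def
  proof (intro conjI allI)
    show "lipschitzian_on UNIV g"
      using lift_horizontal[of UNIV C] by (simp add: gl horizontal_on_def)
    fix t
    obtain \<epsilon> where "\<epsilon> > 0" "shortest_arc \<gamma> (t - \<epsilon>) (t + \<epsilon>)" using locally_shortest by blast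
    then show "\<exists>\<epsilon>>0. longest_arc g (t - \<epsilon>) (t + \<epsilon>)"
      unfolding gl using longest_arc_lift[OF C(1) \<sigma>C] by blast
  qed
  have still: "g t = exp (t / 2) *\<^sub>R mat 1" if "\<sigma> = 0" for t
  proof -
    have "u t = 0" for t using speed[of t] that by simp
    then have "(\<gamma> has_vector_derivative 0) (at t)" for t
      using deriv[of t] by (simp add: cmult.zero_right)
    then have "\<gamma> t = \<gamma> 0" for t
      using lipschitzian_AC[of \<gamma>] horizontal[of UNIV]
      by (intro AC_zero_deriv_const[of _ "{}"]) (auto simp: SL_horizontal_on_def)
    moreover have "C\<^sup>2 = 1\<^sup>2" using that C(2) by auto
    then have "C = 1" by (rule power2_eq_imp_eq) (use C(1) in simp_all)
    ultimately show ?thesis by (simp add: g \<gamma>0)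
  qed
  have lifts: "\<exists>\<kappa> \<gamma>. lifts_SL_geodesic g \<kappa> \<gamma>" if "\<sigma> > 0"
  proof (intro exI)
    define \<kappa> where "\<kappa> = 1 / C"
    have \<kappa>: "\<kappa> > 0" "C * \<kappa> = 1" using C by (simp_all add: \<kappa>_def)
    interpret r: SL_extremal "\<lambda>t. \<gamma> (\<kappa> * t)" "\<lambda>t. \<kappa> *\<^sub>R u (\<kappa> * t)" "\<kappa> * \<sigma>" "\<kappa> *\<^sub>R X"
      by (rule SL_extremal_reparametrize[OF extr \<kappa>(1)])
    have le: "\<kappa> * \<sigma> \<le> 1" using \<sigma>C C by (simp add: \<kappa>_def)
    have l1: "r.lift 1 = (\<lambda>t. exp (t / 2) *\<^sub>R \<gamma> (\<kappa> * t))" by (simp add: fun_eq_iff r.lift_def)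
    show "lifts_SL_geodesic g \<kappa> (\<lambda>t. \<gamma> (\<kappa> * t))"
      unfolding lifts_SL_geodesic_def
    proof (intro conjI allI)
      show "g (\<kappa> * t) = exp (t / 2) *\<^sub>R \<gamma> (\<kappa> * t)" for t
        using \<kappa>(2) by (simp add: g flip: mult.assoc)
      show "future_directed_on UNIV (\<lambda>t. exp (t / 2) *\<^sub>R \<gamma> (\<kappa> * t))"
        using r.lift_future_directed[of 1] by (simp add: l1)
      show "nonspacelike_on UNIV (\<lambda>t. exp (t / 2) *\<^sub>R \<gamma> (\<kappa> * t))"
        using r.lift_nonspacelike[OF le] by (simp add: l1)
      show "SL_geodesic (\<lambda>t. \<gamma> (\<kappa> * t))"
        unfolding SL_geodesic_def using r.locally_shortest by blast
      show "\<exists>\<sigma>>0. arclength_param_on UNIV \<sigma> (\<lambda>t. \<gamma> (\<kappa> * t))"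
        using r.arclength[of UNIV] that \<kappa>(1) by (intro exI[of _ "\<kappa> * \<sigma>"]) simp
    qed (use \<kappa> \<gamma>0 in auto)
  qed
  have part2: "longest_arc (\<lambda>t. exp (t / 2) *\<^sub>R \<gamma>' t) 0 t0 \<longleftrightarrow> shortest_arc \<gamma>' 0 t0"
    if L: "lifts_SL_geodesic g \<kappa> \<gamma>'" and "t0 > 0" for \<kappa> \<gamma>' t0
  proof -
    have \<kappa>: "\<kappa> > 0" and g': "\<And>t. g (\<kappa> * t) = exp (t / 2) *\<^sub>R \<gamma>' t" and geo': "SL_geodesic \<gamma>'"
      using L by (simp_all add: lifts_SL_geodesic_def)
    obtain \<sigma>' where \<sigma>': "\<sigma>' > 0" "arclength_param_on UNIV \<sigma>' \<gamma>'"
      using L unfolding lifts_SL_geodesic_def by blast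
    have det': "det (\<gamma>' t) = 1" for t
    proof -
      obtain \<epsilon> where "\<epsilon> > 0" "shortest_arc \<gamma>' (t - \<epsilon>) (t + \<epsilon>)"
        using geo' unfolding SL_geodesic_def by blast
      then have "\<gamma>' ` {t - \<epsilon>..t + \<epsilon>} \<subseteq> SL" "t \<in> {t - \<epsilon>..t + \<epsilon>}"
        by (auto simp: shortest_arc_def SL_horizontal_on_def)
      then show ?thesis unfolding SL_def by blast
    qed
    have "det (g (\<kappa> * 1)) = of_real ((exp (C * (\<kappa> * 1) / 2))\<^sup>2)"
      unfolding g det_scaleR_cmat2 det by simp
    moreover have "det (g (\<kappa> * 1)) = of_real ((exp (1 / 2))\<^sup>2)"
      unfolding g' det_scaleR_cmat2 det' by simp
    ultimately have "(exp (C * \<kappa> / 2))\<^sup>2 = (exp (1 / 2 :: real))\<^sup>2"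
      by (simp only: of_real_eq_iff mult_1_right)
    then have C\<kappa>: "C * \<kappa> = 1"
      by (simp add: power2_eq_iff_nonneg)
    have \<gamma>': "\<gamma>' = (\<lambda>t. \<gamma> (\<kappa> * t))"
    proof
      fix t
      have "exp (t / 2) *\<^sub>R \<gamma>' t = exp (t / 2) *\<^sub>R \<gamma> (\<kappa> * t)"
        using g'[of t] C\<kappa> by (simp add: g flip: mult.assoc)
      then show "\<gamma>' t = \<gamma> (\<kappa> * t)" by simp
    qed
    interpret r: SL_curve "\<lambda>t. \<gamma> (\<kappa> * t)" "\<lambda>t. \<kappa> *\<^sub>R u (\<kappa> * t)" "\<kappa> * \<sigma>"
      by (rule reparametrize[OF \<kappa>])
    have "riem_length \<gamma>' 0 1 = \<sigma>'" using \<sigma>'(2) by (simp add: arclength_param_on_def)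
    then have pos: "\<kappa> * \<sigma> > 0" using r.riem_length[of 0 1] \<sigma>'(1) by (simp add: \<gamma>')
    have "\<kappa> = 1 / C" using C\<kappa> C(1) by (simp add: field_simps)
    then have le: "\<kappa> * \<sigma> \<le> 1" using \<sigma>C C(1) by simp
    have l1: "r.lift 1 = (\<lambda>t. exp (t / 2) *\<^sub>R \<gamma> (\<kappa> * t))" by (simp add: fun_eq_iff r.lift_def)
    show ?thesis
      using r.longest_arc_lift[OF zero_less_one le, of 0 t0] r.shortest_arc_of_longest_lift[OF pos le, of 0 t0]
      unfolding l1 \<gamma>' by blast
  qed
  have part3: "(\<forall>t\<in>{0..k}. g t = exp (t / 2) *\<^sub>R mat 1) \<or>
            (timelike_on {0..k} g \<and>
              (\<exists>c>0. \<exists>\<gamma>. shortest_arc \<gamma> 0 (k * sinh c) \<and>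
                 arclength_param_on {0..k * sinh c} 1 \<gamma> \<and> \<gamma> 0 = mat 1 \<and>
                 (\<forall>t\<in>{0..k}. g t = exp (cosh c * t / 2) *\<^sub>R \<gamma> (sinh c * t)))) \<or>
            (isotropic_on {0..k} g \<and>
              (\<exists>\<gamma>. shortest_arc \<gamma> 0 k \<and> arclength_param_on {0..k} 1 \<gamma> \<and> \<gamma> 0 = mat 1 \<and>
                 (\<forall>t\<in>{0..k}. g t = exp (t / 2) *\<^sub>R \<gamma> t)))"
    if k: "k > 0" and longest: "longest_arc g 0 k" for k
  proof (cases "\<sigma> = 0")
    case True
    then show ?thesis using still by blast
  next
    case False
    then have pos: "\<sigma> > 0" using s0 by simp
    have short: "shortest_arc \<gamma> 0 k"
      using longest by (intro shortest_arc_of_longest_lift[OF pos \<sigma>C]) (simp add: gl)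
    show ?thesis
    proof (cases "C\<^sup>2 - \<sigma>\<^sup>2 = 1")
      case True
      define c where "c = arsinh \<sigma>"
      have c: "c > 0" "sinh c = \<sigma>" using pos by (simp_all add: c_def)
      have "(cosh c)\<^sup>2 = C\<^sup>2" using True c(2) by (simp add: cosh_square_eq)
      then have cC: "cosh c = C" using C(1) by (simp add: power2_eq_iff_nonneg)
      have "1 / \<sigma> > 0" using pos by simp
      interpret r: SL_curve "\<lambda>t. \<gamma> (1 / \<sigma> * t)" "\<lambda>t. (1 / \<sigma>) *\<^sub>R u (1 / \<sigma> * t)" "1 / \<sigma> * \<sigma>"
        by (rule reparametrize[OF \<open>1 / \<sigma> > 0\<close>])
      have "shortest_arc (\<lambda>t. \<gamma> (1 / \<sigma> * t)) 0 (k * sinh c)"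
        using short pos k unfolding r.shortest_arc_iff shortest_arc_iff c(2) by (simp add: mult.commute)
      moreover have "arclength_param_on {0..k * sinh c} 1 (\<lambda>t. \<gamma> (1 / \<sigma> * t))"
        using r.arclength pos by simp
      moreover have "\<gamma> (1 / \<sigma> * 0) = mat 1" by (simp add: \<gamma>0)
      moreover have "\<forall>t\<in>{0..k}. g t = exp (cosh c * t / 2) *\<^sub>R \<gamma> (1 / \<sigma> * (sinh c * t))"
        using pos by (simp add: g cC c(2))
      moreover have "timelike_on {0..k} g"
      proof -
        have "\<sigma> < C" using True \<sigma>C by (cases "\<sigma> = C") auto
        then show ?thesis using lift_timelike by (simp add: gl)
      qed
      ultimately show ?thesis using c(1)
        by (intro disjI2 disjI1 conjI exI[of _ c] exI[of _ "\<lambda>t. \<gamma> (1 / \<sigma> * t)"])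
    next
      case False
      then have "C = 1" "\<sigma> = 1" using C(2) by auto
      moreover have "isotropic_on {0..k} g"
        using lift_isotropic[OF C(1)] calculation by (simp add: gl)
      moreover have "arclength_param_on {0..k} 1 \<gamma>"
        using arclength[of "{0..k}"] \<open>\<sigma> = 1\<close> by simp
      ultimately show ?thesis using short \<gamma>0 g by auto
    qed
  qed
  have "(\<forall>t. g t = exp (t / 2) *\<^sub>R mat 1) \<or> (\<exists>\<kappa> \<gamma>. lifts_SL_geodesic g \<kappa> \<gamma>)"
    using still lifts s0 by (cases "\<sigma> = 0") auto
  then show ?thesis
    by (intro conjI geo allI impI part2 part3)
qed

end
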